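(* Let $n\ge 1$. Let $D\subset\mathbb{RP}^n$ be an open properly convex set. Then its elliptic tube $D^e$ (viewed as an open subset of an affine chart $\mathbb{C}^n=\mathbb{CP}^n\setminus H^{\mathbb{C}}$, where $H\subset\mathbb{RP}^n$ is a real projective hyperplane disjoint from $D$ and $H^{\mathbb{C}}$ is its complexification) is pseudoconvex, holomorphically convex, a domain of holomorphy, polynomially convex, a Runge domain, and it is convex with respect to the linear fractions. Let $D\subset\mathbb{RP}^n$ be a compact properly convex set. Then $D^e$ (viewed as a compact subset of such an affine chart) is polynomially convex.
   Context: A set $E\subset\mathbb{RP}^n$ is convex if it contains no projective line and its intersection with every projective line is connected. A convex set $E\subset\mathbb{RP}^n$ is properly convex if it is not contained in a projective hyperplane and contains no affine line (a projective line minus a point). Elliptic tubes: regard $\mathbb{RP}^n\subset\mathbb{CP}^n$ and write $\pi$ for the projections $\mathbb{R}^{n+1}\setminus\{0\}\to\mathbb{RP}^n$, $\mathbb{C}^{n+1}\setminus\{0\}\to\mathbb{CP}^n$. A closed segment $I\subset\mathbb{RP}^n$ with endpoints $a_0,a_1$ can be written as $I=\pi(\{c_0v_0+c_1v_1\neq 0 : c_0,c_1\in\mathbb{R},\ c_0c_1\ge 0\})$ for suitable $v_0,v_1\in\mathbb{R}^{n+1}$ with $\pi(v_i)=a_i$; put $I^e=\pi(\{c_0v_0+c_1v_1\neq 0 : c_0,c_1\in\mathbb{C},\ \mathrm{Re}(c_0\overline{c_1})\ge 0\})$. For $D\subset\mathbb{RP}^n$, the elliptic tube is $D^e=\bigcup\{I^e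 : I\subset D \text{ a closed segment}\}\subset\mathbb{CP}^n$. If $D$ is contained in an affine chart $\mathbb{RP}^n\setminus H$, then $D^e\subset\mathbb{CP}^n\setminus H^{\mathbb{C}}$; $D^e$ is open (resp. closed) if $D$ is. A compact $K\subset\mathbb{C}^n$ is polynomially convex if it equals its polynomial hull $\widehat K=\{z\in\mathbb{C}^n : |P(z)|\le\max_K|P| \text{ for all polynomials } P\}$. An open $E\subset\mathbb{C}^n$ is polynomially convex if $\widehat K\cap E$ is compact for every compact $K\subset E$. An open $E\subset\mathbb{C}^n$ is a Runge domain if polynomials are dense in the space of holomorphic functions on $E$ for locally uniform convergence. A linear fraction is a quotient of two complex affine functions; an open $E\subset\mathbb{C}^n$ is convex with respect to the linear fractions if for every compact $K\subset E$ the set $\{z\in E : |f(z)|\le\max_K|f| \text{ for all linear fractions } f \text{ whose denominator has no zero on } E\}$ is compact. *)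

theory Defs
  imports "HOL-Analysis.Analysis"
begin

section \<open>Projective space\<close>

definition proj_rel :: "'a::field ^ ('n::finite option) \<Rightarrow> 'a ^ ('n option) \<Rightarrow> bool" where
  "proj_rel v w \<longleftrightarrow> v \<noteq> 0 \<and> w \<noteq> 0 \<and> (\<exists>c. w = c *s v)"

text \<open>Homogeneous coordinates are indexed by \<^typ>\<open>'n option\<close>, so that
  \<open>('a, 'n) projective\<close> is the projective space of dimension \<open>n = CARD('n)\<close> over \<open>'a\<close>
  and its affine charts are \<open>'a ^ 'n\<close>. As types are nonempty, \<open>n \<ge> 1\<close>.\<close>

quotient_type (overloaded) ('a, 'n) projective = "'a::field ^ ('n::finite option)" / partial: proj_rel
  morphisms rep_proj proj
proof (rule part_equivpI)
  have "proj_rel (axis None 1 :: 'a ^ ('n option)) (axis None 1)"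
    unfolding proj_rel_def by (metis axis_eq_0_iff one_neq_zero vector_smult_lid)
  then show "\<exists>v :: 'a ^ ('n option). proj_rel v v" by blast
  show "symp (proj_rel :: 'a ^ ('n option) \<Rightarrow> _)"
  proof (rule sympI)
    fix v w :: "'a ^ ('n option)"
    assume a: "proj_rel v w"
    then obtain c where c: "w = c *s v" by (auto simp: proj_rel_def)
    with a have "c \<noteq> 0" by (auto simp: proj_rel_def)
    then have "v = inverse c *s w" by (simp add: c vector_smult_assoc)
    with a show "proj_rel w v" by (auto simp: proj_rel_def)
  qed
  show "transp (proj_rel :: 'a ^ ('n option) \<Rightarrow> _)"
    by (rule transpI) (auto simp: proj_rel_def vector_smult_assoc)
qed

lemma proj_eq_iff:
  assumes "v \<noteq> 0" "w \<noteq> 0"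
  shows "proj v = proj w \<longleftrightarrow> (\<exists>c. w = c *s v)"
  using Quotient3_rel[OF Quotient3_projective, of v w] assms
  by (auto simp: proj_rel_def) (metis vector_smult_lid)+

lemma proj_cases:
  obtains v where "v \<noteq> 0" "p = proj v"
  by (metis Quotient3_projective Quotient3_abs_rep Quotient3_rep_reflp proj_rel_def)

instantiation projective :: (real_normed_field, finite) topological_space
begin

text \<open>The quotient topology of the nonzero vectors.\<close>

definition open_projective :: "('a, 'b) projective set \<Rightarrow> bool" where
  "open_projective U \<longleftrightarrow> open {v. v \<noteq> 0 \<and> proj v \<in> U}"

instance
proof
  have "{v :: 'a ^ ('b option). v \<noteq> 0} = - {0}" by auto
  then show "open (UNIV :: ('a, 'b) projective set)"
    unfolding open_projective_def by (simp add: open_Compl)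
next
  fix S T :: "('a, 'b) projective set"
  assume "open S" "open T"
  moreover have "{v. v \<noteq> 0 \<and> proj v \<in> S \<inter> T} =
      {v. v \<noteq> 0 \<and> proj v \<in> S} \<inter> {v. v \<noteq> 0 \<and> proj v \<in> T}" by auto
  ultimately show "open (S \<inter> T)"
    unfolding open_projective_def by (simp add: open_Int)
next
  fix K :: "('a, 'b) projective set set"
  assume "\<forall>S\<in>K. open S"
  moreover have "{v. v \<noteq> 0 \<and> proj v \<in> \<Union>K} = (\<Union>S\<in>K. {v. v \<noteq> 0 \<and> proj v \<in> S})" by auto
  ultimately show "open (\<Union>K)"
    unfolding open_projective_def by (simp add: open_UN)
qed

end

definition proj_hyperplane :: "'a::field ^ ('n::finite option) \<Rightarrow> ('a, 'n) projective set" where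
  "proj_hyperplane l = {proj v | v. v \<noteq> 0 \<and> (\<Sum>i\<in>UNIV. l $ i * v $ i) = 0}"

definition projective_line :: "(real, 'n::finite) projective set \<Rightarrow> bool" where
  "projective_line L \<longleftrightarrow> (\<exists>S. subspace S \<and> dim S = 2 \<and> L = proj ` (S - {0}))"

definition projective_convex :: "(real, 'n::finite) projective set \<Rightarrow> bool" where
  "projective_convex E \<longleftrightarrow>
     (\<forall>L. projective_line L \<longrightarrow> \<not> L \<subseteq> E \<and> connected (E \<inter> L))"

definition properly_convex :: "(real, 'n::finite) projective set \<Rightarrow> bool" where
  "properly_convex E \<longleftrightarrow>
     projective_convex E \<and>
     (\<forall>l. l \<noteq> 0 \<longrightarrow> \<not> E \<subseteq> proj_hyperplane l) \<and>
     (\<forall>L p. projective_line L \<and> p \<in> L \<longrightarrow> \<not> L - {p} \<subseteq> E)"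


section \<open>Elliptic tubes\<close>

definition complex_vec :: "real ^ 'm::finite \<Rightarrow> complex ^ 'm" where
  "complex_vec v = (\<chi> i. complex_of_real (v $ i))"

definition proj_segment :: "real ^ ('n::finite option) \<Rightarrow> real ^ ('n option) \<Rightarrow> (real, 'n) projective set" where
  "proj_segment v0 v1 =
     {proj (c0 *s v0 + c1 *s v1) | c0 c1. c0 * c1 \<ge> 0 \<and> c0 *s v0 + c1 *s v1 \<noteq> 0}"

text \<open>The set depends only on the segment \<open>proj_segment v0 v1\<close>: this segment determines
  independent \<open>v0\<close> and \<open>v1\<close> up to order and up to real factors of equal sign.\<close>

definition elliptic_segment ::
    "real ^ ('n::finite option) \<Rightarrow> real ^ ('n option) \<Rightarrow> (complex, 'n) projective set" where
  "elliptic_segment v0 v1 =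
     {proj (c0 *s complex_vec v0 + c1 *s complex_vec v1) | c0 c1.
        Re (c0 * cnj c1) \<ge> 0 \<and> c0 *s complex_vec v0 + c1 *s complex_vec v1 \<noteq> 0}"

text \<open>Dependent \<open>v0\<close> and \<open>v1\<close> are allowed; both segments are then the same single point.\<close>

definition elliptic_tube :: "(real, 'n::finite) projective set \<Rightarrow> (complex, 'n) projective set" where
  "elliptic_tube D =
     \<Union> {elliptic_segment v0 v1 | v0 v1. v0 \<noteq> 0 \<and> v1 \<noteq> 0 \<and> proj_segment v0 v1 \<subseteq> D}"


section \<open>Affine charts\<close>

definition homogenize :: "complex ^ 'n::finite \<Rightarrow> complex ^ ('n option)" where
  "homogenize z = (\<chi> i. case i of None \<Rightarrow> 1 | Some j \<Rightarrow> z $ j)"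

text \<open>\<open>\<phi>\<close> is an identification of \<open>\<complex>\<^sup>n\<close> with the complement of the hyperplane \<open>l = 0\<close> that is the
  restriction of a projective transformation; two of them differ by an affine
  automorphism of \<open>\<complex>\<^sup>n\<close>.\<close>

definition affine_chart ::
    "complex ^ ('n::finite option) \<Rightarrow> (complex ^ 'n \<Rightarrow> (complex, 'n) projective) \<Rightarrow> bool" where
  "affine_chart l \<phi> \<longleftrightarrow>
     (\<exists>A :: complex ^ ('n option) ^ ('n option).
        invertible A \<and> \<phi> = (\<lambda>z. proj (A *v homogenize z))) \<and>
     range \<phi> = - proj_hyperplane l"


section \<open>Several complex variables\<close>

definition holomorphic_in :: "(complex ^ 'n::finite \<Rightarrow> complex) \<Rightarrow> (complex ^ 'n) set \<Rightarrow> bool" where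
  "holomorphic_in f E \<longleftrightarrow>
     (\<forall>z\<in>E. \<exists>f'. (f has_derivative f') (at z) \<and> (\<forall>c v. f' (c *s v) = c * f' v))"

definition polynomial_Cn :: "(complex ^ 'n::finite \<Rightarrow> complex) \<Rightarrow> bool" where
  "polynomial_Cn P \<longleftrightarrow>
     (\<exists>(F :: ('n \<Rightarrow> nat) set) a. finite F \<and> P = (\<lambda>z. \<Sum>\<alpha>\<in>F. a \<alpha> * (\<Prod>i\<in>UNIV. (z $ i) ^ \<alpha> i)))"

text \<open>The functions are quotients on \<open>E\<close>; the denominators have no zero there.\<close>

definition linear_fraction_in :: "(complex ^ 'n::finite \<Rightarrow> complex) \<Rightarrow> (complex ^ 'n) set \<Rightarrow> bool" where
  "linear_fraction_in f E \<longleftrightarrow>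
     (\<exists>a b c d. (\<forall>z\<in>E. (\<Sum>i\<in>UNIV. c $ i * z $ i) + d \<noteq> 0) \<and>
        f = (\<lambda>z. ((\<Sum>i\<in>UNIV. a $ i * z $ i) + b) / ((\<Sum>i\<in>UNIV. c $ i * z $ i) + d)))"

text \<open>For compact \<open>K\<close> and continuous \<open>f\<close> the inner condition says that \<open>\<bar>f z\<bar>\<close> is at most the maximum
  of \<open>\<bar>f\<bar>\<close> on \<open>K\<close>; the hull of the empty set is empty.\<close>

definition hull_wrt ::
    "('a \<Rightarrow> complex) set \<Rightarrow> 'a set \<Rightarrow> 'a set \<Rightarrow> 'a set" where
  "hull_wrt \<F> E K = {z \<in> E. \<forall>f\<in>\<F>. \<exists>w\<in>K. norm (f z) \<le> norm (f w)}"

definition polynomial_hull :: "(complex ^ 'n::finite) set \<Rightarrow> (complex ^ 'n) set" where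
  "polynomial_hull K = hull_wrt {P. polynomial_Cn P} UNIV K"

definition compact_polynomially_convex :: "(complex ^ 'n::finite) set \<Rightarrow> bool" where
  "compact_polynomially_convex K \<longleftrightarrow> compact K \<and> polynomial_hull K = K"

definition open_polynomially_convex :: "(complex ^ 'n::finite) set \<Rightarrow> bool" where
  "open_polynomially_convex E \<longleftrightarrow>
     open E \<and> (\<forall>K. compact K \<and> K \<subseteq> E \<longrightarrow> compact (polynomial_hull K \<inter> E))"

definition holomorphically_convex :: "(complex ^ 'n::finite) set \<Rightarrow> bool" where
  "holomorphically_convex E \<longleftrightarrow>
     open E \<and> (\<forall>K. compact K \<and> K \<subseteq> E \<longrightarrow> compact (hull_wrt {f. holomorphic_in f E} E K))"

definition linear_fraction_convex :: "(complex ^ 'n::finite) set \<Rightarrow> bool" where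
  "linear_fraction_convex E \<longleftrightarrow>
     open E \<and> (\<forall>K. compact K \<and> K \<subseteq> E \<longrightarrow> compact (hull_wrt {f. linear_fraction_in f E} E K))"

text \<open>On the locally compact \<open>E\<close>, locally uniform convergence is uniform convergence on compact sets.\<close>

definition Runge_domain :: "(complex ^ 'n::finite) set \<Rightarrow> bool" where
  "Runge_domain E \<longleftrightarrow>
     open E \<and>
     (\<forall>f K \<epsilon>. holomorphic_in f E \<and> compact K \<and> K \<subseteq> E \<and> \<epsilon> > 0 \<longrightarrow>
        (\<exists>P. polynomial_Cn P \<and> (\<forall>z\<in>K. norm (f z - P z) < \<epsilon>)))"

text \<open>A domain is a nonempty connected open set. It is a domain of holomorphy if there are no
  open \<open>U\<close> and \<open>V\<close> such that every function holomorphic in \<open>E\<close> agrees on \<open>U\<close> with a function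
  holomorphic in \<open>V\<close>.\<close>

definition domain_of_holomorphy :: "(complex ^ 'n::finite) set \<Rightarrow> bool" where
  "domain_of_holomorphy E \<longleftrightarrow>
     open E \<and> connected E \<and> E \<noteq> {} \<and>
     \<not> (\<exists>U V. open U \<and> open V \<and> U \<noteq> {} \<and> U \<subseteq> V \<inter> E \<and> connected V \<and> \<not> V \<subseteq> E \<and>
          (\<forall>f. holomorphic_in f E \<longrightarrow>
             (\<exists>g. holomorphic_in g V \<and> (\<forall>z\<in>U. f z = g z))))"

text \<open>Subharmonicity on complex lines is expressed by the sub-mean value inequality over circles that
  bound a disc in \<open>E\<close>.\<close>

definition continuous_plurisubharmonic :: "(complex ^ 'n::finite \<Rightarrow> real) \<Rightarrow> (complex ^ 'n) set \<Rightarrow> bool" where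
  "continuous_plurisubharmonic u E \<longleftrightarrow>
     continuous_on E u \<and>
     (\<forall>z w. (\<forall>\<tau>::complex. norm \<tau> \<le> 1 \<longrightarrow> z + \<tau> *s w \<in> E) \<longrightarrow>
        u z \<le> integral {0..2 * pi} (\<lambda>t. u (z + cis t *s w)) / (2 * pi))"

text \<open>Existence of a continuous plurisubharmonic exhaustion function.\<close>

definition pseudoconvex :: "(complex ^ 'n::finite) set \<Rightarrow> bool" where
  "pseudoconvex E \<longleftrightarrow>
     open E \<and>
     (\<exists>u. continuous_plurisubharmonic u E \<and> (\<forall>c::real. compact {z \<in> E. u z \<le> c}))"

end

(*
  Over D lies a double cone in R^(n+1); a real linear form l without zeros on it singles out a convex
  half C. The elliptic tube consists of the proj w for which the values f(w) of the forms f in the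
  dual cone of C have pairwise angles less than pi/2 (at most pi/2 if D is compact): these values
  can then be rotated into a quadrant, which makes the real and imaginary parts of a multiple of w
  lie in C. In the chart l = 1 the tube E is thus given by the inequalities
  Re (f(z) * cnj (g(z))) > 0 between affine functions, that is by |h| < 1 for the linear fractions
  h = (f - g) / (f + g).

  The sets where all |h| <= r < 1 are compact and exhaust E. This gives convexity with respect to the
  linear fractions, holomorphic convexity, and the plurisubharmonic exhaustion sup 1 / (1 - |h|).
  Through every point outside E passes a complex hyperplane that misses E, so E is a domain of
  holomorphy. E is starshaped, hence Runge: the Taylor expansion of f(v + psi(s) (z - v)) in s
  approximates f by polynomials if psi maps a disc to a thin neighbourhood of [0, 1]. Polynomial
  convexity follows from the Runge property. For compact D, the points outside the tube are
  separated from it by such h, which are limits of polynomials by the Runge property of a half space.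
*)
theory Submission
  imports Defs "HOL-Complex_Analysis.Complex_Analysis"
begin

unbundle no fps_syntax

section \<open>Affine functions, polynomials and holomorphic functions on \<open>\<complex>\<^sup>n\<close>\<close>

text \<open>The forms used for open \<open>D\<close> are those of norm 1 in the dual cone. They make
  up a compact set, so the infinitely many strict inequalities still define an open set, the moduli
  of the \<open>h\<close> have a maximum below 1 on every nonempty compact subset of the tube, and
  the values at a point can be rotated into an open quadrant. For compact \<open>D\<close> the
  inequalities are weak; strictness is restored by adding small multiples of \<open>l\<close>, whose
  value does not vanish on the tube.

  That a real hyperplane misses \<open>D\<close> has to be proved, as proper convexity speaks of
  projective lines. A double cone has no preferred half, so the halves are first told apart without
  a linear form: two vectors are on the same side if the segment between them stays in the cone.
  Connectedness makes this relation transitive, and a half is then convex and can be separated from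
  0.

  In the Runge theorem the difficulty is that a Taylor coefficient in \<open>s\<close> is at first
  just some function of \<open>z\<close>. It is a polynomial because on every coordinate line it is
  entire and grows at most like a power of the variable.\<close>

definition affine_Cn :: "(complex ^ 'n::finite \<Rightarrow> complex) \<Rightarrow> bool" where
  "affine_Cn q \<longleftrightarrow> (\<exists>c d. q = (\<lambda>z. (\<Sum>i\<in>UNIV. c $ i * z $ i) + d))"

lemma affine_Cn_const [simp]: "affine_Cn (\<lambda>z. d)"
  unfolding affine_Cn_def by (rule exI[of _ 0], rule exI[of _ d]) simp

lemma affine_Cn_add:
  assumes "affine_Cn p" "affine_Cn q"
  shows "affine_Cn (\<lambda>z. p z + q z)"
proof -
  obtain c d c' d' where "p = (\<lambda>z. (\<Sum>i\<in>UNIV. c $ i * z $ i) + d)"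
    "q = (\<lambda>z. (\<Sum>i\<in>UNIV. c' $ i * z $ i) + d')"
    using assms unfolding affine_Cn_def by blast
  then have "(\<lambda>z. p z + q z) = (\<lambda>z. (\<Sum>i\<in>UNIV. (c + c') $ i * z $ i) + (d + d'))"
    by (simp add: fun_eq_iff algebra_simps sum.distrib)
  then show ?thesis unfolding affine_Cn_def by blast
qed

lemma affine_Cn_cmult:
  assumes "affine_Cn q"
  shows "affine_Cn (\<lambda>z. k * q z)"
proof -
  obtain c d where "q = (\<lambda>z. (\<Sum>i\<in>UNIV. c $ i * z $ i) + d)"
    using assms unfolding affine_Cn_def by blast
  then have "(\<lambda>z. k * q z) = (\<lambda>z. (\<Sum>i\<in>UNIV. (k *s c) $ i * z $ i) + k * d)"
    by (simp add: fun_eq_iff algebra_simps sum_distrib_left)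
  then show ?thesis unfolding affine_Cn_def by blast
qed

lemma affine_Cn_diff:
  assumes "affine_Cn p" "affine_Cn q"
  shows "affine_Cn (\<lambda>z. p z - q z)"
  using affine_Cn_add[OF assms(1) affine_Cn_cmult[OF assms(2), of "-1"]] by simp

lemma affine_Cn_sum:
  assumes "\<And>i. i \<in> I \<Longrightarrow> affine_Cn (q i)"
  shows "affine_Cn (\<lambda>z. \<Sum>i\<in>I. q i z)"
proof (cases "finite I")
  case True
  then show ?thesis using assms
    by (induction I rule: finite_induct) (auto intro: affine_Cn_add)
qed simp

lemma affine_Cn_coord: "affine_Cn (\<lambda>z. z $ i)"
proof -
  have "(\<lambda>z::complex^'a. z $ i) = (\<lambda>z. (\<Sum>j\<in>UNIV. axis i 1 $ j * z $ j) + 0)"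
    by (auto simp: fun_eq_iff axis_def if_distrib if_distribR cong: if_cong)
  then show ?thesis unfolding affine_Cn_def by blast
qed

lemma affine_Cn_line:
  assumes "affine_Cn q"
  obtains m where "\<And>t. q (z + t *s w) = q z + t * m"
proof -
  obtain c d where q: "q = (\<lambda>z. (\<Sum>i\<in>UNIV. c $ i * z $ i) + d)"
    using assms unfolding affine_Cn_def by blast
  have "q (z + t *s w) = q z + t * (\<Sum>i\<in>UNIV. c $ i * w $ i)" for t
    by (simp add: q algebra_simps sum.distrib sum_distrib_left)
  then show thesis by (rule that)
qed

lemma affine_Cn_segment:
  assumes "affine_Cn q"
  shows "q (v + t *s (z - v)) = (1 - t) * q v + t * q z"
proof -
  obtain m where m: "\<And>t. q (v + t *s (z - v)) = q v + t * m"
    using affine_Cn_line[OF assms] by metis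
  have "v + 1 *s (z - v) = z" by (simp add: vec_eq_iff)
  with m[of 1] have "q z = q v + m" by simp
  with m[of t] show ?thesis by (simp add: algebra_simps)
qed

lemma affine_Cn_derivative:
  assumes "affine_Cn q"
  shows "\<exists>f'. (q has_derivative f') (at z) \<and> (\<forall>c v. f' (c *s v) = c * f' v)"
proof -
  obtain c d where q: "q = (\<lambda>z. (\<Sum>i\<in>UNIV. c $ i * z $ i) + d)"
    using assms unfolding affine_Cn_def by blast
  let ?f = "\<lambda>z. \<Sum>i\<in>UNIV. c $ i * z $ i"
  have "linear ?f"
    by (rule linearI) (simp_all add: algebra_simps sum.distrib scaleR_sum_right)
  then have "bounded_linear ?f" by (simp add: linear_conv_bounded_linear)
  then have "(?f has_derivative ?f) (at z)" by (rule bounded_linear_imp_has_derivative)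
  from has_derivative_add[OF this has_derivative_const[of d]]
  have "(q has_derivative ?f) (at z)" by (simp add: q)
  moreover have "\<forall>k v. ?f (k *s v) = k * ?f v" by (simp add: sum_distrib_left algebra_simps)
  ultimately show ?thesis by blast
qed

section \<open>Holomorphic functions of several variables and their restrictions to complex
  lines\<close>

lemma affine_Cn_holomorphic: "affine_Cn q \<Longrightarrow> holomorphic_in q E"
  unfolding holomorphic_in_def using affine_Cn_derivative by blast

lemma holomorphic_in_continuous_on: "holomorphic_in f E \<Longrightarrow> continuous_on E f"
  unfolding holomorphic_in_def
  by (metis continuous_at_imp_continuous_on has_derivative_continuous)

lemma affine_Cn_continuous_on: "affine_Cn q \<Longrightarrow> continuous_on E q"
  by (intro holomorphic_in_continuous_on affine_Cn_holomorphic)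

lemma holomorphic_in_subset: "holomorphic_in f E \<Longrightarrow> F \<subseteq> E \<Longrightarrow> holomorphic_in f F"
  unfolding holomorphic_in_def by blast

lemma holomorphic_in_const: "holomorphic_in (\<lambda>z. c) E"
  by (rule affine_Cn_holomorphic) simp

lemma holomorphic_in_mult:
  assumes "holomorphic_in f E" "holomorphic_in g E"
  shows "holomorphic_in (\<lambda>z. f z * g z) E"
  unfolding holomorphic_in_def
proof
  fix z assume "z \<in> E"
  then obtain f' g' where f: "(f has_derivative f') (at z)" "\<forall>c v. f' (c *s v) = c * f' v"
    and g: "(g has_derivative g') (at z)" "\<forall>c v. g' (c *s v) = c * g' v"
    using assms unfolding holomorphic_in_def by meson
  show "\<exists>f'. ((\<lambda>z. f z * g z) has_derivative f') (at z) \<and> (\<forall>c v. f' (c *s v) = c * f' v)"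
    using has_derivative_mult[OF f(1) g(1)] f(2) g(2)
    by (intro exI[of _ "\<lambda>h. f z * g' h + f' h * g z"]) (simp add: algebra_simps)
qed

lemma holomorphic_in_diff:
  assumes "holomorphic_in f E" "holomorphic_in g E"
  shows "holomorphic_in (\<lambda>z. f z - g z) E"
  unfolding holomorphic_in_def
proof
  fix z assume "z \<in> E"
  then obtain f' g' where f: "(f has_derivative f') (at z)" "\<forall>c v. f' (c *s v) = c * f' v"
    and g: "(g has_derivative g') (at z)" "\<forall>c v. g' (c *s v) = c * g' v"
    using assms unfolding holomorphic_in_def by meson
  show "\<exists>f'. ((\<lambda>z. f z - g z) has_derivative f') (at z) \<and> (\<forall>c v. f' (c *s v) = c * f' v)"
    using has_derivative_diff[OF f(1) g(1)] f(2) g(2)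
    by (intro exI[of _ "\<lambda>h. f' h - g' h"]) (simp add: algebra_simps)
qed

lemma holomorphic_in_inverse:
  assumes "holomorphic_in f E" "\<And>z. z \<in> E \<Longrightarrow> f z \<noteq> 0"
  shows "holomorphic_in (\<lambda>z. inverse (f z)) E"
  unfolding holomorphic_in_def
proof
  fix z assume z: "z \<in> E"
  then obtain f' where f: "(f has_derivative f') (at z)" "\<forall>c v. f' (c *s v) = c * f' v"
    using assms unfolding holomorphic_in_def by meson
  show "\<exists>f'. ((\<lambda>z. inverse (f z)) has_derivative f') (at z) \<and> (\<forall>c v. f' (c *s v) = c * f' v)"
    using Deriv.has_derivative_inverse[OF assms(2)[OF z] f(1)] f(2)
    by (intro exI[of _ "\<lambda>h. - (inverse (f z) * f' h * inverse (f z))"]) (simp add: algebra_simps)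
qed

lemma norm_vector_smult: "norm (c *s (x :: complex ^ 'n::finite)) = norm c * norm x"
  by (simp add: norm_vec_def norm_mult L2_set_right_distrib)

lemma linear_smult_left: "linear (\<lambda>t::complex. t *s (w :: complex ^ 'n::finite))"
  by (rule linearI) (simp_all add: vec_eq_iff algebra_simps)

lemma continuous_on_smult [continuous_intros]:
  fixes g :: "'a::topological_space \<Rightarrow> complex ^ 'n::finite"
  assumes "continuous_on S f" "continuous_on S g"
  shows "continuous_on S (\<lambda>x. f x *s g x)"
  using assms unfolding vector_scalar_mult_def by (intro continuous_intros)

lemma holomorphic_in_line:
  assumes f: "holomorphic_in f E" and T: "\<And>t. t \<in> T \<Longrightarrow> p + t *s w \<in> E"
  shows "(\<lambda>t. f (p + t *s w)) holomorphic_on T"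
  unfolding holomorphic_on_def
proof
  fix t assume "t \<in> T"
  then obtain f' where f': "(f has_derivative f') (at (p + t *s w))" "\<forall>c v. f' (c *s v) = c * f' v"
    using f T unfolding holomorphic_in_def by meson
  have "bounded_linear (\<lambda>t. t *s w)"
    using linear_smult_left by (simp add: linear_conv_bounded_linear)
  then have "((\<lambda>t. t *s w) has_derivative (\<lambda>t. t *s w)) (at t)"
    by (rule bounded_linear_imp_has_derivative)
  from has_derivative_add[OF has_derivative_const[of p] this]
  have "((\<lambda>t. p + t *s w) has_derivative (\<lambda>t. t *s w)) (at t)" by simp
  from has_derivative_compose[OF this f'(1)]
  have "((\<lambda>t. f (p + t *s w)) has_derivative (\<lambda>h. f' w * h)) (at t)"
    using f'(2) by (simp add: mult.commute)
  then have "((\<lambda>t. f (p + t *s w)) has_field_derivative f' w) (at t)"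
    by (simp add: has_field_derivative_def)
  then show "(\<lambda>t. f (p + t *s w)) field_differentiable at t within T"
    using field_differentiable_at_within field_differentiable_def by blast
qed

text \<open>Identity theorem. The interior \<open>A\<close> of the zero set is closed in
  \<open>V\<close>: a ball in \<open>V\<close> around a limit point \<open>x\<close> contains some
  \<open>a\<close> in \<open>A\<close>, and each \<open>y\<close> of the ball lies on the complex
  line through \<open>a\<close>. The part of this line in the ball is convex, so the identity
  theorem in one variable carries the zeros near \<open>a\<close> to \<open>y\<close>.\<close>

lemma holomorphic_in_eq_0_on_connected:
  fixes F :: "complex ^ 'n::finite \<Rightarrow> complex"
  assumes V: "open V" "connected V" and F: "holomorphic_in F V"
    and U: "open U" "U \<noteq> {}" "U \<subseteq> V" "\<And>z. z \<in> U \<Longrightarrow> F z = 0" and z: "z \<in> V"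
  shows "F z = 0"
proof -
  define A where "A = interior {z \<in> V. F z = 0}"
  have A: "open A" "A \<subseteq> V" "U \<subseteq> A"
    unfolding A_def using U by (simp, use interior_subset in blast, intro interior_maximal, auto)
  have A0: "F x = 0" if "x \<in> A" for x using that interior_subset unfolding A_def by blast
  have cl: "x \<in> A" if x: "x \<in> V" "x \<in> closure A" for x
  proof -
    obtain r where r: "r > 0" "ball x r \<subseteq> V" using V(1) x(1) openE by blast
    obtain a where a: "a \<in> A" "a \<in> ball x r"
      using x(2) r(1) closure_approachable[of x A] by (auto simp: dist_commute)
    have "F y = 0" if y: "y \<in> ball x r" for y
    proof -
      define T where "T = (\<lambda>t. a + t *s (y - a)) -` ball x r"
      define T' where "T' = (\<lambda>t. a + t *s (y - a)) -` (A \<inter> ball x r)"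
      have cont: "continuous_on UNIV (\<lambda>t::complex. a + t *s (y - a))" by (intro continuous_intros)
      have oT: "open T" "open T'" unfolding T_def T'_def
        using cont A(1) by (auto intro!: open_vimage)
      have "convex T"
      proof (rule convexI)
        fix s t and u v :: real assume st: "s \<in> T" "t \<in> T" "0 \<le> u" "0 \<le> v" "u + v = 1"
        have "u *\<^sub>R (a + s *s (y - a)) + v *\<^sub>R (a + t *s (y - a)) \<in> ball x r"
          using st convex_ball[of x r] unfolding T_def by (simp add: convex_def)
        moreover have "u *\<^sub>R (a + s *s (y - a)) + v *\<^sub>R (a + t *s (y - a))
           = (u + v) *\<^sub>R a + (u *\<^sub>R s + v *\<^sub>R t) *s (y - a)"
          by (simp add: vec_eq_iff) (simp add: scaleR_conv_of_real algebra_simps)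
        ultimately show "u *\<^sub>R s + v *\<^sub>R t \<in> T" using st unfolding T_def by simp
      qed
      then have "connected T" by (rule convex_connected)
      have "(\<lambda>t. F (a + t *s (y - a))) holomorphic_on T"
        by (rule holomorphic_in_line[OF F]) (use r T_def in auto)
      moreover have "0 \<in> T'" "T' \<subseteq> T" unfolding T'_def T_def using a by auto
      moreover have "F (a + t *s (y - a)) = 0" if "t \<in> T'" for t
        using that A0 unfolding T'_def by auto
      moreover have "1 \<in> T" using y unfolding T_def by simp
      ultimately have "F (a + 1 *s (y - a)) = 0"
        using analytic_continuation_open[OF oT(2,1) _ \<open>connected T\<close>, of "\<lambda>t. F (a + t *s (y - a))" "\<lambda>_. 0" 1]
        by auto
      then show ?thesis by simp
    qed
    then have "ball x r \<subseteq> A" unfolding A_def using r(2) by (intro interior_maximal) auto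
    then show "x \<in> A" using r(1) by auto
  qed
  have "V \<subseteq> A \<union> - closure A" using cl by auto
  then have "A \<inter> V = {} \<or> - closure A \<inter> V = {}"
    using connectedD[OF V(2) A(1), of "- closure A"] closure_subset[of A] by (auto simp: open_Compl)
  then have "V \<subseteq> A" using U(2) A(2,3) cl by auto
  then show ?thesis using z A0 by blast
qed

section \<open>Polynomials in several variables\<close>

lemma polynomial_CnI:
  fixes e :: "'i \<Rightarrow> 'n::finite \<Rightarrow> nat"
  assumes "finite I"
  shows "polynomial_Cn (\<lambda>z. \<Sum>i\<in>I. c i * (\<Prod>j\<in>UNIV. (z $ j) ^ e i j))"
proof -
  \<comment> \<open>Distinct indices may have the same exponent \<open>e i\<close>, as happens for
    products and sums of polynomials; their coefficients are collected.\<close>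
  have "(\<Sum>i\<in>I. c i * (\<Prod>j\<in>UNIV. (z $ j) ^ e i j)) =
     (\<Sum>\<alpha>\<in>e ` I. (\<Sum>i | i \<in> I \<and> e i = \<alpha>. c i) * (\<Prod>j\<in>UNIV. (z $ j) ^ \<alpha> j))" for z :: "complex ^ 'n"
  proof -
    have "(\<Sum>i\<in>I. c i * (\<Prod>j\<in>UNIV. (z $ j) ^ e i j)) =
       (\<Sum>\<alpha>\<in>e ` I. \<Sum>i | i \<in> I \<and> e i = \<alpha>. c i * (\<Prod>j\<in>UNIV. (z $ j) ^ e i j))"
      by (rule sum.image_gen[OF assms])
    then show ?thesis by (simp add: sum_distrib_right)
  qed
  then show ?thesis unfolding polynomial_Cn_def using assms
    by (intro exI[of _ "e ` I"] exI[of _ "\<lambda>\<alpha>. \<Sum>i | i \<in> I \<and> e i = \<alpha>. c i"]) auto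
qed

lemma polynomial_Cn_mult:
  assumes "polynomial_Cn p" "polynomial_Cn q"
  shows "polynomial_Cn (\<lambda>z. p z * q z)"
proof -
  obtain F a G b where F: "finite F" "p = (\<lambda>z. \<Sum>\<alpha>\<in>F. a \<alpha> * (\<Prod>i\<in>UNIV. (z $ i) ^ \<alpha> i))"
    and G: "finite G" "q = (\<lambda>z. \<Sum>\<alpha>\<in>G. b \<alpha> * (\<Prod>i\<in>UNIV. (z $ i) ^ \<alpha> i))"
    using assms unfolding polynomial_Cn_def by blast
  have "(\<lambda>z. p z * q z) = (\<lambda>z. \<Sum>x\<in>F \<times> G. (a (fst x) * b (snd x)) *
     (\<Prod>i\<in>UNIV. (z $ i) ^ (fst x i + snd x i)))"
    unfolding F(2) G(2) sum_product sum.cartesian_product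
    by (intro ext sum.cong) (auto simp: power_add prod.distrib algebra_simps)
  then show ?thesis using F(1) G(1)
    by (simp add: polynomial_CnI[of "F \<times> G" "\<lambda>x. a (fst x) * b (snd x)" "\<lambda>x i. fst x i + snd x i"])
qed

lemma polynomial_Cn_add:
  assumes "polynomial_Cn p" "polynomial_Cn q"
  shows "polynomial_Cn (\<lambda>z. p z + q z)"
proof -
  obtain F a G b where F: "finite F" "p = (\<lambda>z. \<Sum>\<alpha>\<in>F. a \<alpha> * (\<Prod>i\<in>UNIV. (z $ i) ^ \<alpha> i))"
    and G: "finite G" "q = (\<lambda>z. \<Sum>\<alpha>\<in>G. b \<alpha> * (\<Prod>i\<in>UNIV. (z $ i) ^ \<alpha> i))"
    using assms unfolding polynomial_Cn_def by blast
  have "(\<lambda>z. p z + q z) = (\<lambda>z. \<Sum>x\<in>F <+> G. case_sum a b x *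
     (\<Prod>i\<in>UNIV. (z $ i) ^ (case_sum (\<lambda>\<alpha>. \<alpha>) (\<lambda>\<alpha>. \<alpha>) x i)))"
    using F(1) G(1) by (simp add: F(2) G(2) sum.Plus)
  then show ?thesis using F(1) G(1)
    by (simp add: polynomial_CnI)
qed

lemma polynomial_Cn_const: "polynomial_Cn (\<lambda>z. c)"
  using polynomial_CnI[of "{()}" "\<lambda>_. c" "\<lambda>_ _. 0"] by simp

lemma polynomial_Cn_coord: "polynomial_Cn (\<lambda>z. z $ i)"
proof -
  have "(\<Prod>j\<in>UNIV. (z $ j) ^ (if j = i then 1 else 0)) = z $ i" for z :: "complex ^ 'a"
  proof -
    have "(\<Prod>j\<in>UNIV. (z $ j) ^ (if j = i then 1 else 0)) = (\<Prod>j\<in>UNIV. if j = i then z $ j else 1)"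
      by (rule prod.cong) auto
    then show ?thesis by simp
  qed
  then show ?thesis using polynomial_CnI[of "{()}" "\<lambda>_. 1" "\<lambda>_ j. if j = i then 1 else 0"] by simp
qed

lemma polynomial_Cn_sum:
  assumes "\<And>i. i \<in> I \<Longrightarrow> polynomial_Cn (p i)"
  shows "polynomial_Cn (\<lambda>z. \<Sum>i\<in>I. p i z)"
proof (cases "finite I")
  case True
  then show ?thesis using assms
    by (induction I rule: finite_induct) (auto intro: polynomial_Cn_add polynomial_Cn_const)
qed (simp add: polynomial_Cn_const)

lemma polynomial_Cn_prod:
  assumes "\<And>i. i \<in> I \<Longrightarrow> polynomial_Cn (p i)"
  shows "polynomial_Cn (\<lambda>z. \<Prod>i\<in>I. p i z)"
proof (cases "finite I")
  case True
  then show ?thesis using assms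
    by (induction I rule: finite_induct) (auto intro: polynomial_Cn_mult polynomial_Cn_const)
qed (simp add: polynomial_Cn_const)

lemma affine_Cn_polynomial:
  assumes "affine_Cn q"
  shows "polynomial_Cn q"
proof -
  obtain c d where q: "q = (\<lambda>z. (\<Sum>i\<in>UNIV. c $ i * z $ i) + d)"
    using assms unfolding affine_Cn_def by blast
  show ?thesis unfolding q
    by (intro polynomial_Cn_add polynomial_Cn_sum polynomial_Cn_mult polynomial_Cn_const polynomial_Cn_coord)
qed

lemma polynomial_Cn_continuous_on: "polynomial_Cn p \<Longrightarrow> continuous_on S p"
  unfolding polynomial_Cn_def by (auto intro!: continuous_intros)

section \<open>Starshaped open sets are Runge domains\<close>

text \<open>The right-hand side is linear in the values of \<open>p\<close> at 0, ...,
  \<open>d\<close>, with coefficients that are fixed polynomials in \<open>t\<close>. Both sides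
  have degree at most \<open>d\<close> and agree at these \<open>d + 1\<close> points.\<close>

lemma Lagrange_interpolation:
  fixes c :: "nat \<Rightarrow> complex" and d :: nat
  defines "p \<equiv> \<lambda>t. \<Sum>k\<le>d. c k * t ^ k"
  shows "p t = (\<Sum>j\<le>d. p (of_nat j) * (\<Prod>k\<in>{..d}-{j}. (t - of_nat k) / (of_nat j - of_nat k)))"
proof -
  define P where "P = (\<Sum>k\<le>d. monom (c k) k)"
  define Q where "Q = (\<Sum>j\<le>d. smult (p (of_nat j)) (\<Prod>k\<in>{..d}-{j}.
      smult (1 / (of_nat j - of_nat k)) [:- of_nat k, 1:]))"
  have P: "poly P s = p s" for s by (simp add: P_def p_def poly_sum poly_monom)
  have Q: "poly Q s = (\<Sum>j\<le>d. p (of_nat j) * (\<Prod>k\<in>{..d}-{j}. (s - of_nat k) / (of_nat j - of_nat k)))" for s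
    by (simp add: Q_def poly_sum poly_prod diff_divide_distrib)
  have "degree P \<le> d"
    unfolding P_def by (intro degree_sum_le) (auto intro: order.trans[OF degree_monom_le])
  moreover have "degree Q \<le> d"
    unfolding Q_def
  proof (intro degree_sum_le)
    fix j assume j: "j \<in> {..d}"
    have "degree (\<Prod>k\<in>{..d}-{j}. smult (1 / (of_nat j - of_nat k)) [:- of_nat k, 1::complex:])
      \<le> (\<Sum>k\<in>{..d}-{j}. degree (smult (1 / (of_nat j - of_nat k)) [:- of_nat k, 1::complex:]))"
      by (rule order.trans[OF degree_prod_sum_le]) auto
    also have "\<dots> \<le> (\<Sum>k\<in>{..d}-{j}. 1)"
      by (intro sum_mono order.trans[OF degree_smult_le]) auto
    also have "\<dots> = d" using j by simp
    finally show "degree (smult (p (of_nat j)) (\<Prod>k\<in>{..d}-{j}.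
      smult (1 / (of_nat j - of_nat k)) [:- of_nat k, 1:])) \<le> d"
      by (rule order.trans[OF degree_smult_le])
  qed simp
  moreover have "poly P (of_nat i) = poly Q (of_nat i)" if i: "i \<le> d" for i
  proof -
    have "(\<Prod>k\<in>{..d}-{j}. (of_nat i - of_nat k) / (of_nat j - of_nat k)) = (if j = i then 1 else (0::complex))" for j
    proof (cases "j = i")
      case True
      then show ?thesis by (auto intro: prod.neutral)
    next
      case False
      then show ?thesis using i by (auto intro!: prod_zero bexI[of _ i])
    qed
    then show ?thesis using i by (simp only: P Q) (simp add: if_distrib cong: if_cong)
  qed
  ultimately have "P = Q"
  proof -
    assume dP: "degree P \<le> d" and dQ: "degree Q \<le> d"
      and eq: "\<And>i. i \<le> d \<Longrightarrow> poly P (of_nat i) = poly Q (of_nat i)"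
    show ?thesis
    proof (rule ccontr)
      assume "P \<noteq> Q"
      then have nz: "P - Q \<noteq> 0" by simp
      have "(of_nat :: nat \<Rightarrow> complex) ` {..d} \<subseteq> {x. poly (P - Q) x = 0}" using eq by auto
      then have "card ((of_nat :: nat \<Rightarrow> complex) ` {..d}) \<le> card {x. poly (P - Q) x = 0}"
        by (intro card_mono poly_roots_finite nz)
      also have "\<dots> \<le> degree (P - Q)" by (rule card_poly_roots_bound[OF nz])
      also have "\<dots> \<le> d" by (rule degree_diff_le[OF dP dQ])
      finally show False by (simp add: card_image inj_on_def)
    qed
  qed
  then show ?thesis using P Q by metis
qed

text \<open>Induction on the set \<open>I\<close> of free coordinates, with the others frozen at
  \<open>y\<close>. Interpolation in a new coordinate \<open>i\<close> writes the function through
  its values at \<open>z $ i = 0, ..., d\<close>, which have one free coordinate less. The common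
  degree bound \<open>d\<close> allows the same nodes for all \<open>z\<close>.\<close>

lemma polynomial_Cn_separately:
  fixes f :: "complex ^ 'n::finite \<Rightarrow> complex"
  assumes f: "\<And>z i. \<exists>c. \<forall>t. f (z + t *s axis i 1) = (\<Sum>k\<le>d. c k * t ^ k)"
  shows "polynomial_Cn f"
proof -
  have "polynomial_Cn (\<lambda>z. f (\<chi> j. if j \<in> I then z $ j else y j))" if "finite I" for I y
    using that
  proof (induction I arbitrary: y rule: finite_induct)
    case empty
    then show ?case by (simp add: polynomial_Cn_const)
  next
    case (insert i I)
    define L :: "nat \<Rightarrow> complex \<Rightarrow> complex" where
      "L j t = (\<Prod>k\<in>{..d}-{j}. (t - of_nat k) / (of_nat j - of_nat k))" for j t
    have eq: "f (\<chi> j. if j \<in> insert i I then z $ j else y j) =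
       (\<Sum>m\<le>d. f (\<chi> j. if j \<in> I then z $ j else (y(i := of_nat m)) j) * L m (z $ i))" for z
    proof -
      define x where "x = (\<chi> j. if j = i then 0 else if j \<in> I then z $ j else y j)"
      have 1: "(\<chi> j. if j \<in> insert i I then z $ j else y j) = x + (z $ i) *s axis i 1"
        by (auto simp: x_def vec_eq_iff axis_def)
      have 2: "(\<chi> j. if j \<in> I then z $ j else (y(i := of_nat m)) j) = x + (of_nat m) *s axis i 1" for m
        using insert(2) by (auto simp: x_def vec_eq_iff axis_def)
      obtain c where "\<And>t. f (x + t *s axis i 1) = (\<Sum>k\<le>d. c k * t ^ k)" using f by metis
      then show ?thesis using Lagrange_interpolation[where d = d and c = c and t = "z $ i"] unfolding 1 2 L_def by simp
    qed
    have "polynomial_Cn (\<lambda>z. L m (z $ i))" for m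
      unfolding L_def
      by (intro polynomial_Cn_prod affine_Cn_polynomial)
        (use affine_Cn_cmult[OF affine_Cn_diff[OF affine_Cn_coord affine_Cn_const]] in \<open>simp add: divide_inverse mult.commute\<close>)
    then show ?case unfolding eq by (intro polynomial_Cn_sum polynomial_Cn_mult insert.IH)
  qed
  from this[of UNIV] show ?thesis by simp
qed

text \<open>Cauchy's inequality on the circle of radius \<open>r\<close> bounds the coefficients,
  and the tail of the series is then dominated by a geometric series of ratio
  \<open>norm s / r\<close>.\<close>

lemma taylor_remainder_bound:
  fixes f :: "complex \<Rightarrow> complex"
  assumes f: "f holomorphic_on ball 0 R" and B: "\<And>s. s \<in> ball 0 R \<Longrightarrow> norm (f s) \<le> B"
    and r: "0 < r" "r < R" and s: "norm s < r"
  shows "norm ((deriv ^^ j) f 0 / fact j) \<le> B / r ^ j"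
    and "norm (f s - (\<Sum>j<N. (deriv ^^ j) f 0 / fact j * s ^ j)) \<le> B * (norm s / r) ^ N / (1 - norm s / r)"
proof -
  define b where "b j = (deriv ^^ j) f 0 / fact j" for j
  have b: "norm (b j) \<le> B / r ^ j" for j
  proof -
    have "norm ((deriv ^^ j) f 0) \<le> fact j * B / r ^ j"
    proof (rule Cauchy_inequality)
      show "f holomorphic_on ball 0 r" "continuous_on (cball 0 r) f"
        using r by (auto intro!: holomorphic_on_subset[OF f]
          continuous_on_subset[OF holomorphic_on_imp_continuous_on[OF f]])
    qed (use r B in auto)
    then show ?thesis by (simp add: b_def norm_divide field_simps)
  qed
  then show "norm ((deriv ^^ j) f 0 / fact j) \<le> B / r ^ j" unfolding b_def .
  define q where "q = norm s / r"
  have q: "0 \<le> q" "q < 1" using r s by (auto simp: q_def)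
  have "(\<lambda>n. b n * s ^ n) sums f s"
    using holomorphic_power_series[OF f, of s] r s by (simp add: b_def)
  then have 1: "(\<lambda>n. b (n + N) * s ^ (n + N)) sums (f s - (\<Sum>j<N. b j * s ^ j))"
    by (rule sums_split_initial_segment)
  have 2: "(\<lambda>n. B * q ^ N * q ^ n) sums (B * q ^ N * (1 / (1 - q)))"
    by (rule sums_mult[OF geometric_sums]) (use q in simp)
  have "norm (f s - (\<Sum>j<N. b j * s ^ j)) \<le> B * q ^ N * (1 / (1 - q))"
  proof (rule norm_sums_le[OF 1 2])
    fix n
    have "norm (b (n + N) * s ^ (n + N)) \<le> B / r ^ (n + N) * norm s ^ (n + N)"
      unfolding norm_mult norm_power by (rule mult_right_mono[OF b]) simp
    also have "\<dots> = B * q ^ N * q ^ n"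
      using r by (simp add: q_def power_divide power_add mult_ac)
    finally show "norm (b (n + N) * s ^ (n + N)) \<le> B * q ^ N * q ^ n" .
  qed
  then show "norm (f s - (\<Sum>j<N. (deriv ^^ j) f 0 / fact j * s ^ j)) \<le> B * (norm s / r) ^ N / (1 - norm s / r)"
    by (simp add: b_def q_def)
qed

text \<open>The \<open>k\<close>-th Taylor coefficient is the uniform limit, as \<open>s\<close> tends to \<open>0\<close>, of the remainder of
  order \<open>k\<close> divided by \<open>s ^ k\<close>.\<close>

lemma taylor_coeff_holomorphic:
  fixes G :: "complex \<Rightarrow> complex \<Rightarrow> complex"
  assumes U: "open U" and R: "R > 0"
    and hs: "\<And>t. t \<in> U \<Longrightarrow> G t holomorphic_on ball 0 R"
    and ht: "\<And>s. s \<in> ball 0 R \<Longrightarrow> (\<lambda>t. G t s) holomorphic_on U"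
    and B: "\<And>t s. t \<in> U \<Longrightarrow> s \<in> ball 0 R \<Longrightarrow> norm (G t s) \<le> B"
  shows "(\<lambda>t. (deriv ^^ k) (G t) 0 / fact k) holomorphic_on U"
proof (induction k rule: less_induct)
  case (less k)
  define b where "b j t = (deriv ^^ j) (G t) 0 / fact j" for j t
  define r where "r = R / 2"
  have r: "0 < r" "r < R" using R by (auto simp: r_def)
  \<comment> \<open>These points tend to 0 and satisfy
    \<open>norm (s n) / r = 1 / (2 * (n + 1))\<close>. Hence the denominator in the remainder bound
    is at least 1/2, and after division by \<open>norm (s n) ^ k\<close> the bound is
    \<open>B / r ^ k / (n + 1)\<close>, uniformly in \<open>t\<close>.\<close>
  define s :: "nat \<Rightarrow> complex" where "s n = of_real (r / 2 / (real n + 1))" for n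
  have s: "s n \<noteq> 0" "norm (s n) \<le> r / 2" "norm (s n) = r / 2 / (real n + 1)" for n
  proof -
    show n: "norm (s n) = r / 2 / (real n + 1)" for n
      unfolding s_def norm_of_real using r by (simp add: abs_of_nonneg)
    show "norm (s n) \<le> r / 2" unfolding n using r by (simp add: divide_simps)
    have "norm (s n) \<noteq> 0" unfolding n using r by simp
    then show "s n \<noteq> 0" by simp
  qed
  define F where "F n t = (G t (s n) - (\<Sum>j<k. b j t * s n ^ j)) / s n ^ k" for n t
  have F: "F n holomorphic_on U" for n
    unfolding F_def using less s(1,2)[of n] r
    by (intro holomorphic_intros ht) (auto simp: b_def)
  have est: "norm (F n t - b k t) \<le> B / r ^ k / (real n + 1)" if t: "t \<in> U" for n t
  proof -
    have "norm (G t (s n) - (\<Sum>j<Suc k. b j t * s n ^ j)) \<le> B * (norm (s n) / r) ^ Suc k / (1 - norm (s n) / r)"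
      unfolding b_def using s(2)[of n] r t by (intro taylor_remainder_bound(2)[OF hs B]) auto
    also have "G t (s n) - (\<Sum>j<Suc k. b j t * s n ^ j) = (F n t - b k t) * s n ^ k"
      using s(1)[of n] by (simp add: F_def field_simps)
    finally have "norm (F n t - b k t) * norm (s n) ^ k \<le> B * (norm (s n) / r) ^ Suc k / (1 - norm (s n) / r)"
      by (simp add: norm_mult norm_power)
    also have "\<dots> \<le> B * (norm (s n) / r) ^ Suc k / (1 / 2)"
    proof (rule divide_left_mono)
      show "1 / 2 \<le> 1 - norm (s n) / r" using s(2)[of n] r by (simp add: field_simps)
      have "norm (G t 0) \<le> B" using B[OF t, of 0] R by simp
      then have "0 \<le> B" using norm_ge_zero[of "G t 0"] by linarith
      then show "0 \<le> B * (norm (s n) / r) ^ Suc k" using r by simp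
      show "0 < (1 - norm (s n) / r) * (1 / 2)" using s(2)[of n] r by (simp add: field_simps)
    qed
    also have "\<dots> = B / r ^ k / (real n + 1) * norm (s n) ^ k"
    proof -
      define x where "x = 1 / (2 * (real n + 1))"
      have x: "norm (s n) = r * x" "1 / (real n + 1) = 2 * x"
        unfolding s(3) x_def by (auto simp: field_simps)
      have "B / r ^ k / (real n + 1) = B / r ^ k * (2 * x)"
        unfolding x(2)[symmetric] by simp
      then show ?thesis using r by (simp add: x(1) power_mult_distrib)
    qed
    finally show ?thesis by (rule mult_right_le_imp_le) (use s(1) in simp)
  qed
  have lim: "(\<lambda>n. B / r ^ k / (real n + 1)) \<longlonglongrightarrow> 0"
    using LIMSEQ_Suc[OF lim_const_over_n[of "B / r ^ k"]] by (simp add: add.commute)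
  have "b k holomorphic_on U"
  proof (rule holomorphic_uniform_sequence[OF U F])
    fix x assume "x \<in> U"
    then obtain d where d: "d > 0" "cball x d \<subseteq> U" using U open_contains_cball by blast
    have "uniform_limit (cball x d) F (b k) sequentially"
    proof (rule uniform_limitI)
      fix e :: real assume "e > 0"
      from order_tendstoD(2)[OF lim this]
      show "\<forall>\<^sub>F n in sequentially. \<forall>x\<in>cball x d. dist (F n x) (b k x) < e"
      proof (rule eventually_mono, intro ballI)
        fix n t assume "B / r ^ k / (real n + 1) < e" "t \<in> cball x d"
        then show "dist (F n t) (b k t) < e"
          using est[of t n] d(2) unfolding dist_norm by (meson le_less_trans subsetD)
      qed
    qed
    then show "\<exists>d>0. cball x d \<subseteq> U \<and> uniform_limit (cball x d) F (b k) sequentially" using d by blast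
  qed
  then show ?case unfolding b_def .
qed

lemma holomorphic_at_0_linear_bound:
  fixes \<psi> :: "complex \<Rightarrow> complex"
  assumes \<psi>: "\<psi> holomorphic_on ball 0 R" "\<psi> 0 = 0" and R: "R > 0"
  obtains L \<rho> where "L > 0" "0 < \<rho>" "\<rho> \<le> R" "\<And>s. norm s < \<rho> \<Longrightarrow> norm (\<psi> s) \<le> L * norm s"
proof -
  obtain D where "(\<psi> has_field_derivative D) (at 0)"
    using \<psi>(1) R holomorphic_on_imp_differentiable_at[of \<psi> "ball 0 R" 0]
    by (auto simp: field_differentiable_def)
  then have "((\<lambda>s. \<psi> s / s) \<longlongrightarrow> D) (at 0)"
    using \<psi>(2) by (simp add: DERIV_def)
  then have "\<forall>\<^sub>F s in at 0. dist (\<psi> s / s) D < 1" by (rule tendstoD) simp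
  then obtain e where e: "e > 0" "\<And>s. s \<noteq> 0 \<Longrightarrow> norm s < e \<Longrightarrow> norm (\<psi> s / s - D) < 1"
    unfolding eventually_at by (auto simp: dist_norm)
  show thesis
  proof (rule that[of "norm D + 1" "min e R"])
    fix s :: complex assume s: "norm s < min e R"
    show "norm (\<psi> s) \<le> (norm D + 1) * norm s"
    proof (cases "s = 0")
      case False
      have "norm (\<psi> s / s) \<le> norm (\<psi> s / s - D) + norm D"
        using norm_triangle_ineq[of "\<psi> s / s - D" D] by simp
      also have "\<dots> \<le> norm D + 1" using e(2)[of s] s False by simp
      finally show ?thesis using False by (simp add: norm_divide divide_simps)
    qed (use \<psi>(2) in simp)
  qed (use e R in \<open>auto intro: add_nonneg_pos\<close>)
qed

text \<open>On every line the Taylor coefficient is an entire function of polynomial growth, by Cauchy's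
  inequality on a circle of radius comparable to \<open>1 / norm z\<close>.\<close>

lemma taylor_coeff_polynomial_Cn:
  fixes f :: "complex ^ 'n::finite \<Rightarrow> complex"
  assumes f: "holomorphic_in f E" and E: "open E" "v \<in> E"
    and \<psi>: "\<psi> holomorphic_on ball 0 R" "\<psi> 0 = 0" and R: "R > 0"
  shows "polynomial_Cn (\<lambda>z. (deriv ^^ k) (\<lambda>s. f (v + \<psi> s *s (z - v))) 0 / fact k)"
proof -
  obtain L \<rho> where L: "L > 0" "0 < \<rho>" "\<rho> \<le> R" "\<And>s. norm s < \<rho> \<Longrightarrow> norm (\<psi> s) \<le> L * norm s"
    using holomorphic_at_0_linear_bound[OF \<psi> R] by metis
  obtain \<delta> where \<delta>: "\<delta> > 0" "cball v \<delta> \<subseteq> E" using E open_contains_cball by blast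
  have "compact (f ` cball v \<delta>)"
    by (intro compact_continuous_image holomorphic_in_continuous_on[OF holomorphic_in_subset[OF f \<delta>(2)]] compact_cball)
  then obtain B where B: "\<And>x. x \<in> cball v \<delta> \<Longrightarrow> norm (f x) \<le> B"
    by (meson compact_imp_bounded bounded_iff imageI)
  \<comment> \<open>With this \<open>A\<close>, the condition
    \<open>norm s < 1 / (A * (C + 1))\<close> gives both \<open>norm s < \<rho>\<close>, where the
    linear bound on \<open>\<psi>\<close> holds, and \<open>L * norm s * C \<le> \<delta>\<close>.
    So the point stays in the ball around \<open>v\<close> for all \<open>z\<close> with
    \<open>norm (z - v) \<le> C\<close>.\<close>
  define A where "A = 1 / \<rho> + L / \<delta>"
  have A: "A > 0" "1 / \<rho> \<le> A" "L \<le> \<delta> * A"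
    using L \<delta> by (auto simp: A_def algebra_simps intro: add_pos_pos)
  define G where "G z s = f (v + \<psi> s *s (z - v))" for z s
  have inball: "v + \<psi> s *s (z - v) \<in> cball v \<delta>"
    if "norm (z - v) \<le> C" "C > 0" "norm s < 1 / (A * (C + 1))" for z s C
  proof -
    have AC: "A * (C + 1) > 0" using A that by simp
    have "1 / \<rho> \<le> A * (C + 1)"
    proof -
      have "A * 1 \<le> A * (C + 1)" using A that by (intro mult_left_mono) auto
      then show ?thesis using A(2) by linarith
    qed
    then have "1 / (A * (C + 1)) \<le> \<rho>" using L AC by (simp add: field_simps)
    then have s: "norm s < \<rho>" using that by simp
    have "norm (\<psi> s *s (z - v)) \<le> L * norm s * C"
      unfolding norm_vector_smult using L(4)[OF s] that(1) L(1) by (intro mult_mono) auto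
    also have "\<dots> \<le> L * (1 / (A * (C + 1))) * C"
      using that L by (intro mult_right_mono mult_left_mono) auto
    also have "\<dots> \<le> \<delta>"
    proof -
      have "L * C \<le> \<delta> * (A * (C + 1))"
        using mult_mono[OF A(3), of C "C + 1"] L A \<delta> that by (simp add: mult.assoc)
      then show ?thesis using AC by (simp add: field_simps)
    qed
    finally show ?thesis by (metis add_diff_cancel_left' dist_commute dist_norm mem_cball)
  qed
  have rad: "1 / (A * (C + 1)) > 0" "1 / (A * (C + 1)) \<le> R" if "C > 0" for C
  proof -
    have AC: "A * (C + 1) > 0" using A that by simp
    then show "1 / (A * (C + 1)) > 0" by simp
    have "1 / \<rho> \<le> A * (C + 1)"
    proof -
      have "A * 1 \<le> A * (C + 1)" using A that by (intro mult_left_mono) auto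
      then show ?thesis using A(2) by linarith
    qed
    then have "1 / (A * (C + 1)) \<le> \<rho>" using L AC by (simp add: field_simps)
    then show "1 / (A * (C + 1)) \<le> R" using L by simp
  qed
  have hs: "G z holomorphic_on ball 0 (1 / (A * (C + 1)))" if "norm (z - v) \<le> C" "C > 0" for z C
  proof -
    have 1: "(\<lambda>\<tau>. f (v + \<tau> *s (z - v))) holomorphic_on \<psi> ` ball 0 (1 / (A * (C + 1)))"
      by (rule holomorphic_in_line[OF f]) (use inball[OF that] \<delta>(2) in auto)
    have 2: "\<psi> holomorphic_on ball 0 (1 / (A * (C + 1)))"
      by (rule holomorphic_on_subset[OF \<psi>(1)]) (use rad[OF that(2)] in auto)
    show ?thesis using holomorphic_on_compose[OF 2 1] by (simp add: o_def G_def[abs_def])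
  qed
  define b where "b z = (deriv ^^ k) (G z) 0 / fact k" for z
  have bnd: "norm (b z) \<le> B * (2 * A * (C + 1)) ^ k" if "norm (z - v) \<le> C" "C > 0" for z C
  proof -
    define e where "e = 1 / (A * (C + 1))"
    have "e > 0" unfolding e_def by (rule rad(1)[OF that(2)])
    then have e: "0 < e / 2" "e / 2 < e" by auto
    have "norm (b z) \<le> B / (e / 2) ^ k"
      unfolding b_def
    proof (rule taylor_remainder_bound(1)[OF _ _ e, of _ _ 0])
      show "G z holomorphic_on ball 0 e" unfolding e_def by (rule hs[OF that])
      show "norm (G z s) \<le> B" if "s \<in> ball 0 e" for s
        unfolding G_def using that by (intro B inball[OF \<open>norm (z - v) \<le> C\<close> \<open>C > 0\<close>]) (simp add: e_def)
    qed (use e in simp)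
    then show ?thesis using A that by (simp add: e_def power_mult_distrib power_divide mult_ac)
  qed
  have "\<exists>c. \<forall>t. b (z + t *s axis i 1) = (\<Sum>j\<le>k. c j * t ^ j)" for z i
  proof -
    define h where "h t = b (z + t *s axis i 1)" for t
    have dist: "norm (z + t *s axis i 1 - v) \<le> norm (z - v) + norm t" for t
      using norm_triangle_ineq[of "z - v" "t *s axis i 1"] by (simp add: norm_vector_smult algebra_simps)
    \<comment> \<open>For \<open>t\<close> in a bounded disc one constant \<open>C\<close> serves
      all points of the line, so the functions \<open>G\<close> share a disc of definition and the
      bound \<open>B\<close>, as \<open>taylor_coeff_holomorphic\<close> requires. The radius
      \<open>T\<close> being arbitrary, \<open>h\<close> is entire.\<close>
    have "h holomorphic_on ball 0 T" if "T > 0" for T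
    proof -
      define C where "C = norm (z - v) + T"
      have C: "C > 0" using that by (auto simp: C_def intro: add_nonneg_pos)
      have d: "norm (z + t *s axis i 1 - v) \<le> C" if "t \<in> ball 0 T" for t
        using dist[of t] that by (simp add: C_def)
      show ?thesis unfolding h_def b_def
      proof (rule taylor_coeff_holomorphic)
        fix s assume s: "s \<in> ball (0::complex) (1 / (A * (C + 1)))"
        have "(\<lambda>t. f ((v + \<psi> s *s (z - v)) + t *s (\<psi> s *s axis i 1))) holomorphic_on ball 0 T"
        proof (rule holomorphic_in_line[OF f])
          fix t assume "t \<in> ball (0::complex) T"
          from inball[OF d[OF this] C] s \<delta>(2)
          have "v + \<psi> s *s (z + t *s axis i 1 - v) \<in> E" by auto
          then show "v + \<psi> s *s (z - v) + t *s (\<psi> s *s axis i 1) \<in> E"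
            by (simp add: algebra_simps)
        qed
        then show "(\<lambda>t. G (z + t *s axis i 1) s) holomorphic_on ball 0 T"
          by (simp add: G_def algebra_simps)
      next
        fix t assume t: "t \<in> ball (0::complex) T"
        show "G (z + t *s axis i 1) holomorphic_on ball 0 (1 / (A * (C + 1)))"
          by (rule hs[OF d[OF t] C])
        fix s assume s: "s \<in> ball (0::complex) (1 / (A * (C + 1)))"
        show "norm (G (z + t *s axis i 1) s) \<le> B"
          unfolding G_def by (rule B, rule inball[OF d[OF t] C]) (use s in simp)
      qed (use rad[OF C] in auto)
    qed
    then have "h holomorphic_on UNIV"
      by (rule holomorphic_on_balls_imp_entire')
    \<comment> \<open>For such \<open>t\<close> one has
      \<open>norm (z - v) + norm t + 1 \<le> 2 * norm t\<close>, which turns the bound on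
      \<open>b\<close> into a multiple of \<open>norm t ^ k\<close>, the form needed for Liouville's
      theorem.\<close>
    moreover have "norm (h t) \<le> B * (4 * A) ^ k * norm t ^ k" if t: "norm (z - v) + 1 + 1 \<le> norm t" for t
    proof -
      have "norm (h t) \<le> B * (2 * A * ((norm (z - v) + norm t) + 1)) ^ k"
        unfolding h_def by (rule bnd[OF dist]) (use t norm_ge_zero[of "z - v"] in linarith)
      also have "\<dots> \<le> B * (2 * A * (2 * norm t)) ^ k"
      proof (intro mult_left_mono power_mono)
        show "0 \<le> B" using order.trans[OF norm_ge_zero B[of v]] \<delta>(1) by simp
      qed (use t A in auto)
      finally show ?thesis by (simp add: power_mult_distrib mult_ac)
    qed
    ultimately have "h t = (\<Sum>j\<le>k. (deriv ^^ j) h 0 / fact j * t ^ j)" for t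
      by (rule Liouville_polynomial)
    then have "\<forall>t. b (z + t *s axis i 1) = (\<Sum>j\<le>k. (deriv ^^ j) h 0 / fact j * t ^ j)"
      unfolding h_def[symmetric] by blast
    then show ?thesis by (rule exI[of _ "\<lambda>j. (deriv ^^ j) h 0 / fact j"])
  qed
  then have "polynomial_Cn b" by (rule polynomial_Cn_separately)
  then show ?thesis by (simp add: b_def[abs_def] G_def[abs_def])
qed

text \<open>The segments from \<open>v\<close> to the points of \<open>K\<close> form a compact
  subset \<open>Q\<close> of \<open>E\<close>, which has a positive distance \<open>e\<close> to
  spare. Real parameters in [0, 1] can therefore be replaced by complex ones from a thin closed
  rectangle, and compactness bounds \<open>f\<close> on the points so obtained.\<close>

lemma bounded_on_complex_nbhd:
  fixes f :: "complex ^ 'n::finite \<Rightarrow> complex"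
  assumes E: "open E" and star: "\<forall>z\<in>E. \<forall>t\<in>{0..1}. v + of_real t *s (z - v) \<in> E"
    and K: "compact K" "K \<subseteq> E" and f: "continuous_on E f"
  obtains \<eta> B where "\<eta> > 0"
    "\<And>z \<tau>. z \<in> K \<Longrightarrow> - \<eta> \<le> Re \<tau> \<Longrightarrow> Re \<tau> \<le> 1 + \<eta> \<Longrightarrow> \<bar>Im \<tau>\<bar> \<le> \<eta> \<Longrightarrow> v + \<tau> *s (z - v) \<in> E"
    "\<And>z \<tau>. z \<in> K \<Longrightarrow> - \<eta> \<le> Re \<tau> \<Longrightarrow> Re \<tau> \<le> 1 + \<eta> \<Longrightarrow> \<bar>Im \<tau>\<bar> \<le> \<eta> \<Longrightarrow> norm (f (v + \<tau> *s (z - v))) \<le> B"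
proof -
  define \<Phi> where "\<Phi> p = v + fst p *s (snd p - v)" for p :: "complex \<times> (complex ^ 'n)"
  have cont: "continuous_on S \<Phi>" for S unfolding \<Phi>_def by (intro continuous_intros)
  define Q where "Q = \<Phi> ` (of_real ` {0..1} \<times> K)"
  have Q: "compact Q" unfolding Q_def
    by (intro compact_continuous_image cont compact_Times K) (intro continuous_intros, rule compact_Icc)
  have "Q \<subseteq> E" unfolding Q_def \<Phi>_def using star K by auto
  then obtain e where e: "e > 0" "(\<Union>x\<in>Q. ball x e) \<subseteq> E"
    using compact_subset_open_imp_ball_epsilon_subset[OF Q E] by metis
  obtain C where C: "C > 0" "\<And>z. z \<in> K \<Longrightarrow> norm (z - v) \<le> C"
  proof -
    have "bounded ((\<lambda>z. z - v) ` K)"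
      by (intro compact_imp_bounded compact_continuous_image K continuous_intros)
    then show thesis using that unfolding bounded_pos by blast
  qed
  \<comment> \<open>A \<open>\<tau>\<close> in the rectangle is at distance at most
    \<open>2 * \<eta>\<close> from a real \<open>t\<close> in [0, 1], so the point moves by at most
    \<open>2 * \<eta> * C = e / 2\<close>.\<close>
  define \<eta> where "\<eta> = e / (4 * C)"
  have \<eta>: "\<eta> > 0" using e C by (simp add: \<eta>_def)
  have inE: "v + \<tau> *s (z - v) \<in> E" if z: "z \<in> K" and \<tau>: "- \<eta> \<le> Re \<tau>" "Re \<tau> \<le> 1 + \<eta>" "\<bar>Im \<tau>\<bar> \<le> \<eta>" for z \<tau>
  proof -
    define t where "t = max 0 (min 1 (Re \<tau>))"
    have t: "0 \<le> t" "t \<le> 1" "\<bar>Re \<tau> - t\<bar> \<le> \<eta>" using \<tau> by (auto simp: t_def)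
    have "norm (\<tau> - of_real t) \<le> \<bar>Re (\<tau> - of_real t)\<bar> + \<bar>Im (\<tau> - of_real t)\<bar>" by (rule cmod_le)
    also have "\<dots> \<le> 2 * \<eta>" using t \<tau> by simp
    finally have n: "norm (\<tau> - of_real t) \<le> 2 * \<eta>" .
    have "dist (v + of_real t *s (z - v)) (v + \<tau> *s (z - v)) = norm ((\<tau> - of_real t) *s (z - v))"
      by (simp add: dist_norm norm_minus_commute algebra_simps)
    also have "\<dots> \<le> 2 * \<eta> * C" unfolding norm_vector_smult using n C(2)[OF z] \<eta> by (intro mult_mono) auto
    also have "\<dots> < e" using e C by (simp add: \<eta>_def)
    finally have "v + \<tau> *s (z - v) \<in> ball (v + of_real t *s (z - v)) e" by simp
    moreover have "v + of_real t *s (z - v) \<in> Q"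
      unfolding Q_def \<Phi>_def using t z by (force intro!: image_eqI[of _ _ "(of_real t, z)"])
    ultimately show ?thesis using e(2) by blast
  qed
  define N where "N = cbox (Complex (- \<eta>) (- \<eta>)) (Complex (1 + \<eta>) \<eta>)"
  have N: "\<tau> \<in> N \<longleftrightarrow> - \<eta> \<le> Re \<tau> \<and> Re \<tau> \<le> 1 + \<eta> \<and> \<bar>Im \<tau>\<bar> \<le> \<eta>" for \<tau>
    unfolding N_def by (auto simp: in_cbox_complex_iff)
  have "\<Phi> ` (N \<times> K) \<subseteq> E" using inE by (auto simp: N \<Phi>_def)
  then have "compact (f ` \<Phi> ` (N \<times> K))"
    by (intro compact_continuous_image cont continuous_on_subset[OF f] compact_Times K) (auto simp: N_def)
  then obtain B where "\<And>y. y \<in> f ` \<Phi> ` (N \<times> K) \<Longrightarrow> norm y \<le> B"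
    by (meson compact_imp_bounded bounded_iff)
  then have "norm (f (v + \<tau> *s (z - v))) \<le> B" if "z \<in> K" "\<tau> \<in> N" for z \<tau>
    using that by (force simp: \<Phi>_def)
  then show thesis using that[OF \<eta> inE] N by blast
qed

text \<open>The function \<open>\<lambda>s. - Ln (1 - s) / M\<close> maps a disc around \<open>0\<close> into a thin neighbourhood of the
  interval from \<open>0\<close> to \<open>1\<close>, and an interior point of the disc to \<open>1\<close>. Along it, the Taylor series
  of the function at the center \<open>v\<close> converges up to the points of \<open>K\<close>.\<close>

lemma Runge_domain_starshaped:
  fixes E :: "(complex ^ 'n::finite) set"
  assumes E: "open E" "v \<in> E"
    and star: "\<And>z t. z \<in> E \<Longrightarrow> 0 \<le> t \<Longrightarrow> t \<le> 1 \<Longrightarrow> v + of_real t *s (z - v) \<in> E"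
  shows "Runge_domain E"
  unfolding Runge_domain_def
proof (intro conjI allI impI; (elim conjE)?)
  fix f K and \<epsilon> :: real
  assume f: "holomorphic_in f E" and K: "compact K" "K \<subseteq> E" and \<epsilon>: "\<epsilon> > 0"
  obtain \<eta> B where \<eta>: "\<eta> > 0"
    "\<And>z \<tau>. z \<in> K \<Longrightarrow> - \<eta> \<le> Re \<tau> \<Longrightarrow> Re \<tau> \<le> 1 + \<eta> \<Longrightarrow> \<bar>Im \<tau>\<bar> \<le> \<eta> \<Longrightarrow> v + \<tau> *s (z - v) \<in> E"
    "\<And>z \<tau>. z \<in> K \<Longrightarrow> - \<eta> \<le> Re \<tau> \<Longrightarrow> Re \<tau> \<le> 1 + \<eta> \<Longrightarrow> \<bar>Im \<tau>\<bar> \<le> \<eta> \<Longrightarrow> norm (f (v + \<tau> *s (z - v))) \<le> B"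
    using bounded_on_complex_nbhd[OF E(1) _ K holomorphic_in_continuous_on[OF f], of v] star
    by (metis atLeastAtMost_iff)
  \<comment> \<open>Since \<open>\<eta> * M = 2\<close>, it suffices for the lower bound on
    \<open>Re (\<psi> s)\<close> and the bound on \<open>Im (\<psi> s)\<close> that
    \<open>ln (norm (1 - s))\<close> and the modulus of \<open>Im (Ln (1 - s))\<close> are at most 2
    on the disc. The numbers \<open>s0\<close> and \<open>s1\<close> are the real points where
    \<open>\<psi>\<close> takes the values 1 and \<open>1 + \<eta>\<close>; the disc of radius
    \<open>s1 < 1\<close> avoids the singularity at 1.\<close>
  define M where "M = 2 / \<eta>"
  define s0 s1 where "s0 = 1 - exp (- M)" "s1 = 1 - exp (- ((1 + \<eta>) * M))"
  have M: "M > 0" using \<eta> by (simp add: M_def)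
  have s01: "0 < s0" "s0 < s1" "s1 < 1" using M \<eta>(1) by (auto simp: s0_s1_def)
  define \<psi> :: "complex \<Rightarrow> complex" where "\<psi> s = - Ln (1 - s) / of_real M" for s
  have Re_pos: "Re (1 - s) > 0" if "s \<in> ball 0 s1" for s
    using that s01 complex_Re_le_cmod[of s] by simp
  have \<psi>: "\<psi> holomorphic_on ball 0 s1" "\<psi> 0 = 0"
    unfolding \<psi>_def using Re_pos M by (auto intro!: holomorphic_intros simp: complex_nonpos_Reals_iff) force
  have \<psi>_s0: "\<psi> (of_real s0) = 1"
  proof -
    have "1 - complex_of_real s0 = of_real (exp (- M))" by (simp add: s0_s1_def)
    then have "Ln (1 - complex_of_real s0) = of_real (- M)" using Ln_of_real[of "exp (- M)"] by simp
    then show ?thesis using M by (simp add: \<psi>_def)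
  qed
  have \<psi>_range: "- \<eta> \<le> Re (\<psi> s) \<and> Re (\<psi> s) \<le> 1 + \<eta> \<and> \<bar>Im (\<psi> s)\<bar> \<le> \<eta>" if s: "s \<in> ball 0 s1" for s
  proof -
    have nz: "1 - s \<noteq> 0" using Re_pos[OF s] by auto
    have re: "Re (\<psi> s) = - ln (norm (1 - s)) / M" and im: "Im (\<psi> s) = - Im (Ln (1 - s)) / M"
      using nz by (simp_all add: \<psi>_def Re_divide_of_real Im_divide_of_real)
    have "norm (1 - s) \<ge> exp (- ((1 + \<eta>) * M))"
      using norm_triangle_ineq2[of 1 s] s by (simp add: s0_s1_def)
    then have "ln (exp (- ((1 + \<eta>) * M))) \<le> ln (norm (1 - s))" by (subst ln_le_cancel_iff) (use nz in auto)
    then have 1: "- ((1 + \<eta>) * M) \<le> ln (norm (1 - s))" by simp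
    have "norm (1 - s) \<le> 2" using norm_triangle_ineq4[of 1 s] s s01 by simp
    then have "ln (norm (1 - s)) \<le> norm (1 - s) - 1" using nz by (intro ln_le_minus_one) simp
    then have 2: "ln (norm (1 - s)) \<le> 2" using \<open>norm (1 - s) \<le> 2\<close> by simp
    have "\<bar>Im (Ln (1 - s))\<bar> < pi / 2" using Re_Ln_pos_lt[OF nz] Re_pos[OF s] by simp
    then have 3: "\<bar>Im (Ln (1 - s))\<bar> \<le> 2" using pi_less_4 by simp
    have "\<eta> * M = 2" using \<eta>(1) by (simp add: M_def)
    then have "- (\<eta> * M) \<le> - ln (norm (1 - s))" "\<bar>Im (Ln (1 - s))\<bar> \<le> \<eta> * M" using 2 3 by auto
    then show ?thesis unfolding re im using 1 M by (simp add: field_simps abs_if split: if_splits)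
  qed
  define g where "g z s = f (v + \<psi> s *s (z - v))" for z s
  have g: "g z holomorphic_on ball 0 s1" if "z \<in> K" for z
  proof -
    have "(\<lambda>\<tau>. f (v + \<tau> *s (z - v))) holomorphic_on \<psi> ` ball 0 s1"
      by (rule holomorphic_in_line[OF f]) (use \<eta>(2)[OF that] \<psi>_range in auto)
    from holomorphic_on_compose[OF \<psi>(1) this] show ?thesis by (simp add: o_def g_def[abs_def])
  qed
  \<comment> \<open>A radius strictly between \<open>s0\<close> and \<open>s1\<close> makes the
    Taylor series at \<open>s0\<close> converge geometrically with ratio \<open>s0 / r\<close>,
    uniformly for \<open>z\<close> in \<open>K\<close>.\<close>
  define r where "r = (s0 + s1) / 2"
  have r: "0 < r" "r < s1" "s0 < r" using s01 by (auto simp: r_def)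
  define q where "q = s0 / r"
  have q: "0 < q" "q < 1" using r s01 by (auto simp: q_def)
  define P where "P N z = (\<Sum>j<N. (deriv ^^ j) (g z) 0 / fact j * of_real s0 ^ j)" for N z
  have P: "polynomial_Cn (P N)" for N
    unfolding P_def g_def
    by (intro polynomial_Cn_sum polynomial_Cn_mult polynomial_Cn_const
        taylor_coeff_polynomial_Cn[OF f E \<psi>]) (use s01 in auto)
  have est: "norm (f z - P N z) \<le> B * q ^ N / (1 - q)" if z: "z \<in> K" for z N
  proof -
    have "norm (g z (of_real s0) - P N z) \<le> B * (norm (complex_of_real s0) / r) ^ N / (1 - norm (complex_of_real s0) / r)"
      unfolding P_def
      by (rule taylor_remainder_bound(2)[OF g[OF z]])
        (use r s01 \<eta>(3)[OF z] \<psi>_range in \<open>auto simp: g_def\<close>)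
    then show ?thesis using s01 by (simp add: g_def \<psi>_s0 q_def)
  qed
  have "(\<lambda>N. B * q ^ N / (1 - q)) \<longlonglongrightarrow> B * 0 / (1 - q)"
    by (intro tendsto_intros LIMSEQ_realpow_zero) (use q in auto)
  then have "\<forall>\<^sub>F N in sequentially. B * q ^ N / (1 - q) < \<epsilon>" by (rule order_tendstoD) (use \<epsilon> in simp)
  then obtain N where "B * q ^ N / (1 - q) < \<epsilon>" by (meson eventually_happens sequentially_bot)
  then show "\<exists>P. polynomial_Cn P \<and> (\<forall>z\<in>K. norm (f z - P z) < \<epsilon>)"
    using P est by (intro exI[of _ "P N"]) (auto intro: le_less_trans)
qed (rule E(1))

section \<open>Tubes defined by affine functions\<close>

lemma norm_add_diff_squares: "(norm (x + y))\<^sup>2 - (norm (x - y))\<^sup>2 = 4 * Re (x * cnj y)"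
  unfolding cmod_power2 by (simp add: power2_eq_square algebra_simps)

text \<open>The Cayley transform: \<open>x / y\<close> lies in the right half plane iff
  \<open>(x - y) / (x + y)\<close> lies in the unit disc, written without division.\<close>

lemma norm_diff_less_norm_add_iff: "norm (x - y) < norm (x + y) \<longleftrightarrow> 0 < Re (x * cnj y)"
proof -
  have "norm (x - y) < norm (x + y) \<longleftrightarrow> (norm (x - y))\<^sup>2 < (norm (x + y))\<^sup>2"
    by (metis abs_norm_cancel abs_square_le_1 norm_ge_zero power2_less_imp_less power_strict_mono zero_less_numeral)
  then show ?thesis using norm_add_diff_squares[of x y] by auto
qed

text \<open>Cauchy's integral formula at the center. On the unit circle
  \<open>du / u = \<i> dt\<close>, and the factor \<open>\<i>\<close> is removed by multiplication
  with \<open>- \<i>\<close>.\<close>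

lemma holomorphic_circle_mean:
  fixes F :: "complex \<Rightarrow> complex"
  assumes "F holomorphic_on T" "open T" "cball 0 1 \<subseteq> T"
  shows "((\<lambda>t. F (cis t)) has_integral (2 * pi * F 0)) {0..2 * pi}"
proof -
  have "((\<lambda>u. F u / (u - 0)) has_contour_integral (2 * of_real pi * \<i> * F 0)) (circlepath 0 1)"
  proof (rule Cauchy_integral_circlepath)
    show "continuous_on (cball 0 1) F" "F holomorphic_on ball 0 1"
      using assms ball_subset_cball[of "0::complex" 1]
      by (meson holomorphic_on_subset holomorphic_on_imp_continuous_on order.trans)+
  qed simp
  then have "((\<lambda>t. F (cis t) / cis t * \<i> * cis t) has_integral (2 * of_real pi * \<i> * F 0)) {0..2 * pi}"
    unfolding circlepath_def by (subst (asm) has_contour_integral_part_circlepath_iff) auto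
  then have "((\<lambda>t. \<i> * F (cis t)) has_integral (2 * of_real pi * \<i> * F 0)) {0..2 * pi}"
    by (simp add: mult.commute)
  from has_integral_mult_right[OF this, of "- \<i>"]
  have "((\<lambda>t. - \<i> * (\<i> * F (cis t))) has_integral (- \<i> * (2 * of_real pi * \<i> * F 0))) {0..2 * pi}" .
  moreover have "- \<i> * (\<i> * x) = x" for x by (simp add: mult.assoc[symmetric])
  moreover have "- \<i> * (2 * of_real pi * \<i> * F 0) = - \<i> * (\<i> * (2 * pi * F 0))" by simp
  ultimately show ?thesis by (simp only:)
qed

section \<open>Linear fractions and compactness of hulls\<close>

lemma linear_fraction_in_holomorphic_in:
  assumes "linear_fraction_in f E"
  shows "holomorphic_in f E"
proof -
  obtain a b c d where nz: "\<forall>z\<in>E. (\<Sum>i\<in>UNIV. c $ i * z $ i) + d \<noteq> 0"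
    and f: "f = (\<lambda>z. ((\<Sum>i\<in>UNIV. a $ i * z $ i) + b) / ((\<Sum>i\<in>UNIV. c $ i * z $ i) + d))"
    using assms unfolding linear_fraction_in_def by blast
  show ?thesis unfolding f divide_inverse
    by (intro holomorphic_in_mult holomorphic_in_inverse affine_Cn_holomorphic)
      (use nz in \<open>auto simp: affine_Cn_def\<close>)
qed

lemma linear_fraction_inI:
  assumes "affine_Cn p" "affine_Cn q" "\<And>z. z \<in> E \<Longrightarrow> q z \<noteq> 0"
  shows "linear_fraction_in (\<lambda>z. p z / q z) E"
  using assms unfolding affine_Cn_def linear_fraction_in_def by blast

text \<open>Replacing the existential over \<open>K\<close> by a fixed maximiser \<open>w f\<close>
  of the modulus of \<open>f\<close> on \<open>K\<close> exhibits the hull as an intersection of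
  closed subsets of \<open>L\<close>. The compact \<open>L\<close> keeps it away from the boundary
  of \<open>E\<close>.\<close>

lemma compact_hull_wrt:
  fixes E :: "'a::metric_space set"
  assumes K: "compact K" "K \<subseteq> E" and L: "compact L" "L \<subseteq> E" and F: "\<F> \<noteq> {}" "\<And>f. f \<in> \<F> \<Longrightarrow> continuous_on E f"
    and hull: "hull_wrt \<F> E K \<subseteq> L"
  shows "compact (hull_wrt \<F> E K)"
proof (cases "K = {}")
  case True
  then show ?thesis using F(1) by (auto simp: hull_wrt_def)
next
  case False
  have "\<exists>w\<in>K. \<forall>x\<in>K. norm (f x) \<le> norm (f w)" if "f \<in> \<F>" for f
    by (rule continuous_attains_sup[OF K(1) False])
      (intro continuous_intros continuous_on_subset[OF F(2)[OF that] K(2)])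
  then obtain w where w: "\<And>f. f \<in> \<F> \<Longrightarrow> w f \<in> K" "\<And>f x. f \<in> \<F> \<Longrightarrow> x \<in> K \<Longrightarrow> norm (f x) \<le> norm (f (w f))"
    by metis
  have "hull_wrt \<F> E K = L \<inter> (\<Inter>f\<in>\<F>. {z \<in> L. norm (f z) \<le> norm (f (w f))})"
  proof (intro subset_antisym subsetI)
    fix z assume z: "z \<in> hull_wrt \<F> E K"
    have "norm (f z) \<le> norm (f (w f))" if "f \<in> \<F>" for f
      using z w(2)[OF that] that unfolding hull_wrt_def by (blast intro: order.trans)
    then show "z \<in> L \<inter> (\<Inter>f\<in>\<F>. {z \<in> L. norm (f z) \<le> norm (f (w f))})" using z hull by blast
  next
    fix z assume "z \<in> L \<inter> (\<Inter>f\<in>\<F>. {z \<in> L. norm (f z) \<le> norm (f (w f))})"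
    then show "z \<in> hull_wrt \<F> E K" using L(2) w(1) unfolding hull_wrt_def by blast
  qed
  moreover have "closed {z \<in> L. norm (f z) \<le> norm (f (w f))}" if "f \<in> \<F>" for f
    by (rule continuous_on_closed_Collect_le[OF _ continuous_on_const compact_imp_closed[OF L(1)]])
      (intro continuous_intros continuous_on_subset[OF F(2)[OF that] L(2)])
  ultimately show ?thesis by (simp add: L(1) closed_INT compact_Int_closed)
qed

text \<open>Within \<open>E\<close>, the polynomial hull of \<open>K\<close> is contained in the
  hull for holomorphic functions: if some \<open>f\<close> is larger at \<open>z\<close> than on
  \<open>K\<close>, a polynomial close to \<open>f\<close> on \<open>insert z K\<close> is so as
  well.\<close>

lemma open_polynomially_convex_if_Runge:
  assumes R: "Runge_domain E" and H: "holomorphically_convex E"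
  shows "open_polynomially_convex E"
  unfolding open_polynomially_convex_def
proof (intro conjI allI impI; (elim conjE)?)
  show "open E" using R by (simp add: Runge_domain_def)
  fix K assume K: "compact K" "K \<subseteq> E"
  let ?H = "hull_wrt {f. holomorphic_in f E} E K"
  have eq: "polynomial_hull K \<inter> E = hull_wrt {P. polynomial_Cn P} E K"
    by (auto simp: polynomial_hull_def hull_wrt_def)
  have "hull_wrt {P. polynomial_Cn P} E K \<subseteq> ?H"
  proof
    fix z assume z: "z \<in> hull_wrt {P. polynomial_Cn P} E K"
    then have zE: "z \<in> E" by (simp add: hull_wrt_def)
    have "K \<noteq> {}" using z polynomial_Cn_const by (fastforce simp: hull_wrt_def)
    have "\<exists>w\<in>K. norm (f z) \<le> norm (f w)" if f: "holomorphic_in f E" for f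
    proof -
      have "continuous_on K f" using holomorphic_in_continuous_on[OF holomorphic_in_subset[OF f K(2)]] .
      then obtain w0 where w0: "w0 \<in> K" "\<And>w. w \<in> K \<Longrightarrow> norm (f w) \<le> norm (f w0)"
        using continuous_attains_sup[OF K(1) \<open>K \<noteq> {}\<close>, of "\<lambda>w. norm (f w)"] continuous_on_norm by blast
      have "norm (f z) \<le> norm (f w0)"
      proof (rule ccontr)
        assume "\<not> norm (f z) \<le> norm (f w0)"
        \<comment> \<open>Half of the gap is the admissible error, because errors occur at two
          points, \<open>z\<close> and \<open>w\<close>.\<close>
        then have "(norm (f z) - norm (f w0)) / 2 > 0" by simp
        moreover have "compact (insert z K)" "insert z K \<subseteq> E" using K zE by auto
        ultimately obtain P where P: "polynomial_Cn P"
          "\<And>w. w \<in> insert z K \<Longrightarrow> norm (f w - P w) < (norm (f z) - norm (f w0)) / 2"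
          using R[unfolded Runge_domain_def, THEN conjunct2, rule_format,
            of f "insert z K" "(norm (f z) - norm (f w0)) / 2"] f by metis
        obtain w where w: "w \<in> K" "norm (P z) \<le> norm (P w)"
          using z P(1) by (auto simp: hull_wrt_def)
        have "norm (f z) \<le> norm (P z) + norm (f z - P z)"
          using norm_triangle_ineq[of "P z" "f z - P z"] by simp
        moreover have "norm (P w) \<le> norm (f w) + norm (f w - P w)"
          using norm_triangle_ineq4[of "f w" "f w - P w"] by simp
        ultimately show False using P(2)[of z] P(2)[of w] w w0(2)[of w] by (simp add: field_simps)
      qed
      then show ?thesis using w0 by blast
    qed
    then show "z \<in> ?H" using zE by (simp add: hull_wrt_def)
  qed
  moreover have "compact ?H" using H K unfolding holomorphically_convex_def by blast
  moreover have "?H \<subseteq> E" by (auto simp: hull_wrt_def)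
  ultimately show "compact (polynomial_hull K \<inter> E)"
    unfolding eq using K polynomial_Cn_const polynomial_Cn_continuous_on
    by - (rule compact_hull_wrt[where L = ?H], auto intro: polynomial_Cn_const[of 0])
qed

text \<open>An open tube as seen in a chart. \<open>S\<close> is the compact set of unit forms in
  the dual cone and \<open>a f z\<close> the value of the form \<open>f\<close>, normalised by the
  value of \<open>l\<close>; \<open>e\<close> is the multiple of \<open>l\<close> in
  \<open>S\<close>, which makes \<open>a e\<close> constant. \<open>bounded_if\<close> reflects that
  \<open>S\<close> spans the space of forms, and \<open>v\<close> is a real point of the
  tube.\<close>

locale affine_tube =
  fixes S :: "'s::metric_space set" and a :: "'s \<Rightarrow> complex ^ 'n::finite \<Rightarrow> complex"
    and e :: 's and \<kappa> :: real and v :: "complex ^ 'n"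
  assumes compact_S: "compact S" and e_in: "e \<in> S"
    and affine: "\<And>f. affine_Cn (a f)"
    and cont: "continuous_on UNIV (\<lambda>(z, f). a f z)"
    and a_e: "\<And>z. a e z = of_real \<kappa>" and \<kappa>_pos: "\<kappa> > 0"
    and bounded_if: "\<And>M. bounded {z. \<forall>f\<in>S. norm (a f z) \<le> M}"
    and center: "\<And>f. f \<in> S \<Longrightarrow> \<exists>r>0. a f v = of_real r"
begin

definition E :: "(complex ^ 'n) set" where
  "E = {z. \<forall>f\<in>S. \<forall>g\<in>S. 0 < Re (a f z * cnj (a g z))}"

definition h :: "'s \<times> 's \<Rightarrow> complex ^ 'n \<Rightarrow> complex" where
  "h p z = (a (fst p) z - a (snd p) z) / (a (fst p) z + a (snd p) z)"

text \<open>The condition that all \<open>h p\<close> have modulus at most \<open>r\<close>, with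
  denominators cleared so that it defines a closed subset of the whole space.\<close>

definition L :: "real \<Rightarrow> (complex ^ 'n) set" where
  "L r = {z. \<forall>f\<in>S. \<forall>g\<in>S. norm (a f z - a g z) \<le> r * norm (a f z + a g z)}"

lemma continuous_on_a [continuous_intros]:
  assumes "continuous_on X F" "continuous_on X Z"
  shows "continuous_on X (\<lambda>x. a (F x) (Z x))"
  using continuous_on_compose2[OF cont continuous_on_Pair[OF assms(2,1)]] by simp

lemma E_iff: "z \<in> E \<longleftrightarrow> (\<forall>f\<in>S. \<forall>g\<in>S. norm (a f z - a g z) < norm (a f z + a g z))"
  by (simp add: E_def norm_diff_less_norm_add_iff)

lemma Re_pos: "z \<in> E \<Longrightarrow> f \<in> S \<Longrightarrow> 0 < Re (a f z)"
  using e_in \<kappa>_pos by (force simp: E_def a_e zero_less_mult_iff)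

lemma sum_nz: "z \<in> E \<Longrightarrow> f \<in> S \<Longrightarrow> g \<in> S \<Longrightarrow> a f z + a g z \<noteq> 0"
  using E_iff by fastforce

lemma v_in: "v \<in> E"
  unfolding E_def
proof (clarify)
  fix f g assume fg: "f \<in> S" "g \<in> S"
  show "0 < Re (a f v * cnj (a g v))" using center[OF fg(1)] center[OF fg(2)] by auto
qed

text \<open>At a point of \<open>E\<close> the infinitely many positive quantities have a positive
  minimum over the compact \<open>S \<times> S\<close>, and by compactness they vary uniformly
  little near that point.\<close>

lemma open_E: "open E"
proof (subst open_subopen, intro ballI)
  fix z assume z: "z \<in> E"
  define F where "F = (\<lambda>(z, p). Re (a (fst p) z * cnj (a (snd p) z)))"
  have cF: "continuous_on X F" for X
    unfolding F_def split_beta by (intro continuous_intros)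
  have P: "compact (S \<times> S)" "S \<times> S \<noteq> {}" using compact_S e_in compact_Times by auto
  obtain p0 where p0: "p0 \<in> S \<times> S" "\<And>p. p \<in> S \<times> S \<Longrightarrow> F (z, p0) \<le> F (z, p)"
    using continuous_attains_inf[OF P, of "\<lambda>p. F (z, p)"]
      continuous_on_compose2[OF cF[of UNIV] continuous_on_Pair[OF continuous_on_const continuous_on_id]]
    by (metis subset_UNIV)
  have pos: "F (z, p0) / 2 > 0" using z p0(1) by (auto simp: E_def F_def)
  from continuous_on_prod_compactE[OF cF P(1) UNIV_I pos, of z]
  obtain X0 where X0: "z \<in> X0" "open X0" "\<forall>x\<in>X0 \<inter> UNIV. \<forall>t\<in>S \<times> S. dist (F (x, t)) (F (z, t)) \<le> F (z, p0) / 2"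
    by metis
  have "X0 \<subseteq> E"
  proof
    fix x assume "x \<in> X0"
    have "0 < F (x, (f, g))" if "f \<in> S" "g \<in> S" for f g
    proof -
      have "dist (F (x, (f, g))) (F (z, (f, g))) \<le> F (z, p0) / 2" "F (z, p0) \<le> F (z, (f, g))"
        using X0(3) \<open>x \<in> X0\<close> that p0(2) by auto
      then show ?thesis using pos by (auto simp: dist_real_def abs_if split: if_splits)
    qed
    then show "x \<in> E" by (simp add: E_def F_def)
  qed
  then show "\<exists>T. open T \<and> z \<in> T \<and> T \<subseteq> E" using X0 by blast
qed

lemma L_subset: "r < 1 \<Longrightarrow> L r \<subseteq> E"
proof
  fix z assume r: "r < 1" and z: "z \<in> L r"
  have "norm (a f z - a g z) < norm (a f z + a g z)" if fg: "f \<in> S" "g \<in> S" for f g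
  proof (cases "a f z + a g z = 0")
    \<comment> \<open>Numerator and denominator both vanish, so \<open>a f z = 0\<close>; the
      inequality for \<open>f\<close> and \<open>e\<close> then reads
      \<open>\<kappa> \<le> r * \<kappa>\<close>, which is impossible.\<close>
    case True
    then have "a f z - a g z = 0" using z fg by (force simp: L_def)
    with True have "a f z = 0" by (simp add: complex_eq_iff)
    then have "\<bar>\<kappa>\<bar> \<le> r * \<bar>\<kappa>\<bar>" using z fg e_in by (force simp: L_def a_e)
    then show ?thesis using r \<kappa>_pos by simp
  next
    case False
    then have "r * norm (a f z + a g z) < 1 * norm (a f z + a g z)"
      using r by (intro mult_strict_right_mono) auto
    then show ?thesis using z fg by (force simp: L_def)
  qed
  then show "z \<in> E" by (simp add: E_iff)
qed

text \<open>Boundedness comes from comparing each \<open>f\<close> with \<open>e\<close>: for 0 <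
  \<open>r\<close> < 1, the points \<open>x\<close> with
  \<open>norm (x - \<kappa>) \<le> r * norm (x + \<kappa>)\<close> form a disc of
  Apollonius.\<close>

lemma compact_L:
  assumes r: "r < 1"
  shows "compact (L r)"
proof -
  have "L r = (\<Inter>f\<in>S. \<Inter>g\<in>S. {z. norm (a f z - a g z) \<le> r * norm (a f z + a g z)})"
    by (auto simp: L_def)
  moreover have "closed {z. norm (a f z - a g z) \<le> r * norm (a f z + a g z)}" for f g
    by (intro closed_Collect_le continuous_intros)
  ultimately have "closed (L r)" by (simp add: closed_INT)
  moreover have "L r \<subseteq> {z. \<forall>f\<in>S. norm (a f z) \<le> \<kappa> + 2 * \<kappa> / (1 - r)}"
  proof (clarify)
    fix z f assume z: "z \<in> L r" and f: "f \<in> S"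
    have 1: "norm (a f z - of_real \<kappa>) \<le> r * norm (a f z + of_real \<kappa>)"
      using z f e_in by (force simp: L_def a_e)
    have 2: "norm (a f z + of_real \<kappa>) \<le> norm (a f z - of_real \<kappa>) + 2 * \<kappa>"
      using norm_triangle_ineq[of "a f z - of_real \<kappa>" "2 * of_real \<kappa>"] \<kappa>_pos by (simp add: norm_mult add.commute)
    have 3: "norm (a f z) \<le> norm (a f z - of_real \<kappa>) + \<kappa>"
      using norm_triangle_ineq[of "a f z - of_real \<kappa>" "of_real \<kappa>"] \<kappa>_pos by simp
    have "norm (a f z - of_real \<kappa>) \<le> 2 * \<kappa> / (1 - r)"
    proof (cases "r \<le> 0")
      case True
      have "norm (a f z - of_real \<kappa>) \<le> 0"
        using order.trans[OF 1 mult_nonpos_nonneg[OF True norm_ge_zero]] .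
      then show ?thesis using \<kappa>_pos r by simp
    next
      case False
      then have "norm (a f z - of_real \<kappa>) \<le> r * norm (a f z - of_real \<kappa>) + r * (2 * \<kappa>)"
        using 1 mult_left_mono[OF 2, of r] by (simp add: algebra_simps)
      also have "r * (2 * \<kappa>) \<le> 1 * (2 * \<kappa>)" using r \<kappa>_pos by (intro mult_right_mono) auto
      finally show ?thesis using r by (simp add: field_simps)
    qed
    then show "norm (a f z) \<le> \<kappa> + 2 * \<kappa> / (1 - r)" using 3 by simp
  qed
  ultimately show ?thesis using bounded_subset[OF bounded_if] by (auto simp: compact_eq_bounded_closed)
qed

lemma norm_h_le_iff: "z \<in> E \<Longrightarrow> z \<in> L r \<longleftrightarrow> (\<forall>p\<in>S \<times> S. norm (h p z) \<le> r)"
  using sum_nz by (auto simp: L_def h_def norm_divide divide_le_eq)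

lemma norm_h_less: "z \<in> E \<Longrightarrow> p \<in> S \<times> S \<Longrightarrow> norm (h p z) < 1"
  using sum_nz E_iff by (auto simp: h_def norm_divide divide_less_eq)

lemma continuous_on_h: "continuous_on (E \<times> (S \<times> S)) (\<lambda>(z, p). h p z)"
  unfolding h_def split_beta using sum_nz by (intro continuous_intros) auto

lemma linear_fraction_h: "p \<in> S \<times> S \<Longrightarrow> linear_fraction_in (h p) E"
  unfolding h_def[abs_def] using sum_nz
  by (intro linear_fraction_inI affine_Cn_diff affine_Cn_add affine) auto

text \<open>For nonempty \<open>K\<close>, \<open>r\<close> is the maximum of the modulus of
  \<open>h\<close> on the compact \<open>K \<times> (S \<times> S)\<close>.\<close>

lemma compact_subset_L:
  assumes K: "compact K" "K \<subseteq> E"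
  obtains r where "r < 1" "K \<subseteq> L r"
proof (cases "K = {}")
  case False
  have "compact (K \<times> (S \<times> S))" "K \<times> (S \<times> S) \<noteq> {}"
    using False K compact_S e_in by (auto intro!: compact_Times)
  moreover have "continuous_on (K \<times> (S \<times> S)) (\<lambda>x. norm ((\<lambda>(z, p). h p z) x))"
    by (intro continuous_on_norm continuous_on_subset[OF continuous_on_h]) (use K in auto)
  ultimately obtain x where x: "x \<in> K \<times> (S \<times> S)"
    "\<And>y. y \<in> K \<times> (S \<times> S) \<Longrightarrow> norm ((\<lambda>(z, p). h p z) y) \<le> norm ((\<lambda>(z, p). h p z) x)"
    using continuous_attains_sup by metis
  obtain z p where zp: "x = (z, p)" by (cases x)
  have "norm (h p z) < 1" using x(1) K(2) zp by (intro norm_h_less) auto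
  moreover have "K \<subseteq> L (norm (h p z))"
    using x(2) K(2) zp by (subst subset_iff) (fastforce simp: norm_h_le_iff)
  ultimately show thesis using that by blast
qed (use that[of 0] in auto)

text \<open>Each \<open>h p\<close> belongs to the family, so the bound \<open>r\<close> on
  \<open>K\<close> passes to the hull, which stays in \<open>L r\<close>. Linear fractions and
  holomorphic functions are thereby treated at once.\<close>

lemma compact_hull_if_linear_fractions:
  assumes F: "{f. linear_fraction_in f E} \<subseteq> \<F>" "\<And>f. f \<in> \<F> \<Longrightarrow> continuous_on E f"
    and K: "compact K" "K \<subseteq> E"
  shows "compact (hull_wrt \<F> E K)"
proof -
  obtain r where r: "r < 1" "K \<subseteq> L r" using compact_subset_L[OF K] .
  show ?thesis
  proof (rule compact_hull_wrt[OF K compact_L L_subset])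
    show "hull_wrt \<F> E K \<subseteq> L r"
    proof
      fix z assume z: "z \<in> hull_wrt \<F> E K"
      then have zE: "z \<in> E" by (simp add: hull_wrt_def)
      have "norm (h p z) \<le> r" if p: "p \<in> S \<times> S" for p
      proof -
        have "h p \<in> \<F>" using F(1) linear_fraction_h[OF p] by blast
        then obtain w where w: "w \<in> K" "norm (h p z) \<le> norm (h p w)"
          using z by (auto simp: hull_wrt_def)
        have "norm (h p w) \<le> r" using norm_h_le_iff[of w r] w K r p by blast
        then show ?thesis using w by simp
      qed
      then show "z \<in> L r" using norm_h_le_iff[OF zE] by blast
    qed
    show "\<F> \<noteq> {}" using F(1) linear_fraction_h e_in by blast
  qed (use r F in auto)
qed

lemma linear_fraction_convex_E: "linear_fraction_convex E"
  unfolding linear_fraction_convex_def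
  using open_E compact_hull_if_linear_fractions linear_fraction_in_holomorphic_in holomorphic_in_continuous_on
  by blast

lemma holomorphically_convex_E: "holomorphically_convex E"
  unfolding holomorphically_convex_def
  using open_E compact_hull_if_linear_fractions[of "{f. holomorphic_in f E}"]
    linear_fraction_in_holomorphic_in holomorphic_in_continuous_on
  by blast

text \<open>At \<open>v\<close> all forms have positive real values. In the expansion of the product
  along the segment, the mixed terms therefore contain only real parts \<open>Re (a f z)\<close>,
  which are positive by comparison with \<open>e\<close>.\<close>

lemma starshaped:
  assumes z: "z \<in> E" and t: "0 \<le> t" "t \<le> 1"
  shows "v + of_real t *s (z - v) \<in> E"
  unfolding E_def
proof (clarify)
  fix f g assume fg: "f \<in> S" "g \<in> S"
  obtain r where r: "r > 0" "a f v = of_real r" using center[OF fg(1)] by blast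
  obtain s where s: "s > 0" "a g v = of_real s" using center[OF fg(2)] by blast
  define X where "X = Re (a f z * cnj (a g z))"
  have pos: "Re (a f z) > 0" "Re (a g z) > 0" "X > 0"
    using Re_pos[OF z] fg z by (auto simp: E_def X_def)
  have "Re (a f (v + of_real t *s (z - v)) * cnj (a g (v + of_real t *s (z - v))))
      = (1 - t)\<^sup>2 * (r * s) + t\<^sup>2 * X + t * (1 - t) * (r * Re (a g z) + s * Re (a f z))"
    unfolding affine_Cn_segment[OF affine] r s X_def by (simp add: algebra_simps power2_eq_square)
  also have "\<dots> > 0"
  proof (cases "t = 0")
    case True
    then show ?thesis using r s by simp
  next
    case False
    have "t\<^sup>2 * X > 0" using False pos by simp
    moreover have "(1 - t)\<^sup>2 * (r * s) \<ge> 0" "t * (1 - t) * (r * Re (a g z) + s * Re (a f z)) \<ge> 0"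
      using r s pos t by (auto intro!: mult_nonneg_nonneg add_nonneg_nonneg)
    ultimately show ?thesis by linarith
  qed
  finally show "0 < Re (a f (v + of_real t *s (z - v)) * cnj (a g (v + of_real t *s (z - v))))" .
qed

lemma Runge_domain_E: "Runge_domain E"
  using Runge_domain_starshaped[OF open_E v_in starshaped] .

lemma open_polynomially_convex_E: "open_polynomially_convex E"
  by (rule open_polynomially_convex_if_Runge[OF Runge_domain_E holomorphically_convex_E])

lemma connected_E: "connected E"
proof (rule starlike_imp_connected)
  show "starlike E" unfolding starlike_def
  proof (intro bexI ballI subsetI)
    fix z x assume z: "z \<in> E" and "x \<in> closed_segment v z"
    then obtain t where t: "0 \<le> t" "t \<le> 1" "x = (1 - t) *\<^sub>R v + t *\<^sub>R z"
      by (auto simp: in_segment)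
    have "x = v + of_real t *s (z - v)"
      unfolding t(3) by (simp add: vec_eq_iff) (simp add: scaleR_conv_of_real algebra_simps)
    then show "x \<in> E" using starshaped[OF z] t by simp
  qed (rule v_in)
qed

text \<open>For a point \<open>b\<close> of \<open>V\<close> outside \<open>E\<close>, an affine
  \<open>q\<close> is found that vanishes at \<open>b\<close> and nowhere on \<open>E\<close>. If
  \<open>G\<close> continues \<open>1 / q\<close> to \<open>V\<close>, then \<open>q * G = 1\<close>
  on \<open>U\<close>, hence on \<open>V\<close> by the identity theorem, which fails at
  \<open>b\<close>.\<close>

lemma domain_of_holomorphy_E: "domain_of_holomorphy E"
  unfolding domain_of_holomorphy_def
proof (intro conjI notI)
  show "open E" "connected E" "E = {} \<Longrightarrow> False" using open_E connected_E v_in by auto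
  assume "\<exists>U V. open U \<and> open V \<and> U \<noteq> {} \<and> U \<subseteq> V \<inter> E \<and> connected V \<and> \<not> V \<subseteq> E \<and>
    (\<forall>f. holomorphic_in f E \<longrightarrow> (\<exists>g. holomorphic_in g V \<and> (\<forall>z\<in>U. f z = g z)))"
  then obtain U V where U: "open U" "U \<noteq> {}" "U \<subseteq> V \<inter> E" and V: "open V" "connected V" "\<not> V \<subseteq> E"
    and ext: "\<And>f. holomorphic_in f E \<Longrightarrow> \<exists>g. holomorphic_in g V \<and> (\<forall>z\<in>U. f z = g z)"
    by blast
  obtain b where b: "b \<in> V" "b \<notin> E" using V(3) by blast
  obtain f g where fg: "f \<in> S" "g \<in> S" "Re (a f b * cnj (a g b)) \<le> 0"
    using b(2) by (auto simp: E_def not_less)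
  obtain q where q: "affine_Cn q" "q b = 0" "\<And>z. z \<in> E \<Longrightarrow> q z \<noteq> 0"
  proof (cases "a g b = 0")
    case True
    have "a g z \<noteq> 0" if "z \<in> E" for z using Re_pos[OF that fg(2)] by auto
    then show thesis using that[OF affine[of g] True] by blast
  next
    case False
    \<comment> \<open>On \<open>E\<close> all quotients \<open>a f z / a g z\<close> have positive
      real part, whereas \<open>\<zeta>\<close> has not; so the quotient never takes the value
      \<open>\<zeta>\<close> on \<open>E\<close>.\<close>
    define \<zeta> where "\<zeta> = a f b / a g b"
    have "Re \<zeta> = Re (a f b * cnj (a g b)) / (norm (a g b))\<^sup>2"
      unfolding \<zeta>_def by (simp add: Re_divide cmod_power2)
    then have \<zeta>: "Re \<zeta> \<le> 0" using fg(3) by (simp add: divide_nonpos_nonneg)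
    show thesis
    proof (rule that[of "\<lambda>z. a f z - \<zeta> * a g z"])
      show "affine_Cn (\<lambda>z. a f z - \<zeta> * a g z)" by (intro affine_Cn_diff affine_Cn_cmult affine)
      show "a f b - \<zeta> * a g b = 0" using False by (simp add: \<zeta>_def)
      fix z assume z: "z \<in> E"
      have "Re (\<zeta> * a g z * cnj (a g z)) = Re \<zeta> * (norm (a g z))\<^sup>2"
        unfolding mult.assoc complex_norm_square[symmetric] by simp
      also have "\<dots> \<le> 0" using \<zeta> by (simp add: mult_nonpos_nonneg)
      finally show "a f z - \<zeta> * a g z \<noteq> 0" using z fg(1,2) by (force simp: E_def)
    qed
  qed
  have "holomorphic_in (\<lambda>z. inverse (q z)) E"
    by (intro holomorphic_in_inverse affine_Cn_holomorphic q)
  then obtain G where G: "holomorphic_in G V" "\<And>z. z \<in> U \<Longrightarrow> inverse (q z) = G z" using ext by blast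
  have "q b * G b - 1 = 0"
  proof (rule holomorphic_in_eq_0_on_connected[OF V(1,2) _ U(1,2)])
    show "holomorphic_in (\<lambda>z. q z * G z - 1) V"
      by (intro holomorphic_in_diff holomorphic_in_mult affine_Cn_holomorphic q G holomorphic_in_const)
    show "q z * G z - 1 = 0" if "z \<in> U" for z
      using G(2)[OF that, symmetric] q(3)[of z] U(3) that by auto
  qed (use U b in auto)
  then show False using q(2) by simp
qed

text \<open>The exhaustion function is \<open>1 / (1 - m)\<close> with \<open>m\<close> the supremum of the \<open>norm (h p z)\<close>. As
  \<open>1 / (1 - norm x)\<close> is the supremum of the \<open>norm (1 / (1 - c * x))\<close> over the unit circle, it is a
  supremum of moduli of holomorphic functions.\<close>

lemma pseudoconvex_E: "pseudoconvex E"
proof -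
  define m where "m z = (SUP p\<in>S \<times> S. norm (h p z))" for z
  have P: "compact (S \<times> S)" "S \<times> S \<noteq> {}" using compact_S e_in compact_Times by auto
  have att: "\<exists>p\<in>S \<times> S. m z = norm (h p z) \<and> (\<forall>p'\<in>S \<times> S. norm (h p' z) \<le> m z)" if z: "z \<in> E" for z
  proof -
    have "continuous_on (S \<times> S) (\<lambda>p. (\<lambda>(z, p). h p z) (z, p))"
      by (rule continuous_on_compose2[OF continuous_on_h]) (use z in \<open>auto intro!: continuous_intros\<close>)
    then have "continuous_on (S \<times> S) (\<lambda>p. norm (h p z))" by (intro continuous_intros) auto
    then obtain p where p: "p \<in> S \<times> S" "\<And>p'. p' \<in> S \<times> S \<Longrightarrow> norm (h p' z) \<le> norm (h p z)"
      using continuous_attains_sup[OF P] by metis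
    have "m z = norm (h p z)" unfolding m_def
      by (rule antisym) (use p P in \<open>auto intro!: cSUP_least cSUP_upper bdd_aboveI2\<close>)
    then show ?thesis using p by auto
  qed
  have le: "norm (h p z) \<le> m z" if "z \<in> E" "p \<in> S \<times> S" for z p using att that by blast
  have m1: "m z < 1" "0 \<le> m z" if "z \<in> E" for z using att[OF that] norm_h_less[OF that] by auto
  have contm: "continuous_on E m"
    unfolding continuous_on_iff
  proof (intro ballI allI impI)
    fix z \<epsilon> assume z: "z \<in> E" and \<epsilon>: "\<epsilon> > (0::real)"
    have "\<epsilon> / 2 > 0" using \<epsilon> by simp
    from continuous_on_prod_compactE[OF continuous_on_norm[OF continuous_on_h] P(1) z this]
    obtain X0 where X0: "z \<in> X0" "open X0"
      "\<forall>x\<in>X0 \<inter> E. \<forall>p\<in>S \<times> S. dist (norm (h p x)) (norm (h p z)) \<le> \<epsilon> / 2"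
      by (auto simp: split_beta)
    obtain d where d: "d > 0" "ball z d \<subseteq> X0" using X0 openE by blast
    have "dist (m x) (m z) < \<epsilon>" if x: "x \<in> E" "dist x z < d" for x
    proof -
      have *: "\<bar>norm (h p x) - norm (h p z)\<bar> \<le> \<epsilon> / 2" if "p \<in> S \<times> S" for p
        using X0(3) d(2) x that by (auto simp: dist_real_def dist_commute subset_iff)
      obtain p where p: "p \<in> S \<times> S" "m x = norm (h p x)" using att[OF x(1)] by blast
      obtain p' where p': "p' \<in> S \<times> S" "m z = norm (h p' z)" using att[OF z] by blast
      have "m x \<le> m z + \<epsilon> / 2" using *[OF p(1)] le[OF z p(1)] p(2) by linarith
      moreover have "m z \<le> m x + \<epsilon> / 2" using *[OF p'(1)] le[OF x(1) p'(1)] p'(2) by linarith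
      ultimately show ?thesis using \<epsilon> by (auto simp: dist_real_def)
    qed
    then show "\<exists>d>0. \<forall>x'\<in>E. dist x' z < d \<longrightarrow> dist (m x') (m z) < \<epsilon>" using d(1) by blast
  qed
  define u where "u z = 1 / (1 - m z)" for z
  have contu: "continuous_on E u" unfolding u_def
    using m1(1) by (intro continuous_intros contm) fastforce
  have mean: "u z \<le> integral {0..2 * pi} (\<lambda>t. u (z + cis t *s w)) / (2 * pi)"
    if disc: "\<forall>\<tau>::complex. norm \<tau> \<le> 1 \<longrightarrow> z + \<tau> *s w \<in> E" for z w
  proof -
    have z: "z \<in> E" using disc[rule_format, of 0] by simp
    obtain p where p: "p \<in> S \<times> S" "m z = norm (h p z)" using att[OF z] by blast
    \<comment> \<open>This \<open>c\<close> turns \<open>h p z\<close> to the nonnegative real axis,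
      so that \<open>norm (1 / (1 - c * h p z)) = u z\<close> at the center, while \<open>u\<close>
      is an upper bound everywhere on the disc.\<close>
    obtain c where c: "norm c = 1" "c * h p z = of_real (norm (h p z))"
    proof (cases "h p z = 0")
      case False
      show thesis by (rule that[of "cnj (h p z) / of_real (norm (h p z))"])
        (use False in \<open>auto simp: norm_divide complex_norm_square[symmetric] mult.commute power2_eq_square\<close>)
    qed (use that[of 1] in auto)
    define T where "T = (\<lambda>\<tau>::complex. z + \<tau> *s w) -` E"
    have T: "open T" "cball 0 1 \<subseteq> T" unfolding T_def
      using disc by (auto intro!: open_vimage open_E continuous_intros)
    have lin: "norm (1 / (1 - c * h p x)) \<le> u x \<and> 1 - c * h p x \<noteq> 0" if x: "x \<in> E" for x
    proof -
      have "norm (c * h p x) \<le> m x" using le[OF x p(1)] c(1) by (simp add: norm_mult)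
      then have "1 - m x \<le> norm (1 - c * h p x)" using norm_triangle_ineq2[of 1 "c * h p x"] by simp
      then show ?thesis using m1(1)[OF x]
        by (auto simp: u_def norm_divide intro!: divide_left_mono mult_pos_pos)
    qed
    define F where "F \<tau> = 1 / (1 - c * h p (z + \<tau> *s w))" for \<tau>
    have "(\<lambda>\<tau>. h p (z + \<tau> *s w)) holomorphic_on T"
      by (rule holomorphic_in_line[OF linear_fraction_in_holomorphic_in[OF linear_fraction_h[OF p(1)]]])
        (simp add: T_def)
    then have "F holomorphic_on T" unfolding F_def
      using lin by (intro holomorphic_intros) (auto simp: T_def)
    from holomorphic_circle_mean[OF this T]
    have int: "((\<lambda>t. F (cis t)) has_integral (2 * pi * F 0)) {0..2 * pi}" .
    have "continuous_on {0..2 * pi} (\<lambda>t. u (z + cis t *s w))"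
      by (rule continuous_on_compose2[OF contu]) (use disc in \<open>auto intro!: continuous_intros\<close>)
    then have intu: "(\<lambda>t. u (z + cis t *s w)) integrable_on {0..2 * pi}"
      by (rule integrable_continuous_real)
    have "norm (integral {0..2 * pi} (\<lambda>t. F (cis t))) \<le> integral {0..2 * pi} (\<lambda>t. u (z + cis t *s w))"
      by (rule Henstock_Kurzweil_Integration.integral_norm_bound_integral[OF has_integral_integrable[OF int] intu])
        (use lin disc in \<open>simp add: F_def\<close>)
    moreover have "norm (F 0) = u z"
    proof -
      have "F 0 = of_real (1 / (1 - norm (h p z)))" by (simp add: F_def c(2))
      then show ?thesis using m1(1)[OF z] p(2) by (simp only: norm_of_real u_def) simp
    qed
    ultimately have "2 * pi * u z \<le> integral {0..2 * pi} (\<lambda>t. u (z + cis t *s w))"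
      using integral_unique[OF int] by (simp add: norm_mult)
    then show ?thesis by (simp add: field_simps)
  qed
  have "compact {z \<in> E. u z \<le> c}" for c
  proof (cases "c < 1")
    case True
    have "u z \<ge> 1" if "z \<in> E" for z using m1[OF that] by (simp add: u_def)
    with True have "{z \<in> E. u z \<le> c} = {}" by force
    then show ?thesis by (metis compact_empty)
  next
    case False
    \<comment> \<open>For \<open>c \<ge> 1\<close> the sublevel set is
      \<open>L (1 - 1 / c)\<close>.\<close>
    have "u z \<le> c \<longleftrightarrow> m z \<le> 1 - 1 / c" if "z \<in> E" for z
      using m1[OF that] False by (simp add: u_def field_simps)
    moreover have "m z \<le> r \<longleftrightarrow> z \<in> L r" if "z \<in> E" for z r
      using norm_h_le_iff[OF that, of r] att[OF that] by (metis order.trans)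
    ultimately have "{z \<in> E. u z \<le> c} = L (1 - 1 / c)" using L_subset[of "1 - 1 / c"] False by auto
    then show ?thesis using compact_L[of "1 - 1 / c"] False by simp
  qed
  then show ?thesis unfolding pseudoconvex_def continuous_plurisubharmonic_def
    using open_E contu mean by blast
qed

end

section \<open>Separation of points from compact tubes by polynomials\<close>

lemma Runge_domain_halfspace:
  assumes q: "affine_Cn q" and z: "0 < Re (q z)"
  shows "Runge_domain {w. 0 < Re (q w)}"
proof (rule Runge_domain_starshaped)
  show "open {w. 0 < Re (q w)}"
    by (intro open_Collect_less continuous_intros affine_Cn_continuous_on[OF q])
  show "z \<in> {w. 0 < Re (q w)}" using z by simp
  fix w and t :: real assume w: "w \<in> {w. 0 < Re (q w)}" and t: "0 \<le> t" "t \<le> 1"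
  have "Re (q (z + of_real t *s (w - z))) = (1 - t) * Re (q z) + t * Re (q w)"
    unfolding affine_Cn_segment[OF q] by simp
  also have "\<dots> > 0"
    using w z t by (cases "t = 0") (auto intro!: add_nonneg_pos mult_nonneg_nonneg)
  finally show "z + of_real t *s (w - z) \<in> {w. 0 < Re (q w)}" by simp
qed

text \<open>A large disc around a real \<open>R\<close> contains the image of \<open>Z\<close> under
  \<open>q\<close> but not \<open>q z\<close>, so the affine polynomial \<open>R - q\<close>
  separates. In the squared distance, \<open>2 * R * - Re (q z)\<close> has to exceed the bound
  \<open>M\<^sup>2\<close> on the squared norms, which determines \<open>R\<close>.\<close>

lemma polynomial_separates_from_halfspace:
  assumes q: "affine_Cn q" and Z: "compact Z" "\<And>w. w \<in> Z \<Longrightarrow> 0 \<le> Re (q w)" and z: "Re (q z) < 0"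
  shows "\<exists>P. polynomial_Cn P \<and> (\<forall>w\<in>Z. norm (P w) < norm (P z))"
proof -
  have "compact (q ` Z)" by (intro compact_continuous_image affine_Cn_continuous_on q Z)
  then obtain M where M: "\<And>w. w \<in> Z \<Longrightarrow> norm (q w) \<le> M"
    by (meson compact_imp_bounded bounded_iff imageI)
  define R where "R = M\<^sup>2 / (2 * - Re (q z)) + 1"
  have "0 \<le> M\<^sup>2 / (2 * - Re (q z))" using z by (intro divide_nonneg_pos) auto
  then have R: "R > 0" unfolding R_def by linarith
  have big: "M\<^sup>2 < 2 * R * - Re (q z)" using z by (simp add: R_def field_simps zero_less_mult_iff)
  have sq: "(norm (of_real R - x))\<^sup>2 = R\<^sup>2 - 2 * R * Re x + (norm x)\<^sup>2" for x
    unfolding cmod_power2 by (simp add: power2_eq_square algebra_simps)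
  have "norm (of_real R - q w) < norm (of_real R - q z)" if w: "w \<in> Z" for w
  proof (rule power2_less_imp_less)
    have "2 * R * Re (q w) \<ge> 0" using R Z(2)[OF w] by simp
    moreover have "(norm (q w))\<^sup>2 \<le> M\<^sup>2" using M[OF w] by (intro power_mono) auto
    moreover have "(norm (q z))\<^sup>2 \<ge> 0" by simp
    ultimately show "(norm (of_real R - q w))\<^sup>2 < (norm (of_real R - q z))\<^sup>2"
      unfolding sq using big by linarith
  qed simp
  moreover have "polynomial_Cn (\<lambda>z. of_real R - q z)"
    by (intro affine_Cn_polynomial affine_Cn_diff q) simp
  ultimately show ?thesis by blast
qed

text \<open>After adding a small positive constant to both functions, the linear fraction
  \<open>(p - q) / (p + q)\<close> is less than \<open>1\<close> in modulus on \<open>Z\<close> and greater than \<open>1\<close> at \<open>z\<close>.\<close>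

lemma polynomial_separates_from_tube:
  assumes p: "affine_Cn p" and q: "affine_Cn q"
    and Z: "compact Z" "\<And>w. w \<in> Z \<Longrightarrow> 0 \<le> Re (p w)" "\<And>w. w \<in> Z \<Longrightarrow> 0 \<le> Re (q w)"
      "\<And>w. w \<in> Z \<Longrightarrow> 0 \<le> Re (p w * cnj (q w))"
    and z: "0 \<le> Re (p z)" "0 \<le> Re (q z)" "Re (p z * cnj (q z)) < 0"
  shows "\<exists>P. polynomial_Cn P \<and> (\<forall>w\<in>Z. norm (P w) < norm (P z))"
proof -
  define s where "s = Re (p z) + Re (q z)"
  \<comment> \<open>At \<open>z\<close> the shift adds
    \<open>\<delta> * s + \<delta>\<^sup>2 \<le> \<delta> * (s + 1)\<close> to the negative real
    part, which is at most half of its modulus by this choice.\<close>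
  define \<delta> where "\<delta> = min 1 (- Re (p z * cnj (q z)) / (2 * (s + 1)))"
  have s: "s \<ge> 0" using z by (simp add: s_def)
  have \<delta>: "\<delta> > 0" "\<delta> \<le> 1" using z s by (auto simp: \<delta>_def)
  have expand: "Re ((x + of_real \<delta>) * cnj (y + of_real \<delta>)) = Re (x * cnj y) + \<delta> * (Re x + Re y) + \<delta>\<^sup>2" for x y
    by (simp add: power2_eq_square algebra_simps)
  define A where "A = (\<lambda>w. p w + of_real \<delta>)"
  define B where "B = (\<lambda>w. q w + of_real \<delta>)"
  have AB: "affine_Cn A" "affine_Cn B" unfolding A_def B_def using p q by (auto intro: affine_Cn_add)
  have posZ: "0 < Re (A w * cnj (B w))" if w: "w \<in> Z" for w
  proof -
    have "0 \<le> \<delta> * (Re (p w) + Re (q w))" using \<delta> Z(2,3)[OF w] by simp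
    moreover have "0 < \<delta>\<^sup>2" using \<delta> by simp
    ultimately show ?thesis unfolding A_def B_def expand using Z(4)[OF w] by linarith
  qed
  have negz: "Re (A z * cnj (B z)) < 0"
  proof -
    have "\<delta> * (Re (p z) + Re (q z)) + \<delta>\<^sup>2 = \<delta> * (s + \<delta>)" by (simp add: s_def power2_eq_square algebra_simps)
    also have "\<dots> \<le> \<delta> * (s + 1)" using \<delta> by (intro mult_left_mono) auto
    also have "\<dots> \<le> - Re (p z * cnj (q z)) / (2 * (s + 1)) * (s + 1)"
      using s by (intro mult_right_mono) (auto simp: \<delta>_def)
    also have "\<dots> = - Re (p z * cnj (q z)) / 2" using s by (simp add: field_simps)
    also have "\<dots> < - Re (p z * cnj (q z))" using z(3) by linarith
    finally show ?thesis unfolding A_def B_def expand by linarith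
  qed
  define Q where "Q = (\<lambda>w. A w + B w)"
  have Q: "affine_Cn Q" unfolding Q_def by (intro affine_Cn_add AB)
  have Qpos: "0 < Re (Q w)" if "w \<in> insert z Z" for w
    using that z(1,2) Z(2,3)[of w] \<delta> by (auto simp: Q_def A_def B_def)
  define F where "F = (\<lambda>w. (A w - B w) * inverse (Q w))"
  \<comment> \<open>The poles of \<open>F\<close> lie outside this half space, which contains both
    \<open>Z\<close> and \<open>z\<close>. Being Runge, it yields one polynomial close to
    \<open>F\<close> on \<open>insert z Z\<close>.\<close>
  define H where "H = {w. 0 < Re (Q w)}"
  have "holomorphic_in F H"
    unfolding F_def by (intro holomorphic_in_mult holomorphic_in_inverse affine_Cn_holomorphic affine_Cn_diff AB Q)
      (auto simp: H_def)
  moreover have "Runge_domain H" unfolding H_def using Qpos[of z] by (intro Runge_domain_halfspace[OF Q]) auto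
  moreover have "compact (insert z Z)" "insert z Z \<subseteq> H" using Z(1) Qpos by (auto simp: H_def)
  moreover have nF: "norm (F w) = norm (A w - B w) / norm (A w + B w)" for w
    by (simp add: F_def Q_def norm_mult norm_inverse divide_inverse)
  have nz: "norm (A w + B w) > 0" if "w \<in> insert z Z" for w
    using Qpos[OF that] complex_Re_le_cmod[of "A w + B w"] unfolding Q_def by linarith
  have FZ: "norm (F w) < 1" if "w \<in> Z" for w
    using norm_diff_less_norm_add_iff[of "A w" "B w"] posZ[OF that] nz[of w] that by (simp add: nF)
  have Fz: "norm (F z) > 1"
  proof -
    have "(norm (A z + B z))\<^sup>2 < (norm (A z - B z))\<^sup>2"
      using norm_add_diff_squares[of "A z" "B z"] negz by linarith
    then have "norm (A z + B z) < norm (A z - B z)" by (rule power2_less_imp_less) simp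
    then show ?thesis using nz[of z] by (simp add: nF)
  qed
  then have "(norm (F z) - 1) / 2 > 0" by simp
  ultimately obtain P where P: "polynomial_Cn P"
    "\<forall>w\<in>insert z Z. norm (F w - P w) < (norm (F z) - 1) / 2"
    unfolding Runge_domain_def by meson
  have "norm (P w) < norm (P z)" if w: "w \<in> Z" for w
  proof -
    have "norm (F w - P w) < (norm (F z) - 1) / 2" "norm (F z - P z) < (norm (F z) - 1) / 2"
      using P(2) w by auto
    moreover have "norm (F z) \<le> norm (P z) + norm (F z - P z)"
      using norm_triangle_ineq[of "P z" "F z - P z"] by simp
    moreover have "norm (P w) \<le> norm (F w) + norm (F w - P w)"
      using norm_triangle_ineq4[of "F w" "F w - P w"] by simp
    ultimately show ?thesis using FZ[OF w] by argo
  qed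
  then show ?thesis using P(1) by blast
qed

text \<open>Comparison with \<open>e\<close> shows that all forms have nonnegative real part on
  \<open>Z\<close>. A point outside \<open>Z\<close> either violates this, and a half space
  separates it, or it violates the inequality for a pair \<open>f\<close>, \<open>g\<close> with
  nonnegative real parts at the point.\<close>

lemma compact_tube_polynomially_convex:
  fixes a :: "'s \<Rightarrow> complex ^ 'n::finite \<Rightarrow> complex" and S :: "'s set"
  defines "Z \<equiv> {z. \<forall>f\<in>S. \<forall>g\<in>S. 0 \<le> Re (a f z * cnj (a g z))}"
  assumes affine: "\<And>f. affine_Cn (a f)" and e: "e \<in> S" "\<And>z. a e z = 1" and Z: "compact Z"
  shows "compact_polynomially_convex Z"
  unfolding compact_polynomially_convex_def
proof (intro conjI Z subset_antisym subsetI)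
  show "z \<in> polynomial_hull Z" if "z \<in> Z" for z
    using that by (auto simp: polynomial_hull_def hull_wrt_def)
  have Re: "0 \<le> Re (a f w)" if "w \<in> Z" "f \<in> S" for w f using that e by (force simp: Z_def)
  fix z assume z: "z \<in> polynomial_hull Z"
  show "z \<in> Z"
  proof (rule ccontr)
    assume "z \<notin> Z"
    then obtain f g where fg: "f \<in> S" "g \<in> S" "Re (a f z * cnj (a g z)) < 0"
      by (auto simp: Z_def not_le)
    have "\<exists>P. polynomial_Cn P \<and> (\<forall>w\<in>Z. norm (P w) < norm (P z))"
    proof (cases "0 \<le> Re (a f z) \<and> 0 \<le> Re (a g z)")
      case True
      then show ?thesis using fg
        by (intro polynomial_separates_from_tube[OF affine affine Z Re Re]) (auto simp: Z_def)
    next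
      case False
      then obtain k where "k \<in> S" "Re (a k z) < 0" using fg(1,2) by force
      then show ?thesis by (intro polynomial_separates_from_halfspace[OF affine Z Re])
    qed
    then show False using z by (force simp: polynomial_hull_def hull_wrt_def not_le[symmetric])
  qed
qed

section \<open>Double cones\<close>

text \<open>The sets of homogeneous coordinates of properly convex sets. Of the two projective segments
  between two points, a properly convex set contains exactly one.\<close>

locale double_cone =
  fixes X :: "'a::euclidean_space set"
  assumes scale: "\<And>c x. x \<in> X \<Longrightarrow> c \<noteq> 0 \<Longrightarrow> c *\<^sub>R x \<in> X"
    and zero: "0 \<notin> X" and nonempty: "X \<noteq> {}"
    and dichotomy: "\<And>x y. x \<in> X \<Longrightarrow> y \<in> X \<Longrightarrow> closed_segment x y \<subseteq> X \<or> closed_segment x (- y) \<subseteq> X"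
    and not_both: "\<And>x y. closed_segment x y \<subseteq> X \<Longrightarrow> closed_segment x (- y) \<subseteq> X \<Longrightarrow> False"
    and no_line: "\<And>x u. u \<noteq> 0 \<Longrightarrow> \<exists>b. x + b *\<^sub>R u \<notin> X"
begin

text \<open>Being in the same half of the double cone, expressed before a linear form is
  available.\<close>

definition rel :: "'a \<Rightarrow> 'a \<Rightarrow> bool" where
  "rel x y \<longleftrightarrow> closed_segment x y \<subseteq> X"

lemma relD: "rel x y \<Longrightarrow> x \<in> X" "rel x y \<Longrightarrow> y \<in> X"
  unfolding rel_def by auto

lemma rel_sym: "rel x y \<Longrightarrow> rel y x"
  by (simp add: rel_def closed_segment_commute)

lemma rel_segment: "rel x y \<Longrightarrow> z \<in> closed_segment x y \<Longrightarrow> rel x z"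
  unfolding rel_def using subset_closed_segment[of x z x y] by auto

lemma uminus_in: "x \<in> X \<Longrightarrow> - x \<in> X"
  using scale[of x "-1"] by simp

lemma rel_scale:
  assumes "rel x y" "c > 0"
  shows "rel x (c *\<^sub>R y)"
  unfolding rel_def
proof
  fix z assume "z \<in> closed_segment x (c *\<^sub>R y)"
  then obtain t where t: "0 \<le> t" "t \<le> 1" "z = (1 - t) *\<^sub>R x + t *\<^sub>R c *\<^sub>R y"
    by (auto simp: in_segment)
  \<comment> \<open>Up to the positive factor \<open>k\<close>, the point \<open>z\<close> is the
    point with weight \<open>s\<close> on the segment from \<open>x\<close> to
    \<open>y\<close>.\<close>
  define k where "k = (1 - t) + t * c"
  have k: "k > 0" unfolding k_def using t assms(2)
    by (cases "t = 0") (auto intro!: add_nonneg_pos)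
  define s where "s = t * c / k"
  have s: "0 \<le> s" "s \<le> 1" "k * s = t * c" "k * (1 - s) = 1 - t"
    using t k assms(2) by (auto simp: s_def k_def field_simps)
  then have "(1 - s) *\<^sub>R x + s *\<^sub>R y \<in> closed_segment x y" unfolding in_segment by blast
  then have "(1 - s) *\<^sub>R x + s *\<^sub>R y \<in> X" using assms(1) by (auto simp: rel_def)
  from scale[OF this, of k] have "k *\<^sub>R ((1 - s) *\<^sub>R x + s *\<^sub>R y) \<in> X" using k by simp
  also have "k *\<^sub>R ((1 - s) *\<^sub>R x + s *\<^sub>R y) = z"
    unfolding t(3) scaleR_add_right scaleR_scaleR s(3,4) ..
  finally show "z \<in> X" .
qed

lemma rel_refl: "x \<in> X \<Longrightarrow> rel x x"
  by (simp add: rel_def)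

lemma rel_or: "x \<in> X \<Longrightarrow> y \<in> X \<Longrightarrow> rel x y \<or> rel x (- y)"
  unfolding rel_def by (rule dichotomy)

lemma rel_not_both: "rel x y \<Longrightarrow> \<not> rel x (- y)"
  unfolding rel_def using not_both by blast

lemma open_rel:
  assumes "open X"
  shows "open {y. rel x y}"
proof (subst open_subopen, intro ballI)
  fix y assume "y \<in> {y. rel x y}"
  then have "closed_segment x y \<subseteq> X" by (simp add: rel_def)
  then obtain e where e: "e > 0" "(\<Union>z\<in>closed_segment x y. ball z e) \<subseteq> X"
    using compact_subset_open_imp_ball_epsilon_subset[OF compact_segment assms] by metis
  have "rel x y'" if y': "y' \<in> ball y e" for y'
    unfolding rel_def
  proof
    fix z assume "z \<in> closed_segment x y'"
    then obtain t where t: "0 \<le> t" "t \<le> 1" "z = (1 - t) *\<^sub>R x + t *\<^sub>R y'"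
      by (auto simp: in_segment)
    have "dist ((1 - t) *\<^sub>R x + t *\<^sub>R y) z = t * dist y y'"
      using t by (simp add: dist_norm scaleR_diff_right[symmetric])
    also have "\<dots> \<le> 1 * dist y y'" using t by (intro mult_right_mono) auto
    also have "\<dots> < e" using y' by simp
    finally have "z \<in> ball ((1 - t) *\<^sub>R x + t *\<^sub>R y) e" by simp
    moreover have "(1 - t) *\<^sub>R x + t *\<^sub>R y \<in> closed_segment x y" using t by (auto simp: in_segment)
    ultimately show "z \<in> X" using e(2) by blast
  qed
  then show "\<exists>T. open T \<and> y \<in> T \<and> T \<subseteq> {y. rel x y}"
    using e(1) by (intro exI[of _ "ball y e"]) auto
qed

text \<open>A nonempty double cone accumulates at 0, so only \<open>insert 0 X\<close> can be
  closed. Segments through 0 are excluded separately, by \<open>zero_in_segment\<close>.\<close>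

lemma closed_rel_0:
  assumes "closed (insert 0 X)"
  shows "closed {y. closed_segment x y \<subseteq> insert 0 X}"
proof -
  have "{y. closed_segment x y \<subseteq> insert 0 X} =
    (\<Inter>t\<in>{0..1}. (\<lambda>y. (1 - t) *\<^sub>R x + t *\<^sub>R y) -` insert 0 X)"
    by (force simp: in_segment)
  moreover have "closed ((\<lambda>y. (1 - t) *\<^sub>R x + t *\<^sub>R y) -` insert 0 X)" for t
    by (intro closed_vimage assms continuous_intros)
  ultimately show ?thesis by (simp add: closed_INT)
qed

lemma zero_in_segment:
  assumes "0 \<in> closed_segment x y" "x \<noteq> 0" "y \<noteq> 0"
  obtains c where "c > 0" "y = - (c *\<^sub>R x)"
proof -
  obtain t where t: "0 \<le> t" "t \<le> 1" "(1 - t) *\<^sub>R x + t *\<^sub>R y = 0"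
    using assms(1) by (auto simp: in_segment)
  have t01: "t \<noteq> 0" "t \<noteq> 1" using t assms(2,3) by auto
  have "t *\<^sub>R y = - ((1 - t) *\<^sub>R x)" using t(3) by (simp add: eq_neg_iff_add_eq_0 add.commute)
  then have "(1 / t) *\<^sub>R (t *\<^sub>R y) = (1 / t) *\<^sub>R - ((1 - t) *\<^sub>R x)" by simp
  then have "y = - (((1 - t) / t) *\<^sub>R x)" using t01 by simp
  then show thesis using t t01 by (intro that[of "(1 - t) / t"]) auto
qed

text \<open>If \<open>u\<close> moves along the segment from \<open>x\<close> to \<open>z\<close>, the alternative between \<open>rel y u\<close> and
  \<open>rel y (- u)\<close> cannot change by connectedness.\<close>

lemma rel_triangle:
  assumes X: "open X \<or> closed (insert 0 X)" and xy: "rel x y" and xz: "rel x z"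
  shows "rel y z"
  using X
proof
  assume o: "open X"
  have "open {u. rel y (- u)}"
    using open_vimage[OF open_rel[OF o], of uminus y] by (simp add: vimage_def continuous_intros)
  moreover have "closed_segment x z \<subseteq> {u. rel y u} \<union> {u. rel y (- u)}"
    using rel_or relD[OF xy] xz by (auto simp: rel_def)
  moreover have "{u. rel y u} \<inter> {u. rel y (- u)} \<inter> closed_segment x z = {}"
    using rel_not_both by auto
  ultimately have "{u. rel y u} \<inter> closed_segment x z = {} \<or> {u. rel y (- u)} \<inter> closed_segment x z = {}"
    using connectedD[OF connected_segment(1)[of x z] open_rel[OF o]] by blast
  moreover have "x \<in> {u. rel y u} \<inter> closed_segment x z" using rel_sym[OF xy] by simp
  ultimately have "\<not> rel y (- z)" by auto
  then show ?thesis using rel_or relD[OF xy] relD[OF xz] by blast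
next
  assume c: "closed (insert 0 X)"
  have y: "y \<in> X" "y \<noteq> 0" using relD[OF xy] zero by auto
  have seg: "u \<in> X" "u \<noteq> 0" if "u \<in> closed_segment x z" for u using that xz zero by (auto simp: rel_def)
  show ?thesis
  proof (cases "\<exists>k>0. k *\<^sub>R y \<in> closed_segment x z")
    case True
    then obtain k where k: "k > 0" "k *\<^sub>R y \<in> closed_segment x z" by blast
    have "rel z (k *\<^sub>R y)" using rel_segment[OF rel_sym[OF xz]] k(2) by (simp add: closed_segment_commute)
    from rel_scale[OF this, of "1 / k"] have "rel z y" using k(1) by simp
    then show ?thesis by (rule rel_sym)
  next
    case no_pos: False
    have no_neg: "\<not> (\<exists>k>0. - (k *\<^sub>R y) \<in> closed_segment x z)"
    proof
      assume "\<exists>k>0. - (k *\<^sub>R y) \<in> closed_segment x z"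
      then obtain k where k: "k > 0" "- (k *\<^sub>R y) \<in> closed_segment x z" by blast
      from rel_scale[OF rel_segment[OF xz k(2)], of "1 / k"] have "rel x (- y)" using k(1) by simp
      then show False using rel_not_both[OF xy] by blast
    qed
    \<comment> \<open>These closed sets tolerate 0 on the segments. It does not occur: 0 between
      \<open>y\<close> and \<open>u\<close> makes \<open>u\<close> a negative multiple of
      \<open>y\<close>, and 0 between \<open>y\<close> and \<open>- u\<close> a positive one,
      against \<open>no_neg\<close> and \<open>no_pos\<close>.\<close>
    define A where "A = {u. closed_segment y u \<subseteq> insert 0 X}"
    define B where "B = {u. closed_segment y (- u) \<subseteq> insert 0 X}"
    have A: "rel y u" if "u \<in> A" "u \<in> closed_segment x z" for u
    proof -
      have "0 \<notin> closed_segment y u"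
        using zero_in_segment[OF _ y(2) seg(2)[OF that(2)]] no_neg that(2) by metis
      then show ?thesis using that(1) by (auto simp: A_def rel_def)
    qed
    have B: "rel y (- u)" if "u \<in> B" "u \<in> closed_segment x z" for u
    proof -
      have "0 \<notin> closed_segment y (- u)"
        using zero_in_segment[of y "- u", OF _ y(2)] seg(2)[OF that(2)] no_pos that(2)
        by (metis neg_equal_iff_equal neg_equal_0_iff_equal)
      then show ?thesis using that(1) by (auto simp: B_def rel_def)
    qed
    have "closed A" unfolding A_def by (rule closed_rel_0[OF c])
    moreover have "closed B"
      using closed_vimage[OF closed_rel_0[OF c], of uminus y] by (simp add: B_def vimage_def continuous_intros)
    moreover have "closed_segment x z \<subseteq> A \<union> B"
      using rel_or[OF y(1)] seg(1) unfolding A_def B_def rel_def by blast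
    moreover have "A \<inter> B \<inter> closed_segment x z = {}" using A B rel_not_both by blast
    ultimately have "A \<inter> closed_segment x z = {} \<or> B \<inter> closed_segment x z = {}"
      using connected_closedD[OF connected_segment(1)[of x z]] by blast
    moreover have "x \<in> A \<inter> closed_segment x z" using rel_sym[OF xy] by (auto simp: A_def rel_def)
    ultimately have "z \<notin> B" by auto
    then have "\<not> rel y (- z)" by (auto simp: B_def rel_def)
    then show ?thesis using rel_or y(1) relD[OF xz] by blast
  qed
qed

text \<open>The points related to a fixed \<open>v\<close> form a convex cone \<open>C\<close>
  without 0, and every point of \<open>X\<close> is in \<open>C\<close> up to sign. If
  \<open>X\<close> is open, a form that is nonnegative on the open \<open>C\<close> is positive
  there. If \<open>insert 0 X\<close> is closed, one separates 0 from the convex hull of the unit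
  vectors of \<open>C\<close>, which is compact and contained in \<open>C\<close>.\<close>

lemma ex_functional:
  assumes X: "open X \<or> closed (insert 0 X)"
  shows "\<exists>l. l \<noteq> 0 \<and> (\<forall>x\<in>X. l \<bullet> x \<noteq> 0)"
proof -
  obtain v where v: "v \<in> X" using nonempty by blast
  define C where "C = {x. rel v x}"
  have CX: "C \<subseteq> X" using relD by (auto simp: C_def)
  have "convex C"
    unfolding convex_contains_segment
  proof (intro ballI subsetI)
    fix x y z assume "x \<in> C" "y \<in> C" "z \<in> closed_segment x y"
    then have "rel x y" using rel_triangle[OF X, of v x y] by (simp add: C_def)
    then have "rel x z" using rel_segment \<open>z \<in> closed_segment x y\<close> by blast
    then show "z \<in> C" using rel_triangle[OF X, of x v z] rel_sym \<open>x \<in> C\<close> by (simp add: C_def)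
  qed
  have "0 \<notin> C" using CX zero by blast
  have scaleC: "c *\<^sub>R x \<in> C" if "x \<in> C" "c > 0" for c x using rel_scale that by (simp add: C_def)
  have "\<exists>l. l \<noteq> 0 \<and> (\<forall>x\<in>C. l \<bullet> x > 0)"
    using X
  proof
    assume o: "open X"
    obtain l where l: "l \<noteq> 0" "\<forall>x\<in>C. 0 \<le> l \<bullet> x"
      using separating_hyperplane_set_0[OF \<open>convex C\<close> \<open>0 \<notin> C\<close>] by blast
    have "l \<bullet> x > 0" if x: "x \<in> C" for x
    proof -
      have "open C" unfolding C_def by (rule open_rel[OF o])
      then obtain e where e: "e > 0" "cball x e \<subseteq> C" using x open_contains_cball by blast
      have "x - (e / norm l) *\<^sub>R l \<in> cball x e" using l e by (simp add: dist_norm)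
      then have "0 \<le> l \<bullet> (x - (e / norm l) *\<^sub>R l)" using l(2) e(2) by blast
      moreover have "l \<bullet> l > 0" using l(1) by simp
      then have "(e / norm l) * (l \<bullet> l) > 0" using e l by simp
      ultimately show ?thesis by (simp add: inner_diff_right)
    qed
    then show ?thesis using l(1) by blast
  next
    assume c: "closed (insert 0 X)"
    \<comment> \<open>If a limit point \<open>y\<close> in \<open>X\<close> were not in
      \<open>C\<close>, then \<open>- y\<close> would be. But the segment from a relative interior
      point \<open>x\<close> of \<open>C\<close> to \<open>y\<close> runs in \<open>C\<close>, so
      \<open>x\<close> would be related to both \<open>y\<close> and \<open>- y\<close>.\<close>
    have cl: "closure C \<subseteq> insert 0 C"
    proof
      fix y assume y: "y \<in> closure C"
      have "C \<subseteq> insert 0 X" using CX by blast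
      then have "y \<in> insert 0 X" using closure_minimal[OF _ c] y by blast
      moreover have "y \<in> C" if yX: "y \<in> X"
      proof (rule ccontr)
        assume "y \<notin> C"
        then have "rel v (- y)" using rel_or[OF v yX] by (simp add: C_def)
        have "rel_interior C \<noteq> {}" using rel_interior_eq_empty[OF \<open>convex C\<close>] rel_refl[OF v] by (auto simp: C_def)
        then obtain x where x: "x \<in> rel_interior C" by blast
        then have xC: "x \<in> C" using rel_interior_subset by blast
        have "open_segment x y \<subseteq> C"
          using rel_interior_closure_convex_segment[OF \<open>convex C\<close> x y] rel_interior_subset by blast
        then have "rel x y" using xC yX CX by (auto simp: rel_def closed_segment_eq_open)
        moreover have "rel x (- y)" using rel_triangle[OF X, of v x "- y"] xC \<open>rel v (- y)\<close> by (simp add: C_def)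
        ultimately show False using rel_not_both by blast
      qed
      ultimately show "y \<in> insert 0 C" by blast
    qed
    have eq: "C \<inter> sphere 0 1 = closure C \<inter> sphere 0 1" using cl closure_subset[of C] by auto
    have "compact (C \<inter> sphere 0 1)" unfolding eq by (intro closed_Int_compact) auto
    then have "compact (convex hull (C \<inter> sphere 0 1))" by (rule compact_convex_hull)
    moreover have sub: "convex hull (C \<inter> sphere 0 1) \<subseteq> C" by (intro hull_minimal \<open>convex C\<close>) auto
    ultimately obtain l b where l: "l \<noteq> 0" "0 < b" "\<forall>x\<in>convex hull (C \<inter> sphere 0 1). l \<bullet> x > b"
      using separating_hyperplane_closed_0[of "convex hull (C \<inter> sphere 0 1)"] \<open>0 \<notin> C\<close>
      by (auto simp: compact_imp_closed)
    have "l \<bullet> x > 0" if x: "x \<in> C" for x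
    proof -
      have "x \<noteq> 0" using x \<open>0 \<notin> C\<close> by blast
      then have "(1 / norm x) *\<^sub>R x \<in> C \<inter> sphere 0 1" using scaleC[OF x, of "1 / norm x"] by simp
      then have "l \<bullet> ((1 / norm x) *\<^sub>R x) > b" using l(3) by (meson hull_inc)
      then have "(1 / norm x) * (l \<bullet> x) > 0" using l(2) by simp
      then show ?thesis using \<open>x \<noteq> 0\<close> by (simp add: zero_less_divide_iff)
    qed
    then show ?thesis using l(1) by blast
  qed
  then obtain l where l: "l \<noteq> 0" "\<And>x. x \<in> C \<Longrightarrow> l \<bullet> x > 0" by blast
  have "l \<bullet> x \<noteq> 0" if "x \<in> X" for x
    using rel_or[OF v that] l(2)[of x] l(2)[of "- x"] by (auto simp: C_def)
  then show ?thesis using l(1) by blast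
qed

end

section \<open>A half of the double cone and its dual cone\<close>

definition dual_cone :: "'a::real_inner set \<Rightarrow> 'a set" where
  "dual_cone C = {f. \<forall>x\<in>C. 0 \<le> f \<bullet> x}"

locale half_cone = double_cone X for X :: "'a::euclidean_space set" +
  fixes l :: 'a
  assumes l_nz: "\<And>x. x \<in> X \<Longrightarrow> l \<bullet> x \<noteq> 0"
begin

definition C :: "'a set" where
  "C = {x \<in> X. 0 < l \<bullet> x}"

lemma X_iff: "x \<in> X \<longleftrightarrow> x \<in> C \<or> - x \<in> C"
proof
  assume "x \<in> X"
  then show "x \<in> C \<or> - x \<in> C" using l_nz[of x] uminus_in[of x] by (auto simp: C_def)
next
  assume "x \<in> C \<or> - x \<in> C"
  then show "x \<in> X" using uminus_in[of "- x"] by (auto simp: C_def)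
qed

lemma scale_C: "x \<in> C \<Longrightarrow> c > 0 \<Longrightarrow> c *\<^sub>R x \<in> C"
  using scale[of x c] by (simp add: C_def)

lemma C_nonempty: "C \<noteq> {}"
  using nonempty X_iff by blast

lemma zero_notin_C: "0 \<notin> C"
  using zero by (simp add: C_def)

text \<open>The segment from \<open>x\<close> to \<open>- y\<close> meets the kernel of
  \<open>l\<close>, at the parameter \<open>t\<close> below, and so leaves \<open>X\<close>; the
  dichotomy leaves only the segment from \<open>x\<close> to \<open>y\<close>.\<close>

lemma convex_C: "convex C"
  unfolding convex_contains_segment
proof (intro ballI)
  fix x y assume xy: "x \<in> C" "y \<in> C"
  have "\<not> closed_segment x (- y) \<subseteq> X"
  proof
    assume seg: "closed_segment x (- y) \<subseteq> X"
    define t where "t = (l \<bullet> x) / (l \<bullet> x + l \<bullet> y)"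
    have pos: "l \<bullet> x > 0" "l \<bullet> y > 0" using xy by (auto simp: C_def)
    then have t: "0 \<le> t" "t \<le> 1" by (auto simp: t_def field_simps)
    then have "(1 - t) *\<^sub>R x + t *\<^sub>R (- y) \<in> closed_segment x (- y)" unfolding in_segment by blast
    then have "(1 - t) *\<^sub>R x + t *\<^sub>R (- y) \<in> X" using seg by blast
    moreover have "l \<bullet> ((1 - t) *\<^sub>R x + t *\<^sub>R (- y)) = 0"
      using pos by (simp add: inner_add_right inner_diff_right t_def field_simps)
    ultimately show False using l_nz by blast
  qed
  then have seg: "closed_segment x y \<subseteq> X" using dichotomy xy by (auto simp: C_def)
  have "convex {x. 0 < l \<bullet> x}" by (rule convex_halfspace_gt)
  then have "closed_segment x y \<subseteq> {x. 0 < l \<bullet> x}"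
    using xy by (auto simp: convex_contains_segment C_def)
  with seg show "closed_segment x y \<subseteq> C" by (auto simp: C_def)
qed

lemma l_in_dual: "l \<in> dual_cone C"
  by (auto simp: dual_cone_def C_def)

lemma l_nonzero: "l \<noteq> 0"
  using C_nonempty by (auto simp: C_def)

lemma dual_cone_scale: "f \<in> dual_cone C \<Longrightarrow> 0 \<le> c \<Longrightarrow> c *\<^sub>R f \<in> dual_cone C"
  by (simp add: dual_cone_def)

text \<open>\<open>C\<close> is a cone: stretching a point with a negative value would break the
  bound, and shrinking one would break a positive \<open>b\<close>.\<close>

lemma dual_cone_if_bounded_below:
  assumes "\<And>x. x \<in> C \<Longrightarrow> b \<le> f \<bullet> x"
  shows "f \<in> dual_cone C" "b \<le> 0"
proof -
  show "f \<in> dual_cone C"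
    unfolding dual_cone_def
  proof (clarify, rule ccontr)
    fix x assume x: "x \<in> C" and neg: "\<not> 0 \<le> f \<bullet> x"
    define c where "c = (\<bar>b\<bar> + 1) / - (f \<bullet> x)"
    have "c > 0" unfolding c_def using neg by (intro divide_pos_pos) auto
    then have "b \<le> f \<bullet> (c *\<^sub>R x)" by (intro assms scale_C x)
    also have "\<dots> = - (\<bar>b\<bar> + 1)" using neg by (simp add: c_def field_simps)
    finally show False by linarith
  qed
  obtain x where x: "x \<in> C" using C_nonempty by blast
  show "b \<le> 0"
  proof (rule ccontr)
    assume b: "\<not> b \<le> 0"
    have fx: "f \<bullet> x > 0" using assms[OF x] b by linarith
    define c where "c = b / (2 * (f \<bullet> x))"
    have "c > 0" using b fx by (simp add: c_def)
    then have "b \<le> f \<bullet> (c *\<^sub>R x)" by (intro assms scale_C x)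
    then show False using b fx by (simp add: c_def)
  qed
qed

lemma open_C: "open X \<Longrightarrow> open C"
proof -
  assume "open X"
  moreover have "C = X \<inter> {x. 0 < l \<bullet> x}" by (auto simp: C_def)
  ultimately show ?thesis by (simp add: open_Int open_halfspace_gt)
qed

text \<open>A point of the open \<open>C\<close> can be moved a little against \<open>f\<close>
  inside \<open>C\<close>, which lowers the value strictly but not below 0.\<close>

lemma dual_cone_pos:
  assumes o: "open X" and f: "f \<in> dual_cone C" "f \<noteq> 0" and x: "x \<in> C"
  shows "0 < f \<bullet> x"
proof -
  obtain e where e: "e > 0" "cball x e \<subseteq> C" using x open_C[OF o] open_contains_cball by blast
  have "x - (e / norm f) *\<^sub>R f \<in> cball x e" using f e by (simp add: dist_norm)
  then have "0 \<le> f \<bullet> (x - (e / norm f) *\<^sub>R f)" using f(1) e(2) unfolding dual_cone_def by blast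
  moreover have "f \<bullet> f > 0" using f(2) by simp
  then have "(e / norm f) * (f \<bullet> f) > 0" using e f by simp
  ultimately show ?thesis by (simp add: inner_diff_right)
qed

text \<open>Bipolar theorem for the open cone, tested on the compact set of unit forms only.\<close>

lemma bidual_open:
  assumes o: "open X" and x: "\<And>f. f \<in> dual_cone C \<Longrightarrow> norm f = 1 \<Longrightarrow> 0 < f \<bullet> x"
  shows "x \<in> C"
proof (rule ccontr)
  assume "x \<notin> C"
  then obtain f b where f: "f \<noteq> 0" "\<forall>y\<in>{x}. f \<bullet> y \<le> b" "\<forall>y\<in>C. b \<le> f \<bullet> y"
    using separating_hyperplane_sets[of "{x}" C] convex_C C_nonempty by auto
  have fC: "f \<in> dual_cone C" "b \<le> 0" using dual_cone_if_bounded_below[of b f] f(3) by auto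
  have "0 < ((1 / norm f) *\<^sub>R f) \<bullet> x"
    by (rule x) (use f fC dual_cone_scale[of f "1 / norm f"] in auto)
  then have "0 < f \<bullet> x" using f(1) by (simp add: zero_less_divide_iff)
  then show False using f(2) fC(2) by auto
qed

text \<open>If all forms vanished at \<open>u\<close>, then by \<open>bidual_open\<close> the cone
  would contain a full line in direction \<open>u\<close>, which \<open>no_line\<close>
  forbids.\<close>

lemma dual_cone_separates_0:
  assumes o: "open X" and u: "u \<noteq> 0"
  shows "\<exists>f\<in>dual_cone C. norm f = 1 \<and> f \<bullet> u \<noteq> 0"
proof (rule ccontr)
  assume neg: "\<not> ?thesis"
  obtain x where x: "x \<in> C" using C_nonempty by blast
  have "x + b *\<^sub>R u \<in> C" for b
  proof (rule bidual_open[OF o])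
    fix f assume f: "f \<in> dual_cone C" "norm f = 1"
    then have "f \<bullet> u = 0" "f \<noteq> 0" using neg by auto
    then show "0 < f \<bullet> (x + b *\<^sub>R u)" using dual_cone_pos[OF o f(1) _ x] by (simp add: inner_add_right)
  qed
  then show False using no_line[OF u, of x] X_iff by blast
qed

lemma span_dual_cone:
  assumes o: "open X"
  shows "span (dual_cone C \<inter> sphere 0 1) = UNIV"
proof (rule ccontr)
  assume "span (dual_cone C \<inter> sphere 0 1) \<noteq> UNIV"
  then have "dim (dual_cone C \<inter> sphere 0 1) < DIM('a)"
    using dim_eq_full[of "dual_cone C \<inter> sphere 0 1"] dim_subset_UNIV[of "dual_cone C \<inter> sphere 0 1"] by simp
  then obtain u where u: "u \<noteq> 0" "\<And>f. f \<in> span (dual_cone C \<inter> sphere 0 1) \<Longrightarrow> orthogonal u f"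
    using orthogonal_to_subspace_exists[of "dual_cone C \<inter> sphere 0 1"] by blast
  obtain f where "f \<in> dual_cone C" "norm f = 1" "f \<bullet> u \<noteq> 0" using dual_cone_separates_0[OF o u(1)] by blast
  then show False using u(2)[of f] by (auto simp: span_base orthogonal_def inner_commute)
qed

lemma compact_dual_cone: "compact (dual_cone C \<inter> sphere 0 1)"
proof (rule closed_Int_compact)
  have "dual_cone C = (\<Inter>x\<in>C. {f. 0 \<le> f \<bullet> x})" by (auto simp: dual_cone_def)
  moreover have "closed {f. 0 \<le> f \<bullet> x}" for x :: 'a by (intro closed_Collect_le continuous_intros)
  ultimately show "closed (dual_cone C)" by (simp add: closed_INT)
qed simp

lemma closed_C:
  assumes "closed (insert 0 X)"
  shows "closed (insert 0 C)"
proof -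
  have "insert 0 C = insert 0 X \<inter> {x. 0 \<le> l \<bullet> x}" using l_nz by (force simp: C_def)
  then show ?thesis by (simp only:) (intro closed_Int closed_halfspace_ge assms)
qed

lemma bidual_closed:
  assumes c: "closed (insert 0 X)" and x: "\<And>f. f \<in> dual_cone C \<Longrightarrow> 0 \<le> f \<bullet> x"
  shows "x \<in> insert 0 C"
proof (rule ccontr)
  assume nx: "x \<notin> insert 0 C"
  have "convex (insert 0 C)"
    unfolding convex_contains_segment
  proof (intro ballI subsetI)
    fix y z w assume y: "y \<in> insert 0 C" and z: "z \<in> insert 0 C" and w: "w \<in> closed_segment y z"
    obtain t where t: "0 \<le> t" "t \<le> 1" "w = (1 - t) *\<^sub>R y + t *\<^sub>R z" using w by (auto simp: in_segment)
    have "closed_segment y z \<subseteq> C" if "y \<in> C" "z \<in> C" using convex_C that convex_contains_segment by blast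
    then show "w \<in> insert 0 C"
      using y z t w scale_C[of y "1 - t"] scale_C[of z t] by (cases "t = 0"; cases "t = 1") auto
  qed
  then obtain f b where f: "f \<bullet> x < b" "\<forall>y\<in>insert 0 C. b < f \<bullet> y"
    using separating_hyperplane_closed_point[OF _ closed_C[OF c] nx] by blast
  have "f \<in> dual_cone C" using dual_cone_if_bounded_below(1)[of b f] f(2) by (auto intro: less_imp_le)
  then have "0 \<le> f \<bullet> x" by (rule x)
  then show False using f by auto
qed

text \<open>Here \<open>m\<close> is the minimum of \<open>l\<close> over the unit vectors of
  \<open>C\<close>, positive by compactness. This is what bounds the tube of a compact set.\<close>

lemma l_interior_dual_cone:
  assumes c: "closed (insert 0 X)"
  obtains m where "m > 0" "\<And>u. norm u \<le> m \<Longrightarrow> l + u \<in> dual_cone C"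
proof -
  have eq: "C \<inter> sphere 0 1 = insert 0 C \<inter> sphere 0 1" by auto
  have comp: "compact (C \<inter> sphere 0 1)"
    unfolding eq by (intro closed_Int_compact closed_C[OF c]) simp
  obtain y where "y \<in> C" using C_nonempty by blast
  then have "(1 / norm y) *\<^sub>R y \<in> C \<inter> sphere 0 1"
    using scale_C[of y "1 / norm y"] zero_notin_C by (cases "y = 0") auto
  then have "C \<inter> sphere 0 1 \<noteq> {}" by blast
  then obtain x0 where x0: "x0 \<in> C \<inter> sphere 0 1" "\<And>x. x \<in> C \<inter> sphere 0 1 \<Longrightarrow> l \<bullet> x0 \<le> l \<bullet> x"
    using continuous_attains_inf[OF comp, of "\<lambda>x. l \<bullet> x"] continuous_on_inner[OF continuous_on_const continuous_on_id]
    by metis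
  have pos: "l \<bullet> x0 > 0" using x0(1) by (simp add: C_def)
  show thesis
  proof (rule that[OF pos])
    fix u :: 'a assume u: "norm u \<le> l \<bullet> x0"
    have "0 \<le> (l + u) \<bullet> x" if x: "x \<in> C" for x
    proof -
      have nx: "x \<noteq> 0" using x zero_notin_C by blast
      then have "(1 / norm x) *\<^sub>R x \<in> C \<inter> sphere 0 1" using scale_C[OF x, of "1 / norm x"] by simp
      then have "l \<bullet> x0 \<le> l \<bullet> ((1 / norm x) *\<^sub>R x)" by (rule x0(2))
      then have "(l \<bullet> x0) * norm x \<le> l \<bullet> x" using nx by (simp add: field_simps)
      moreover have "\<bar>u \<bullet> x\<bar> \<le> norm u * norm x" by (rule Cauchy_Schwarz_ineq2)
      moreover have "norm u * norm x \<le> (l \<bullet> x0) * norm x" using u by (intro mult_right_mono) auto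
      ultimately show ?thesis by (simp add: inner_add_left)
    qed
    then show "l + u \<in> dual_cone C" by (simp add: dual_cone_def)
  qed
qed

end

section \<open>The double cone over a properly convex set\<close>

definition cone_over :: "(real, 'n::finite) projective set \<Rightarrow> (real ^ 'n option) set" where
  "cone_over D = {x. x \<noteq> 0 \<and> proj x \<in> D}"

lemma proj_scaleR: "c \<noteq> 0 \<Longrightarrow> x \<noteq> 0 \<Longrightarrow> proj (c *\<^sub>R x) = proj (x :: real ^ 'n::finite option)"
  by (subst proj_eq_iff) (auto simp: scalar_mult_eq_scaleR intro!: exI[of _ "1 / c"])

lemma cone_over_scaleR: "x \<in> cone_over D \<Longrightarrow> c \<noteq> 0 \<Longrightarrow> c *\<^sub>R x \<in> cone_over D"
  by (simp add: cone_over_def proj_scaleR)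

lemma proj_mem_iff:
  fixes y :: "real ^ 'n::finite option"
  assumes P: "\<And>c y. c \<noteq> 0 \<Longrightarrow> P y \<Longrightarrow> P (c *\<^sub>R y)" and y: "y \<noteq> 0"
  shows "proj y \<in> {proj z | z. z \<noteq> 0 \<and> P z} \<longleftrightarrow> P y"
proof
  assume "proj y \<in> {proj z | z. z \<noteq> 0 \<and> P z}"
  then obtain z where z: "proj z = proj y" "z \<noteq> 0" "P z" by force
  then obtain c where c: "y = c *s z" using proj_eq_iff[OF z(2) y] by blast
  then have "c \<noteq> 0" using y by auto
  then show "P y" using P[OF _ z(3), of c] c by (simp add: scalar_mult_eq_scaleR)
qed (use y in blast)

lemma open_proj_set:
  fixes P :: "real ^ 'n::finite option \<Rightarrow> bool"
  assumes P: "\<And>c y. c \<noteq> 0 \<Longrightarrow> P y \<Longrightarrow> P (c *\<^sub>R y)" and o: "open {y. P y}"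
  shows "open {proj z | z. z \<noteq> 0 \<and> P z}"
proof -
  have "{v. v \<noteq> 0 \<and> proj v \<in> {proj z | z. z \<noteq> 0 \<and> P z}} = {v. P v} \<inter> - {0}"
    using proj_mem_iff[where P = P, OF P] by blast
  then show ?thesis unfolding open_projective_def using o by (simp add: open_Int open_Compl)
qed

lemma mem_span_2: "y \<in> span {v, w} \<longleftrightarrow> (\<exists>a b. y = a *\<^sub>R v + b *\<^sub>R w)"
proof -
  have "y \<in> span {v, w} \<longleftrightarrow> (\<exists>a b. y - a *\<^sub>R v = b *\<^sub>R w)"
    by (auto simp: span_breakdown_eq span_singleton)
  then show ?thesis by (auto simp: algebra_simps)
qed

lemma projective_line_span:
  fixes v w :: "real ^ 'n::finite option"
  assumes "v \<noteq> 0" "\<And>k. w \<noteq> k *\<^sub>R v"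
  shows "projective_line (proj ` (span {v, w} - {0}))"
proof -
  have "w \<noteq> v" using assms(2)[of 1] by simp
  have "independent {w, v}"
    using assms by (auto simp: independent_insert span_singleton)
  then have "dim (span {w, v}) = 2" using \<open>w \<noteq> v\<close> by (simp add: dim_eq_card_independent)
  then show ?thesis unfolding projective_line_def by (metis insert_commute subspace_span)
qed

text \<open>The component of \<open>w\<close> orthogonal to \<open>v\<close>, rescaled. It gives a
  coordinate on the plane of \<open>v\<close> and \<open>w\<close>.\<close>

lemma ex_coordinate_functional:
  fixes v w :: "'a::real_inner"
  assumes v: "v \<noteq> 0" and w: "\<And>k. w \<noteq> k *\<^sub>R v"
  shows "\<exists>q. q \<bullet> v = 0 \<and> q \<bullet> w = 1"
proof -
  define u where "u = w - ((v \<bullet> w) / (v \<bullet> v)) *\<^sub>R v"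
  have uv: "u \<bullet> v = 0" using v by (simp add: u_def inner_diff_left inner_commute[of w v])
  have "u \<noteq> 0" using w by (auto simp: u_def)
  have "w = u + ((v \<bullet> w) / (v \<bullet> v)) *\<^sub>R v" by (simp add: u_def)
  then have "u \<bullet> w = u \<bullet> u" using uv by (metis add.right_neutral inner_add_right inner_scaleR_right mult_zero_right)
  then show ?thesis using uv \<open>u \<noteq> 0\<close> by (intro exI[of _ "(1 / (u \<bullet> u)) *\<^sub>R u"]) simp
qed

lemma combination_in_cone_over:
  assumes "closed_segment v w \<subseteq> cone_over D" "0 \<le> a" "0 \<le> b" "a + b \<noteq> 0"
  shows "a *\<^sub>R v + b *\<^sub>R w \<in> cone_over D"
proof -
  have "(1 - b / (a + b)) *\<^sub>R v + (b / (a + b)) *\<^sub>R w \<in> closed_segment v w"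
    unfolding in_segment using assms(2-4) by (intro exI[of _ "b / (a + b)"]) (auto simp: field_simps)
  then have "(a + b) *\<^sub>R ((1 - b / (a + b)) *\<^sub>R v + (b / (a + b)) *\<^sub>R w) \<in> cone_over D"
    using assms(1,4) cone_over_scaleR by blast
  also have "(a + b) *\<^sub>R ((1 - b / (a + b)) *\<^sub>R v + (b / (a + b)) *\<^sub>R w) = a *\<^sub>R v + b *\<^sub>R w"
    using assms(4) by (simp add: scaleR_add_right right_diff_distrib)
  finally show ?thesis .
qed

text \<open>Up to sign, every nonzero combination of \<open>v\<close> and \<open>w\<close> is a
  nonnegative combination of \<open>v\<close> and \<open>w\<close> or of \<open>v\<close> and
  \<open>- w\<close>. Hence the whole projective line would lie in \<open>D\<close>.\<close>

lemma cone_over_not_both: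
  fixes v w :: "real ^ 'n::finite option"
  assumes D: "projective_convex D"
    and seg: "closed_segment v w \<subseteq> cone_over D" "closed_segment v (- w) \<subseteq> cone_over D"
  shows False
proof -
  have v: "v \<noteq> 0" using seg(1) by (auto simp: cone_over_def)
  have comb: "a *\<^sub>R v + b *\<^sub>R w \<in> cone_over D" if "a \<noteq> 0 \<or> b \<noteq> 0" for a b
  proof -
    have pos: "a *\<^sub>R v + b *\<^sub>R w \<in> cone_over D" if "a \<noteq> 0 \<or> b \<noteq> 0" "0 \<le> a" for a b
    proof (cases "0 \<le> b")
      case True
      then show ?thesis using combination_in_cone_over[OF seg(1), of a b] that by auto
    next
      case False
      then show ?thesis using combination_in_cone_over[OF seg(2), of a "- b"] that by auto
    qed
    show ?thesis
    proof (cases "0 \<le> a")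
      case False
      have "- 1 *\<^sub>R ((- a) *\<^sub>R v + (- b) *\<^sub>R w) \<in> cone_over D"
        by (rule cone_over_scaleR[OF pos]) (use False in auto)
      then show ?thesis by (simp add: add.commute)
    qed (use pos that in blast)
  qed
  have "w \<noteq> k *\<^sub>R v" for k
  proof
    assume "w = k *\<^sub>R v"
    then have "(- k) *\<^sub>R v + 1 *\<^sub>R w = 0" by simp
    then show False using comb[of "- k" 1] by (simp add: cone_over_def)
  qed
  then have "projective_line (proj ` (span {v, w} - {0}))" by (rule projective_line_span[OF v])
  moreover have "proj ` (span {v, w} - {0}) \<subseteq> D"
  proof
    fix p assume "p \<in> proj ` (span {v, w} - {0})"
    then obtain y where y: "p = proj y" "y \<noteq> 0" "y \<in> span {v, w}" by blast
    then obtain a b where ab: "p = proj (a *\<^sub>R v + b *\<^sub>R w)" "a *\<^sub>R v + b *\<^sub>R w \<noteq> 0"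
      using mem_span_2[of y v w] by blast
    then have "a \<noteq> 0 \<or> b \<noteq> 0" by auto
    then show "p \<in> D" using comb[of a b] ab(1) by (simp add: cone_over_def)
  qed
  ultimately show False using D unfolding projective_convex_def by blast
qed

text \<open>Points \<open>p\<close> and \<open>q\<close> of the two segments that are missing from the set disconnect its intersection
  with the line: on the plane, the product of two linear functionals vanishing at \<open>p\<close> and at \<open>q\<close>
  has opposite signs at \<open>v\<close> and \<open>w\<close>.\<close>

lemma cone_over_dichotomy:
  fixes v w :: "real ^ 'n::finite option"
  assumes D: "projective_convex D" and vw: "v \<in> cone_over D" "w \<in> cone_over D"
  shows "closed_segment v w \<subseteq> cone_over D \<or> closed_segment v (- w) \<subseteq> cone_over D"
proof -
  have v0: "v \<noteq> 0" and w0: "w \<noteq> 0" using vw by (auto simp: cone_over_def)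
  have mw: "- w \<in> cone_over D" using cone_over_scaleR[OF vw(2), of "-1"] by simp
  have multiple: "closed_segment v (k *\<^sub>R v) \<subseteq> cone_over D" if "k > 0" for k
  proof
    fix z assume "z \<in> closed_segment v (k *\<^sub>R v)"
    then obtain t where t: "0 \<le> t" "t \<le> 1" "z = (1 - t) *\<^sub>R v + t *\<^sub>R k *\<^sub>R v" by (auto simp: in_segment)
    have "(1 - t) + t * k > 0" using t that by (cases "t = 0") (auto intro!: add_nonneg_pos)
    moreover have "z = ((1 - t) + t * k) *\<^sub>R v" by (simp only: t(3) scaleR_add_left scaleR_scaleR)
    ultimately show "z \<in> cone_over D" using cone_over_scaleR[OF vw(1), of "(1 - t) + t * k"] by simp
  qed
  show ?thesis
  proof (cases "\<exists>k. w = k *\<^sub>R v")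
    case True
    then obtain k where k: "w = k *\<^sub>R v" by blast
    then have "k > 0 \<or> - k > 0" using w0 by auto
    then show ?thesis using multiple[of k] multiple[of "- k"] k by auto
  next
    case False
    have "v \<noteq> k *\<^sub>R w" for k
    proof
      assume k: "v = k *\<^sub>R w"
      then have "k \<noteq> 0" using v0 by auto
      then have "w = (1 / k) *\<^sub>R v" using k by simp
      then show False using False by blast
    qed
    then obtain \<alpha> where \<alpha>: "\<alpha> \<bullet> w = 0" "\<alpha> \<bullet> v = 1" using ex_coordinate_functional[OF w0, of v] by blast
    obtain \<beta> where \<beta>: "\<beta> \<bullet> v = 0" "\<beta> \<bullet> w = 1" using ex_coordinate_functional[OF v0, of w] False by blast
    show ?thesis
    proof (rule ccontr)
      assume "\<not> ?thesis"
      then obtain p q where p: "p \<in> closed_segment v w" "p \<notin> cone_over D"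
        and q: "q \<in> closed_segment v (- w)" "q \<notin> cone_over D" by blast
      obtain s where s: "0 \<le> s" "s \<le> 1" "p = (1 - s) *\<^sub>R v + s *\<^sub>R w" using p(1) by (auto simp: in_segment)
      obtain t where t: "0 \<le> t" "t \<le> 1" "q = (1 - t) *\<^sub>R v + t *\<^sub>R (- w)"
        using q(1) unfolding in_segment by blast
      have "s \<noteq> 0" "s \<noteq> 1" using s(3) p(2) vw by auto
      then have s01: "0 < s" "s < 1" using s(1,2) by auto
      have "t \<noteq> 0" "t \<noteq> 1" using t(3) q(2) vw mw by auto
      then have t01: "0 < t" "t < 1" using t(1,2) by auto
      \<comment> \<open>\<open>\<mu>\<close> vanishes at \<open>p\<close> and \<open>\<nu>\<close>
        at \<open>q\<close>. Their product \<open>F\<close> is homogeneous of degree 2, so its sign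
        is defined on projective points.\<close>
      define \<mu> where "\<mu> = s *\<^sub>R \<alpha> - (1 - s) *\<^sub>R \<beta>"
      define \<nu> where "\<nu> = t *\<^sub>R \<alpha> + (1 - t) *\<^sub>R \<beta>"
      define F where "F y = (\<mu> \<bullet> y) * (\<nu> \<bullet> y)" for y
      have \<mu>: "\<mu> \<bullet> (a *\<^sub>R v + b *\<^sub>R w) = s * a - (1 - s) * b" for a b
        using \<alpha> \<beta> by (simp add: \<mu>_def inner_add_right inner_diff_left algebra_simps)
      have \<nu>: "\<nu> \<bullet> (a *\<^sub>R v + b *\<^sub>R w) = t * a + (1 - t) * b" for a b
        using \<alpha> \<beta> by (simp add: \<nu>_def inner_add_right inner_add_left algebra_simps)
      have Fscale: "F (c *\<^sub>R y) = c\<^sup>2 * F y" for c y by (simp add: F_def power2_eq_square)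
      define U where "U = {proj z | z. z \<noteq> 0 \<and> 0 < F z}"
      define V where "V = {proj z | z. z \<noteq> 0 \<and> F z < 0}"
      have UV_iff: "proj y \<in> U \<longleftrightarrow> 0 < F y" "proj y \<in> V \<longleftrightarrow> F y < 0" if "y \<noteq> 0" for y
        unfolding U_def V_def using that
        by (subst proj_mem_iff; simp add: Fscale zero_less_mult_iff mult_less_0_iff)+
      have "open U" unfolding U_def
        by (rule open_proj_set)
          (auto simp: Fscale zero_less_mult_iff, auto simp: F_def intro!: open_Collect_less continuous_intros)
      have "open V" unfolding V_def
        by (rule open_proj_set)
          (auto simp: Fscale mult_less_0_iff, auto simp: F_def intro!: open_Collect_less continuous_intros)
      define L where "L = proj ` (span {v, w} - {0})"
      have L: "projective_line L" unfolding L_def using projective_line_span[OF v0] False by blast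
      have vL: "proj v \<in> D \<inter> L" "proj w \<in> D \<inter> L"
        using vw v0 w0 by (auto simp: cone_over_def L_def span_base)
      have "D \<inter> L \<subseteq> U \<union> V"
      proof
        fix x assume "x \<in> D \<inter> L"
        then obtain y where y: "x = proj y" "y \<noteq> 0" "y \<in> span {v, w}" "y \<in> cone_over D"
          by (auto simp: L_def cone_over_def)
        obtain a b where ab: "y = a *\<^sub>R v + b *\<^sub>R w" using y(3) mem_span_2 by blast
        have "F y \<noteq> 0"
        proof
          assume "F y = 0"
          then consider "\<mu> \<bullet> y = 0" | "\<nu> \<bullet> y = 0" by (auto simp: F_def)
          then show False
          proof cases
            case 1
            then have e: "s * a = (1 - s) * b" using \<mu>[of a b] ab by simp
            have "y = (b / s) *\<^sub>R p"
            proof -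
              have "b / s * (1 - s) = a" using e s01 by (simp add: field_simps)
              then show ?thesis using s01 by (simp add: ab s(3) scaleR_add_right)
            qed
            moreover from this have "b / s \<noteq> 0" using y(2) by auto
            ultimately have "p = (1 / (b / s)) *\<^sub>R y" "1 / (b / s) \<noteq> 0" by auto
            then show False using cone_over_scaleR[OF y(4)] p(2) by metis
          next
            case 2
            then have e: "t * a = - (1 - t) * b" using \<nu>[of a b] ab by (simp add: algebra_simps)
            have "y = (- b / t) *\<^sub>R q"
            proof -
              have "- b / t * (1 - t) = a" using e t01 by (simp add: field_simps)
              then show ?thesis using t01 by (simp add: ab t(3) scaleR_diff_right)
            qed
            moreover from this have "- b / t \<noteq> 0" using y(2) by auto
            ultimately have "q = (1 / (- b / t)) *\<^sub>R y" "1 / (- b / t) \<noteq> 0" by auto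
            then show False using cone_over_scaleR[OF y(4)] q(2) by metis
          qed
        qed
        then show "x \<in> U \<union> V" using UV_iff[OF y(2)] y(1) by auto
      qed
      moreover have "U \<inter> V \<inter> (D \<inter> L) = {}"
      proof -
        have False if xU: "x \<in> U" and xV: "x \<in> V" for x
        proof -
          obtain y where y: "x = proj y" "y \<noteq> 0" "0 < F y" using xU unfolding U_def by blast
          then show False using UV_iff(2)[OF y(2)] xV by simp
        qed
        then show ?thesis by blast
      qed
      moreover have "connected (D \<inter> L)" using D L unfolding projective_convex_def by blast
      ultimately have "U \<inter> (D \<inter> L) = {} \<or> V \<inter> (D \<inter> L) = {}"
        using connectedD[OF _ \<open>open U\<close> \<open>open V\<close>] by blast
      moreover have "F v > 0"
        using \<mu>[of 1 0] \<nu>[of 1 0] s01 t01 by (simp add: F_def)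
      moreover have "F w < 0"
        using \<mu>[of 0 1] \<nu>[of 0 1] s01 t01 by (simp add: F_def mult_neg_pos)
      ultimately show False using vL UV_iff v0 w0 by blast
    qed
  qed
qed

text \<open>A line with direction \<open>u\<close> in the cone projects onto a projective line minus
  the point \<open>proj u\<close>.\<close>

lemma cone_over_no_line:
  fixes u :: "real ^ 'n::finite option"
  assumes D: "properly_convex D" and u: "u \<noteq> 0"
  shows "\<exists>b. x + b *\<^sub>R u \<notin> cone_over D"
proof (rule ccontr)
  assume "\<not> ?thesis"
  then have all: "\<And>b. x + b *\<^sub>R u \<in> cone_over D" by blast
  have "x \<noteq> k *\<^sub>R u" for k using all[of "- k"] by (auto simp: cone_over_def)
  then have "projective_line (proj ` (span {u, x} - {0}))" by (rule projective_line_span[OF u])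
  moreover have "proj u \<in> proj ` (span {u, x} - {0})" using u by (auto simp: span_base)
  moreover have "proj ` (span {u, x} - {0}) - {proj u} \<subseteq> D"
  proof
    fix p assume p: "p \<in> proj ` (span {u, x} - {0}) - {proj u}"
    then obtain y where y: "p = proj y" "y \<noteq> 0" "y \<in> span {u, x}" by blast
    then obtain b a where ab: "p = proj (b *\<^sub>R u + a *\<^sub>R x)" "b *\<^sub>R u + a *\<^sub>R x \<noteq> 0"
      using mem_span_2[of y u x] by blast
    have "a \<noteq> 0"
    proof
      assume "a = 0"
      then have "p = proj u" using ab proj_scaleR[of b u] u by auto
      then show False using p by blast
    qed
    then have "a *\<^sub>R (x + (b / a) *\<^sub>R u) = b *\<^sub>R u + a *\<^sub>R x" by (simp add: algebra_simps)
    moreover have "a *\<^sub>R (x + (b / a) *\<^sub>R u) \<in> cone_over D" using cone_over_scaleR[OF all] \<open>a \<noteq> 0\<close> by blast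
    ultimately show "p \<in> D" using ab(1) by (simp add: cone_over_def)
  qed
  ultimately show False using D unfolding properly_convex_def by blast
qed

lemma double_cone_cone_over:
  fixes D :: "(real, 'n::finite) projective set"
  assumes D: "properly_convex D"
  shows "double_cone (cone_over D)"
proof
  have pc: "projective_convex D" using D by (simp add: properly_convex_def)
  show "c *\<^sub>R x \<in> cone_over D" if "x \<in> cone_over D" "c \<noteq> 0" for c x
    using cone_over_scaleR that by blast
  show "0 \<notin> cone_over D" by (simp add: cone_over_def)
  \<comment> \<open>Nonemptiness holds because \<open>D\<close> is not contained in a hyperplane;
    any nonzero form serves.\<close>
  have "(axis None 1 :: real ^ 'n option) \<noteq> 0" by (simp add: axis_eq_0_iff)
  then have "D \<noteq> {}" using D unfolding properly_convex_def by blast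
  then obtain p where "p \<in> D" by blast
  then show "cone_over D \<noteq> {}" by (cases p rule: proj_cases) (auto simp: cone_over_def)
  show "closed_segment x y \<subseteq> cone_over D \<or> closed_segment x (- y) \<subseteq> cone_over D"
    if "x \<in> cone_over D" "y \<in> cone_over D" for x y
    using cone_over_dichotomy[OF pc that] .
  show False if "closed_segment x y \<subseteq> cone_over D" "closed_segment x (- y) \<subseteq> cone_over D" for x y
    using cone_over_not_both[OF pc that] .
  show "\<exists>b. x + b *\<^sub>R u \<notin> cone_over D" if "u \<noteq> 0" for x u
    using cone_over_no_line[OF D that] .
qed

lemma open_cone_over: "open D \<Longrightarrow> open (cone_over D)"
  by (simp add: open_projective_def cone_over_def)

text \<open>A compact \<open>D\<close> that misses \<open>proj x\<close> is covered by the complements of the closed neighbourhoods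
  of \<open>proj x\<close> that are given by bounds on the angle with \<open>x\<close>.\<close>

lemma closed_cone_over:
  fixes D :: "(real, 'n::finite) projective set"
  assumes D: "compact D"
  shows "closed (insert 0 (cone_over D))"
proof -
  have "x \<in> insert 0 (cone_over D)" if cl: "x \<in> closure (insert 0 (cone_over D))" for x
  proof (rule ccontr)
    assume "x \<notin> insert 0 (cone_over D)"
    then have x: "x \<noteq> 0" "x \<notin> cone_over D" by auto
    define P where "P k y \<longleftrightarrow> \<bar>y \<bullet> x\<bar> < k * norm y * norm x" for k y
    have Pscale: "P k (c *\<^sub>R y)" if "c \<noteq> 0" "P k y" for k c y
      using that by (simp add: P_def abs_mult mult_ac)
    define U where "U k = {proj z | z. z \<noteq> 0 \<and> P k z}" for k
    have "open (U k)" for k unfolding U_def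
      by (rule open_proj_set[where P = "P k", OF Pscale]) (auto simp: P_def intro!: open_Collect_less continuous_intros)
    moreover have "D \<subseteq> (\<Union>k\<in>{0..<1}. U k)"
    proof
      fix p assume p: "p \<in> D"
      obtain y where y: "y \<noteq> 0" "p = proj y" by (rule proj_cases)
      then have yX: "y \<in> cone_over D" using p by (simp add: cone_over_def)
      have n: "norm y * norm x > 0" using x y by simp
      have "\<bar>y \<bullet> x\<bar> \<noteq> norm y * norm x"
      proof
        assume "\<bar>y \<bullet> x\<bar> = norm y * norm x"
        then have "norm y *\<^sub>R x = norm x *\<^sub>R y \<or> norm y *\<^sub>R x = - norm x *\<^sub>R y"
          by (simp add: norm_cauchy_schwarz_abs_eq)
        then have "norm y *\<^sub>R x \<in> cone_over D"
          using cone_over_scaleR[OF yX, of "norm x"] cone_over_scaleR[OF yX, of "- norm x"] x(1) by auto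
        from cone_over_scaleR[OF this, of "1 / norm y"] show False using y(1) x(2) by simp
      qed
      then have "\<bar>y \<bullet> x\<bar> / (norm y * norm x) < 1"
        using Cauchy_Schwarz_ineq2[of y x] n by (simp add: divide_less_eq)
      then obtain k where k: "\<bar>y \<bullet> x\<bar> / (norm y * norm x) < k" "k < 1" using dense by blast
      have "0 \<le> \<bar>y \<bullet> x\<bar> / (norm y * norm x)" by simp
      then have "0 \<le> k" using k(1) by linarith
      then have "k \<in> {0..<1}" using k(2) by simp
      moreover have "P k y" using k n by (simp add: P_def divide_less_eq mult.assoc)
      ultimately show "p \<in> (\<Union>k\<in>{0..<1}. U k)" using y by (auto simp: U_def)
    qed
    ultimately obtain F where F: "F \<subseteq> {0..<1}" "finite F" "D \<subseteq> (\<Union>k\<in>F. U k)"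
      using compactE_image[OF D, of "{0..<1}" U] by metis
    \<comment> \<open>Inserting 0 makes the maximum meaningful also for an empty subcover.\<close>
    define k0 where "k0 = Max (insert 0 F)"
    have k0: "k0 < 1" "\<And>k. k \<in> F \<Longrightarrow> k \<le> k0" using F by (auto simp: k0_def)
    have "cone_over D \<subseteq> {y. \<bar>y \<bullet> x\<bar> \<le> k0 * norm y * norm x}"
    proof
      fix y assume y: "y \<in> cone_over D"
      then obtain k where k: "k \<in> F" "proj y \<in> U k" using F(3) by (auto simp: cone_over_def)
      then have "P k y" using proj_mem_iff[where P = "P k", OF Pscale] y by (simp add: U_def cone_over_def)
      moreover have "k * norm y * norm x \<le> k0 * norm y * norm x"
        using k0(2)[OF k(1)] by (intro mult_right_mono) auto
      ultimately show "y \<in> {y. \<bar>y \<bullet> x\<bar> \<le> k0 * norm y * norm x}" by (simp add: P_def)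
    qed
    then have "insert 0 (cone_over D) \<subseteq> {y. \<bar>y \<bullet> x\<bar> \<le> k0 * norm y * norm x}" by auto
    moreover have "closed {y. \<bar>y \<bullet> x\<bar> \<le> k0 * norm y * norm x}"
      by (intro closed_Collect_le continuous_intros)
    ultimately have "x \<in> {y. \<bar>y \<bullet> x\<bar> \<le> k0 * norm y * norm x}" using cl closure_minimal by blast
    then have "norm x * norm x \<le> k0 * (norm x * norm x)"
      by (simp add: power2_norm_eq_inner[symmetric] power2_eq_square mult.assoc)
    then show False using x(1) k0(1) by (simp add: mult_le_cancel_right1)
  qed
  then show ?thesis by (metis closure_subset_eq subsetI)
qed

section \<open>Elliptic tubes in homogeneous coordinates\<close>

text \<open>The complex linear extension of the real form with coefficients \<open>f\<close>,
  without conjugation.\<close>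

definition cev :: "real ^ 'm::finite \<Rightarrow> complex ^ 'm \<Rightarrow> complex" where
  "cev f w = (\<Sum>i\<in>UNIV. of_real (f $ i) * w $ i)"

lemma cev_add_right: "cev f (x + y) = cev f x + cev f y"
  by (simp add: cev_def algebra_simps sum.distrib)

lemma cev_smult: "cev f (c *s x) = c * cev f x"
  by (simp add: cev_def algebra_simps sum_distrib_left)

lemma cev_add_left: "cev (f + g) x = cev f x + cev g x"
  by (simp add: cev_def algebra_simps sum.distrib)

lemma cev_diff_left: "cev (f - g) x = cev f x - cev g x"
  by (simp add: cev_def algebra_simps sum_subtractf)

lemma cev_scaleR_left: "cev (c *\<^sub>R f) x = of_real c * cev f x"
  by (simp add: cev_def algebra_simps sum_distrib_left)

lemma cev_complex_vec: "cev f (complex_vec x) = of_real (f \<bullet> x)"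
  by (simp add: cev_def complex_vec_def inner_vec_def)

lemma cev_axis: "cev (axis i 1) w = w $ i"
proof -
  have "cev (axis i 1) w = (\<Sum>j\<in>UNIV. if j = i then w $ j else 0)"
    unfolding cev_def by (rule sum.cong) (auto simp: axis_def)
  then show ?thesis by simp
qed

lemma continuous_on_cev [continuous_intros]:
  assumes "continuous_on S F" "continuous_on S W"
  shows "continuous_on S (\<lambda>x. cev (F x) (W x))"
  unfolding cev_def using assms by (intro continuous_intros)

lemma cev_complex_vec_left: "(\<Sum>i\<in>UNIV. complex_vec l $ i * w $ i) = cev l w"
  by (simp add: cev_def complex_vec_def)

lemma complex_vec_uminus: "complex_vec (- x) = - complex_vec x"
  by (simp add: complex_vec_def vec_eq_iff)

lemma complex_vec_scaleR: "complex_vec (c *\<^sub>R x) = of_real c *s complex_vec x"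
  by (simp add: complex_vec_def vec_eq_iff)

lemma complex_vec_eq_0: "complex_vec x = 0 \<longleftrightarrow> x = 0"
  by (simp add: complex_vec_def vec_eq_iff)

lemma complex_vec_Re_Im:
  "w = complex_vec (\<chi> i. Re (w $ i)) + \<i> *s complex_vec (\<chi> i. Im (w $ i))"
  by (simp add: complex_vec_def vec_eq_iff complex_eq)

lemma cev_Re_Im:
  "Re (cev f w) = f \<bullet> (\<chi> i. Re (w $ i))" "Im (cev f w) = f \<bullet> (\<chi> i. Im (w $ i))"
  by (simp_all add: cev_def inner_vec_def)

text \<open>Rotate an element of least argument to slightly above the positive real axis.\<close>

lemma ex_rotation_into_quadrant:
  fixes Z :: "complex set"
  assumes Z: "compact Z" "Z \<noteq> {}" and pos: "\<And>x y. x \<in> Z \<Longrightarrow> y \<in> Z \<Longrightarrow> 0 < Re (x * cnj y)"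
  shows "\<exists>c. norm c = 1 \<and> (\<forall>z\<in>Z. 0 < Re (c * z) \<and> 0 < Im (c * z))"
proof -
  obtain z0 where z0: "z0 \<in> Z" using Z(2) by blast
  \<comment> \<open>The tangent of the argument relative to \<open>z0\<close>. As
    \<open>Re (z * cnj z0) > 0\<close>, these arguments lie between -pi/2 and pi/2, where comparing
    tangents compares arguments.\<close>
  define slope where "slope z = Im (z * cnj z0) / Re (z * cnj z0)" for z
  have "continuous_on Z slope" unfolding slope_def
    using pos[OF _ z0] by (intro continuous_intros) fastforce
  then obtain z1 where z1: "z1 \<in> Z" "\<And>z. z \<in> Z \<Longrightarrow> slope z1 \<le> slope z"
    using continuous_attains_inf[OF Z] by blast
  have im: "0 \<le> Im (z * cnj z1)" if z: "z \<in> Z" for z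
  proof -
    define a b where "a = z * cnj z0" "b = z1 * cnj z0"
    have ab: "0 < Re a" "0 < Re b" using pos z z0 z1 by (auto simp: a_b_def)
    have "Im b / Re b \<le> Im a / Re a" using z1(2)[OF z] by (simp add: slope_def a_b_def)
    then have "Im b * Re a \<le> Im a * Re b" using ab by (simp add: field_simps)
    then have "0 \<le> Im (a * cnj b)" by (simp add: algebra_simps)
    also have "a * cnj b = (z * cnj z1) * of_real ((norm z0)\<^sup>2)"
      unfolding a_b_def complex_norm_square by (simp add: mult_ac)
    finally have "0 \<le> Im ((z * cnj z1) * of_real ((norm z0)\<^sup>2))" .
    moreover have "Im (x * of_real r) = Im x * r" for x r by simp
    ultimately have "0 \<le> Im (z * cnj z1) * (norm z0)\<^sup>2" by (simp only:)
    moreover have "z0 \<noteq> 0" using pos[OF z0 z0] by auto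
    ultimately show ?thesis by (simp add: zero_le_mult_iff)
  qed
  obtain m where m: "m > 0" "\<And>z. z \<in> Z \<Longrightarrow> m \<le> Re (z * cnj z1)"
  proof -
    have "continuous_on Z (\<lambda>z. Re (z * cnj z1))" by (intro continuous_intros)
    then obtain x where "x \<in> Z" "\<And>z. z \<in> Z \<Longrightarrow> Re (x * cnj z1) \<le> Re (z * cnj z1)"
      using continuous_attains_inf[OF Z] by blast
    then show thesis using that pos z1(1) by blast
  qed
  obtain M where M: "M \<ge> 0" "\<And>z. z \<in> Z \<Longrightarrow> Im (z * cnj z1) \<le> M"
  proof -
    have "continuous_on Z (\<lambda>z. Im (z * cnj z1))" by (intro continuous_intros)
    then obtain x where "x \<in> Z" "\<And>z. z \<in> Z \<Longrightarrow> Im (z * cnj z1) \<le> Im (x * cnj z1)"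
      using continuous_attains_sup[OF Z] by blast
    then show thesis using that im by blast
  qed
  \<comment> \<open>An additional rotation by the argument of \<open>1 + \<i> * \<epsilon>\<close>
    makes all imaginary parts positive; real parts stay positive as
    \<open>\<epsilon> * M < m\<close>.\<close>
  define \<epsilon> where "\<epsilon> = m / (M + 1)"
  have \<epsilon>: "\<epsilon> > 0" using m M by (simp add: \<epsilon>_def)
  define c0 where "c0 = (1 + \<i> * of_real \<epsilon>) * cnj z1"
  have c0: "0 < Re (c0 * z) \<and> 0 < Im (c0 * z)" if z: "z \<in> Z" for z
  proof -
    define b where "b = z * cnj z1"
    have eq: "c0 * z = (1 + \<i> * of_real \<epsilon>) * b" by (simp add: c0_def b_def)
    have "\<epsilon> * Im b \<le> \<epsilon> * M" using M(2)[OF z] \<epsilon> by (simp add: b_def)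
    also have "\<epsilon> * M < \<epsilon> * (M + 1)" using \<epsilon> by simp
    also have "\<dots> = m" using M(1) by (simp add: \<epsilon>_def)
    also have "m \<le> Re b" using m(2)[OF z] by (simp add: b_def)
    finally have "0 < Re (c0 * z)" unfolding eq by simp
    moreover have "0 < \<epsilon> * Re b" using \<epsilon> pos[OF z z1(1)] by (simp add: b_def)
    then have "0 < Im (c0 * z)" unfolding eq using im[OF z] by (simp add: b_def)
    ultimately show ?thesis by simp
  qed
  then have "c0 \<noteq> 0" using z0 by force
  define c where "c = c0 / of_real (norm c0)"
  have "c * z = (1 / norm c0) *\<^sub>R (c0 * z)" for z by (simp add: c_def scaleR_conv_of_real)
  then have "\<forall>z\<in>Z. 0 < Re (c * z) \<and> 0 < Im (c * z)" using c0 \<open>c0 \<noteq> 0\<close> by simp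
  moreover have "norm c = 1" using \<open>c0 \<noteq> 0\<close> by (simp add: c_def norm_divide)
  ultimately show ?thesis by blast
qed

lemma proj_mem_hyperplane_iff:
  fixes w :: "complex ^ 'n::finite option"
  assumes "w \<noteq> 0"
  shows "proj w \<in> proj_hyperplane (complex_vec l) \<longleftrightarrow> cev l w = 0"
proof
  assume "proj w \<in> proj_hyperplane (complex_vec l)"
  then obtain v where v: "proj w = proj v" "v \<noteq> 0" "cev l v = 0"
    unfolding proj_hyperplane_def cev_complex_vec_left by blast
  then obtain c where "w = c *s v" using proj_eq_iff[OF v(2) assms] by metis
  then show "cev l w = 0" using v(3) by (simp add: cev_smult)
next
  assume "cev l w = 0"
  then show "proj w \<in> proj_hyperplane (complex_vec l)"
    unfolding proj_hyperplane_def cev_complex_vec_left using assms by blast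
qed

section \<open>Membership in the tube in terms of the dual cone\<close>

locale tube_cone = half_cone "cone_over D" l
  for D :: "(real, 'n::finite) projective set" and l :: "real ^ 'n option"
begin

lemma rel_if_in_C:
  assumes "x \<in> C" "y \<in> C"
  shows "rel x y"
proof -
  have "closed_segment x y \<subseteq> C" using convex_C assms by (simp add: convex_contains_segment)
  then show ?thesis by (auto simp: rel_def C_def)
qed

lemma combination_in_C:
  assumes x: "x \<in> C" and y: "y \<in> C" and ab: "0 \<le> a" "0 \<le> b" "a + b \<noteq> 0"
  shows "a *\<^sub>R x + b *\<^sub>R y \<in> C"
proof -
  have "closed_segment x y \<subseteq> cone_over D" using rel_if_in_C[OF x y] by (simp add: rel_def)
  then have "a *\<^sub>R x + b *\<^sub>R y \<in> cone_over D" using ab by (rule combination_in_cone_over)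
  moreover have "0 < l \<bullet> (a *\<^sub>R x + b *\<^sub>R y)"
  proof -
    have "0 < l \<bullet> x" "0 < l \<bullet> y" using x y by (auto simp: C_def)
    then show ?thesis using ab
      by (cases "a = 0") (auto simp: inner_add_right intro!: add_pos_nonneg)
  qed
  ultimately show ?thesis by (simp add: C_def)
qed

text \<open>Rescaling both coefficients by \<open>k\<close> multiplies \<open>c0 * cnj c1\<close> by
  a nonnegative real. If \<open>v0\<close> and \<open>v1\<close> are independent, the segment
  between them lies in the cone, so both are in \<open>C\<close> or both in \<open>- C\<close>, and
  a common sign change suffices. Dependent vectors give a single point.\<close>

lemma elliptic_tube_memD:
  assumes w: "w \<noteq> 0" and t: "proj w \<in> elliptic_tube D"
  obtains x y c d where "x \<in> C" "y \<in> C" "w = c *s complex_vec x + d *s complex_vec y" "0 \<le> Re (c * cnj d)"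
proof -
  obtain v0 v1 where v: "v0 \<noteq> 0" "v1 \<noteq> 0" "proj_segment v0 v1 \<subseteq> D" "proj w \<in> elliptic_segment v0 v1"
    using t unfolding elliptic_tube_def by blast
  obtain c0 c1 where c: "proj w = proj (c0 *s complex_vec v0 + c1 *s complex_vec v1)" "0 \<le> Re (c0 * cnj c1)"
    "c0 *s complex_vec v0 + c1 *s complex_vec v1 \<noteq> 0"
    using v(4) unfolding elliptic_segment_def by blast
  obtain k where k: "w = k *s (c0 *s complex_vec v0 + c1 *s complex_vec v1)"
    using c(1) proj_eq_iff[OF c(3) w] by metis
  define c d where "c = k * c0" "d = k * c1"
  have wcd: "w = c *s complex_vec v0 + d *s complex_vec v1"
    by (simp add: k c_d_def vector_add_ldistrib vector_smult_assoc)
  have "c * cnj d = of_real ((norm k)\<^sup>2) * (c0 * cnj c1)"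
    unfolding c_d_def complex_norm_square by (simp add: mult_ac)
  then have recd: "0 \<le> Re (c * cnj d)" using c(2) by (simp add: zero_le_mult_iff)
  have inX: "a *\<^sub>R v0 + b *\<^sub>R v1 \<in> cone_over D" if "0 \<le> a * b" "a *\<^sub>R v0 + b *\<^sub>R v1 \<noteq> 0" for a b
  proof -
    have "proj (a *s v0 + b *s v1) \<in> proj_segment v0 v1"
      unfolding proj_segment_def using that by (auto simp: scalar_mult_eq_scaleR)
    then show ?thesis using v(3) that(2) by (auto simp: cone_over_def scalar_mult_eq_scaleR)
  qed
  have v0X: "v0 \<in> cone_over D" using inX[of 1 0] v(1) by simp
  have v1X: "v1 \<in> cone_over D" using inX[of 0 1] v(2) by simp
  show thesis
  proof (cases "\<exists>a. v1 = a *\<^sub>R v0")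
    case True
    then obtain a where a: "v1 = a *\<^sub>R v0" by blast
    have w': "w = (c + d * of_real a) *s complex_vec v0"
      by (simp add: wcd a complex_vec_scaleR vector_smult_assoc vector_sadd_rdistrib)
    show thesis
    proof (cases "v0 \<in> C")
      case True
      then show thesis using that[of v0 v0 "c + d * of_real a" 0] w' by simp
    next
      case False
      then have "- v0 \<in> C" using v0X X_iff by blast
      then show thesis using that[of "- v0" "- v0" "- (c + d * of_real a)" 0] w'
        by (simp add: complex_vec_uminus vec_eq_iff)
    qed
  next
    case False
    have "closed_segment v0 v1 \<subseteq> cone_over D"
    proof
      fix z assume "z \<in> closed_segment v0 v1"
      then obtain t where t: "0 \<le> t" "t \<le> 1" "z = (1 - t) *\<^sub>R v0 + t *\<^sub>R v1" by (auto simp: in_segment)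
      have "z \<noteq> 0"
      proof
        assume "z = 0"
        show False
        proof (cases "t = 0")
          case True
          then show False using t \<open>z = 0\<close> v(1) by simp
        next
          case nz: False
          have "t *\<^sub>R v1 = (t - 1) *\<^sub>R v0"
            using t(3) \<open>z = 0\<close> by (simp add: algebra_simps eq_neg_iff_add_eq_0)
          then have "(1 / t) *\<^sub>R t *\<^sub>R v1 = ((1 / t) * (t - 1)) *\<^sub>R v0" by simp
          then have "v1 = ((1 / t) * (t - 1)) *\<^sub>R v0" using nz by simp
          then show False using False by blast
        qed
      qed
      then show "z \<in> cone_over D" using inX[of "1 - t" t] t by simp
    qed
    then have rel: "rel v0 v1" by (simp add: rel_def)
    consider "v0 \<in> C" "v1 \<in> C" | "- v0 \<in> C" "- v1 \<in> C" | "v0 \<in> C" "- v1 \<in> C" | "- v0 \<in> C" "v1 \<in> C"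
      using v0X v1X X_iff by blast
    then show thesis
    proof cases
      case 1
      then show thesis using that wcd recd by blast
    next
      case 2
      then show thesis using that[of "- v0" "- v1" "- c" "- d"] wcd recd
        by (simp add: complex_vec_uminus vec_eq_iff)
    next
      case 3
      then have "rel v0 (- v1)" by (intro rel_if_in_C)
      then show thesis using rel_not_both[OF rel] by blast
    next
      case 4
      then have "rel v1 (- v0)" by (intro rel_if_in_C)
      then show thesis using rel_not_both[OF rel_sym[OF rel]] by blast
    qed
  qed
qed

text \<open>The coefficients \<open>1 / c\<close> and \<open>\<i> / c\<close> are perpendicular, a
  boundary case of the defining inequality. If \<open>x\<close> or \<open>y\<close> is 0, a segment
  with equal ends is used.\<close>

lemma elliptic_tube_memI:
  assumes x: "x \<in> insert 0 C" and y: "y \<in> insert 0 C" and w: "w \<noteq> 0" and c: "c \<noteq> 0"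
    and eq: "c *s w = complex_vec x + \<i> *s complex_vec y"
  shows "proj w \<in> elliptic_tube D"
proof -
  have seg: "proj_segment p q \<subseteq> D" if pq: "p \<in> C" "q \<in> C" for p q
  proof
    fix z assume "z \<in> proj_segment p q"
    then obtain a b where ab: "z = proj (a *\<^sub>R p + b *\<^sub>R q)" "0 \<le> a * b" "a *\<^sub>R p + b *\<^sub>R q \<noteq> 0"
      by (auto simp: proj_segment_def scalar_mult_eq_scaleR)
    then have nz: "a \<noteq> 0 \<or> b \<noteq> 0" by auto
    have "a *\<^sub>R p + b *\<^sub>R q \<in> cone_over D"
    proof (cases "0 \<le> a \<and> 0 \<le> b")
      case True
      then have "a + b \<noteq> 0" using nz by auto
      then show ?thesis using combination_in_C[OF pq] True X_iff by blast
    next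
      case False
      then have n: "a \<le> 0" "b \<le> 0" "- a + - b \<noteq> 0" using ab(2) nz by (auto simp: zero_le_mult_iff)
      have "(- a) *\<^sub>R p + (- b) *\<^sub>R q \<in> C" by (rule combination_in_C[OF pq]) (use n in auto)
      then have "- (a *\<^sub>R p + b *\<^sub>R q) \<in> C" by (simp add: algebra_simps)
      then show ?thesis using X_iff by blast
    qed
    then show "z \<in> D" using ab(1) by (simp add: cone_over_def)
  qed
  have in_tube: "proj w \<in> elliptic_tube D"
    if "p \<in> C" "q \<in> C" "w = c0 *s complex_vec p + c1 *s complex_vec q" "0 \<le> Re (c0 * cnj c1)" for p q c0 c1
  proof -
    have "proj w \<in> elliptic_segment p q"
      unfolding elliptic_segment_def using that w by blast
    moreover have "p \<noteq> 0" "q \<noteq> 0" using that(1,2) zero_notin_C by auto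
    ultimately show ?thesis unfolding elliptic_tube_def using seg[OF that(1,2)] by blast
  qed
  have wxy: "w = (1 / c) *s complex_vec x + (\<i> / c) *s complex_vec y"
  proof -
    have "(1 / c) *s (c *s w) = (1 / c) *s complex_vec x + (\<i> / c) *s complex_vec y"
      unfolding eq by (simp add: vector_add_ldistrib vector_smult_assoc)
    then show ?thesis using c by (simp add: vector_smult_assoc)
  qed
  have "Re ((1 / c) * cnj (\<i> / c)) = 0"
  proof -
    have "(1 / c) * cnj (\<i> / c) = - \<i> * ((1 / c) * cnj (1 / c))" by simp
    also have "\<dots> = - \<i> * of_real ((norm (1 / c))\<^sup>2)" by (simp only: complex_norm_square)
    finally show ?thesis by simp
  qed
  then have 1: ?thesis if "x \<in> C" "y \<in> C" using in_tube[OF that wxy] by simp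
  have "complex_vec (0 :: real ^ 'n option) = 0" by (simp add: complex_vec_eq_0)
  then have 2: ?thesis if "x \<in> C" "y = 0" using in_tube[of x x "1 / c" 0] that wxy by simp
  have 3: ?thesis if "y \<in> C" "x = 0"
    using in_tube[of y y "\<i> / c" 0] that wxy \<open>complex_vec 0 = 0\<close> by simp
  have "\<not> (x = 0 \<and> y = 0)" using wxy w \<open>complex_vec 0 = 0\<close> by auto
  then show ?thesis using 1 2 3 x y by blast
qed

lemma Re_cev_mult:
  "Re (cev f (c *s complex_vec x + d *s complex_vec y) * cnj (cev g (c *s complex_vec x + d *s complex_vec y)))
    = (norm c)\<^sup>2 * ((f \<bullet> x) * (g \<bullet> x)) + (norm d)\<^sup>2 * ((f \<bullet> y) * (g \<bullet> y))
      + Re (c * cnj d) * ((f \<bullet> x) * (g \<bullet> y) + (f \<bullet> y) * (g \<bullet> x))"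
  unfolding cev_add_right cev_smult cev_complex_vec cmod_power2
  by (simp add: power2_eq_square algebra_simps)

lemma Re_cev_mult_pos:
  assumes "w \<noteq> 0" "w = c *s complex_vec x + d *s complex_vec y" "0 \<le> Re (c * cnj d)"
    and "0 < f \<bullet> x" "0 < f \<bullet> y" "0 < g \<bullet> x" "0 < g \<bullet> y"
  shows "0 < Re (cev f w * cnj (cev g w))"
proof -
  have "0 \<le> Re (c * cnj d) * ((f \<bullet> x) * (g \<bullet> y) + (f \<bullet> y) * (g \<bullet> x))"
    using assms by (intro mult_nonneg_nonneg add_nonneg_nonneg) auto
  moreover have "c \<noteq> 0 \<or> d \<noteq> 0" using assms(1,2) by auto
  then have "0 < (norm c)\<^sup>2 * ((f \<bullet> x) * (g \<bullet> x)) + (norm d)\<^sup>2 * ((f \<bullet> y) * (g \<bullet> y))"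
    using assms(4-7) by (cases "c = 0") (auto intro!: add_pos_nonneg)
  ultimately show ?thesis unfolding assms(2) Re_cev_mult by linarith
qed

lemma elliptic_tube_avoids_hyperplane:
  "elliptic_tube D \<subseteq> - proj_hyperplane (complex_vec l)"
proof
  fix p assume p: "p \<in> elliptic_tube D"
  obtain w where w: "w \<noteq> 0" "p = proj w" by (rule proj_cases)
  then obtain x y c d where xy: "x \<in> C" "y \<in> C" "w = c *s complex_vec x + d *s complex_vec y" "0 \<le> Re (c * cnj d)"
    using p elliptic_tube_memD[of w] by metis
  have "0 < Re (cev l w * cnj (cev l w))"
    by (rule Re_cev_mult_pos[OF w(1) xy(3,4)]) (use xy in \<open>auto simp: C_def\<close>)
  then have "cev l w \<noteq> 0" by auto
  then show "p \<in> - proj_hyperplane (complex_vec l)" using w proj_mem_hyperplane_iff[OF w(1)] by simp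
qed

lemma elliptic_tube_open_iff:
  assumes o: "open (cone_over D)" and w: "w \<noteq> 0"
  shows "proj w \<in> elliptic_tube D \<longleftrightarrow>
    (\<forall>f\<in>dual_cone C \<inter> sphere 0 1. \<forall>g\<in>dual_cone C \<inter> sphere 0 1. 0 < Re (cev f w * cnj (cev g w)))"
    (is "_ \<longleftrightarrow> ?R")
proof
  assume "proj w \<in> elliptic_tube D"
  then obtain x y c d where xy: "x \<in> C" "y \<in> C" "w = c *s complex_vec x + d *s complex_vec y" "0 \<le> Re (c * cnj d)"
    using elliptic_tube_memD[OF w] by metis
  have "0 < f \<bullet> x \<and> 0 < f \<bullet> y" if "f \<in> dual_cone C \<inter> sphere 0 1" for f
    using dual_cone_pos[OF o, of f] that xy by force
  then show ?R using Re_cev_mult_pos[OF w xy(3,4)] by blast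
next
  assume R: ?R
  let ?S = "dual_cone C \<inter> sphere 0 1"
  have "(1 / norm l) *\<^sub>R l \<in> ?S" using l_nonzero dual_cone_scale[OF l_in_dual] by simp
  then have "(\<lambda>f. cev f w) ` ?S \<noteq> {}" by blast
  moreover have "compact ((\<lambda>f. cev f w) ` ?S)"
    by (intro compact_continuous_image continuous_intros compact_dual_cone)
  ultimately obtain c where c: "norm c = 1" "\<forall>z\<in>(\<lambda>f. cev f w) ` ?S. 0 < Re (c * z) \<and> 0 < Im (c * z)"
    using ex_rotation_into_quadrant[of "(\<lambda>f. cev f w) ` ?S"] R by auto
  \<comment> \<open>The real forms take at \<open>x\<close> and \<open>y\<close> the real and
    imaginary parts of their values at \<open>c *s w\<close>; these are positive, so the bipolar
    theorem puts \<open>x\<close> and \<open>y\<close> into \<open>C\<close>.\<close>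
  define x y where "x = (\<chi> i. Re ((c *s w) $ i))" "y = (\<chi> i. Im ((c *s w) $ i))"
  have "0 < f \<bullet> x \<and> 0 < f \<bullet> y" if "f \<in> dual_cone C" "norm f = 1" for f
    using c(2) that unfolding x_y_def cev_Re_Im[symmetric] cev_smult by auto
  then have "x \<in> C" "y \<in> C" by (auto intro: bidual_open[OF o])
  moreover have "c *s w = complex_vec x + \<i> *s complex_vec y"
    unfolding x_y_def by (rule complex_vec_Re_Im)
  ultimately show "proj w \<in> elliptic_tube D" using c(1) w by (intro elliptic_tube_memI[of x y w c]) auto
qed

text \<open>For closed cones the inequalities are not strict; the rotation into the closed quadrant is a
  limit of rotations for the functionals perturbed by multiples of \<open>l\<close>.\<close>

lemma elliptic_tube_closed_iff:
  assumes cl: "closed (insert 0 (cone_over D))" and w: "w \<noteq> 0"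
  shows "proj w \<in> elliptic_tube D \<longleftrightarrow>
    cev l w \<noteq> 0 \<and> (\<forall>f\<in>dual_cone C. \<forall>g\<in>dual_cone C. 0 \<le> Re (cev f w * cnj (cev g w)))"
    (is "_ \<longleftrightarrow> ?R")
proof
  assume "proj w \<in> elliptic_tube D"
  then obtain x y c d where xy: "x \<in> C" "y \<in> C" "w = c *s complex_vec x + d *s complex_vec y" "0 \<le> Re (c * cnj d)"
    using elliptic_tube_memD[OF w] by metis
  have "0 < Re (cev l w * cnj (cev l w))"
    by (rule Re_cev_mult_pos[OF w xy(3,4)]) (use xy in \<open>auto simp: C_def\<close>)
  then have "cev l w \<noteq> 0" by auto
  moreover have "0 \<le> Re (cev f w * cnj (cev g w))" if "f \<in> dual_cone C" "g \<in> dual_cone C" for f g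
    unfolding xy(3) Re_cev_mult using that xy
    by (intro add_nonneg_nonneg mult_nonneg_nonneg) (auto simp: dual_cone_def)
  ultimately show ?R by blast
next
  assume R: ?R
  let ?S = "dual_cone C \<inter> sphere 0 1"
  have S: "?S \<noteq> {}" using l_nonzero dual_cone_scale[OF l_in_dual, of "1 / norm l"] by (intro exI[of _ "(1 / norm l) *\<^sub>R l"] ex_in_conv[THEN iffD1]) simp
  define \<epsilon> where "\<epsilon> n = 1 / (real n + 1)" for n
  have \<epsilon>: "\<epsilon> n > 0" for n by (simp add: \<epsilon>_def)
  have "\<exists>c. norm c = 1 \<and> (\<forall>f\<in>?S. 0 < Re (c * (cev f w + of_real (\<epsilon> n) * cev l w)) \<and>
      0 < Im (c * (cev f w + of_real (\<epsilon> n) * cev l w)))" for n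
  proof -
    let ?Z = "(\<lambda>f. cev f w + of_real (\<epsilon> n) * cev l w) ` ?S"
    have "compact ?Z" by (intro compact_continuous_image continuous_intros compact_dual_cone)
    moreover have "0 < Re (z * cnj z')" if zz: "z \<in> ?Z" "z' \<in> ?Z" for z z'
    proof -
      obtain f g where fg: "f \<in> dual_cone C" "g \<in> dual_cone C"
        "z = cev f w + of_real (\<epsilon> n) * cev l w" "z' = cev g w + of_real (\<epsilon> n) * cev l w"
        using zz by blast
      \<comment> \<open>The first three terms are nonnegative because \<open>l\<close> belongs to
        the dual cone, and the last is positive because \<open>cev l w \<noteq> 0\<close>.\<close>
      have "Re (z * cnj z') = Re (cev f w * cnj (cev g w)) + \<epsilon> n * Re (cev f w * cnj (cev l w))
          + \<epsilon> n * Re (cev l w * cnj (cev g w)) + (\<epsilon> n)\<^sup>2 * (norm (cev l w))\<^sup>2"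
        unfolding fg(3,4) cmod_power2 by (simp add: power2_eq_square algebra_simps)
      moreover have "0 < (\<epsilon> n)\<^sup>2 * (norm (cev l w))\<^sup>2" using R \<epsilon>[of n] by simp
      moreover have "0 \<le> Re (cev f w * cnj (cev g w))" "0 \<le> \<epsilon> n * Re (cev f w * cnj (cev l w))"
        "0 \<le> \<epsilon> n * Re (cev l w * cnj (cev g w))"
        using R fg(1,2) l_in_dual \<epsilon>[of n] by (auto intro!: mult_nonneg_nonneg simp del: complex_cnj_mult)
      ultimately show ?thesis by linarith
    qed
    ultimately show ?thesis using ex_rotation_into_quadrant[of ?Z] S by auto
  qed
  then obtain c where c: "\<And>n. norm (c n) = 1"
    "\<And>n f. f \<in> ?S \<Longrightarrow> 0 < Re (c n * (cev f w + of_real (\<epsilon> n) * cev l w)) \<and>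
      0 < Im (c n * (cev f w + of_real (\<epsilon> n) * cev l w))"
    by metis
  have "\<forall>n. c n \<in> sphere 0 1" using c(1) by simp
  then obtain c' r where c': "c' \<in> sphere 0 1" "strict_mono r" "(c \<circ> r) \<longlonglongrightarrow> c'"
    using compact_sphere[of "0::complex" 1] unfolding compact_eq_seq_compact_metric seq_compact_def by metis
  have "\<epsilon> \<longlonglongrightarrow> 0" unfolding \<epsilon>_def
    using LIMSEQ_Suc[OF lim_const_over_n[of "1::real"]] by (simp add: add.commute)
  then have er: "(\<epsilon> \<circ> r) \<longlonglongrightarrow> 0" by (rule LIMSEQ_subseq_LIMSEQ[OF _ c'(2)])
  have lim: "(\<lambda>n. (c \<circ> r) n * (cev f w + of_real ((\<epsilon> \<circ> r) n) * cev l w)) \<longlonglongrightarrow> c' * (cev f w + of_real 0 * cev l w)" for f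
    by (intro tendsto_intros c'(3) er)
  have unit: "0 \<le> Re (c' * cev f w) \<and> 0 \<le> Im (c' * cev f w)" if f: "f \<in> ?S" for f
  proof -
    have "0 \<le> Re (c' * (cev f w + of_real 0 * cev l w))"
      by (rule tendsto_lowerbound[OF tendsto_Re[OF lim[of f]]])
        (use c(2)[OF f] in \<open>auto intro!: always_eventually less_imp_le\<close>)
    moreover have "0 \<le> Im (c' * (cev f w + of_real 0 * cev l w))"
      by (rule tendsto_lowerbound[OF tendsto_Im[OF lim[of f]]])
        (use c(2)[OF f] in \<open>auto intro!: always_eventually less_imp_le\<close>)
    ultimately show ?thesis by simp
  qed
  define x y where "x = (\<chi> i. Re ((c' *s w) $ i))" "y = (\<chi> i. Im ((c' *s w) $ i))"
  have "0 \<le> f \<bullet> x \<and> 0 \<le> f \<bullet> y" if f: "f \<in> dual_cone C" for f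
  proof (cases "f = 0")
    case False
    then have "(1 / norm f) *\<^sub>R f \<in> ?S" using dual_cone_scale[OF f, of "1 / norm f"] by simp
    from unit[OF this]
    have "0 \<le> ((1 / norm f) *\<^sub>R f) \<bullet> x \<and> 0 \<le> ((1 / norm f) *\<^sub>R f) \<bullet> y"
      unfolding x_y_def cev_Re_Im[symmetric] cev_smult .
    then show ?thesis using False by (simp add: zero_le_divide_iff)
  qed simp
  then have "x \<in> insert 0 C" "y \<in> insert 0 C" using bidual_closed[OF cl] by blast+
  moreover have "c' *s w = complex_vec x + \<i> *s complex_vec y"
    unfolding x_y_def by (rule complex_vec_Re_Im)
  moreover have "c' \<noteq> 0" using c'(1) by auto
  ultimately show "proj w \<in> elliptic_tube D" using w by (intro elliptic_tube_memI[of x y w c'])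
qed

end

section \<open>Elliptic tubes in affine charts\<close>

text \<open>A nonconstant affine function on a complex line has a zero. Applied to \<open>l\<close>,
  which has no zero on the chart.\<close>

lemma affine_Cn_nonvanishing_constant:
  assumes q: "affine_Cn q" and nz: "\<And>z. q z \<noteq> 0"
  shows "q z = q 0"
proof -
  obtain m where m: "\<And>t. q (0 + t *s z) = q 0 + t * m" using affine_Cn_line[OF q] by metis
  have "m = 0"
  proof (rule ccontr)
    assume "m \<noteq> 0"
    then show False using m[of "- q 0 / m"] nz by simp
  qed
  then show ?thesis using m[of 1] by simp
qed

locale tube_chart = tube_cone D l
  for D :: "(real, 'n::finite) projective set" and l :: "real ^ 'n option" +
  fixes A :: "complex ^ 'n option ^ 'n option" and \<phi> :: "complex ^ 'n \<Rightarrow> (complex, 'n) projective"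
  assumes invertible: "invertible A" and \<phi>: "\<phi> = (\<lambda>z. proj (A *v homogenize z))"
    and range_\<phi>: "range \<phi> = - proj_hyperplane (complex_vec l)"
begin

definition W :: "complex ^ 'n \<Rightarrow> complex ^ 'n option" where
  "W z = A *v homogenize z"

definition \<kappa> :: complex where
  "\<kappa> = cev l (W 0)"

text \<open>The complex matrix \<open>A\<close> is arbitrary, so \<open>l\<close> has some nonzero
  complex constant value \<open>\<kappa>\<close> on the chart; dividing by it makes
  \<open>a l\<close> equal to 1.\<close>

definition a :: "real ^ 'n option \<Rightarrow> complex ^ 'n \<Rightarrow> complex" where
  "a f z = cev f (W z) / \<kappa>"

lemma W_nonzero: "W z \<noteq> 0"
proof
  assume "W z = 0"
  obtain B where "B ** A = mat 1" using invertible unfolding invertible_def by blast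
  then have "homogenize z = B *v W z" by (simp add: W_def matrix_vector_mul_assoc)
  then have "homogenize z $ None = 0" using \<open>W z = 0\<close> by simp
  then show False by (simp add: homogenize_def)
qed

lemma affine_W: "affine_Cn (\<lambda>z. W z $ i)"
proof -
  have "affine_Cn (\<lambda>z::complex ^ 'n. homogenize z $ j)" for j
    by (cases j) (simp_all add: homogenize_def affine_Cn_coord)
  then show ?thesis unfolding W_def matrix_vector_mult_def
    by (simp add: affine_Cn_sum affine_Cn_cmult)
qed

lemma affine_a: "affine_Cn (a f)"
proof -
  have "a f = (\<lambda>z. (1 / \<kappa>) * (\<Sum>i\<in>UNIV. of_real (f $ i) * W z $ i))"
    by (simp add: a_def[abs_def] cev_def)
  then show ?thesis by (simp only:) (intro affine_Cn_cmult affine_Cn_sum affine_W)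
qed

lemma cev_l_W: "cev l (W z) = \<kappa>" and \<kappa>_nonzero: "\<kappa> \<noteq> 0"
proof -
  have nz: "cev l (W z) \<noteq> 0" for z
  proof -
    have "proj (W z) \<notin> proj_hyperplane (complex_vec l)" using range_\<phi> by (auto simp: \<phi> W_def)
    then show ?thesis using proj_mem_hyperplane_iff[OF W_nonzero] by blast
  qed
  have "affine_Cn (\<lambda>z. cev l (W z))"
    unfolding cev_def by (intro affine_Cn_sum affine_Cn_cmult affine_W)
  then show "cev l (W z) = \<kappa>" unfolding \<kappa>_def using nz by (rule affine_Cn_nonvanishing_constant)
  show "\<kappa> \<noteq> 0" unfolding \<kappa>_def by (rule nz)
qed

lemma a_l: "a l z = 1"
  by (simp add: a_def cev_l_W \<kappa>_nonzero)

lemma a_scaleR: "a (c *\<^sub>R f) z = of_real c * a f z"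
  by (simp add: a_def cev_scaleR_left)

lemma Re_a_mult: "Re (a f z * cnj (a g z)) = Re (cev f (W z) * cnj (cev g (W z))) / (norm \<kappa>)\<^sup>2"
proof -
  have "a f z * cnj (a g z) = (cev f (W z) * cnj (cev g (W z))) / (\<kappa> * cnj \<kappa>)" by (simp add: a_def)
  also have "\<kappa> * cnj \<kappa> = of_real ((norm \<kappa>)\<^sup>2)" by (rule complex_norm_square[symmetric])
  finally show ?thesis by (simp only: Re_divide_of_real)
qed

lemma bounded_if_bounded_coordinates: "bounded {z. \<forall>i. norm (W z $ i) \<le> b i}"
proof -
  obtain B where B: "B ** A = mat 1" using invertible unfolding invertible_def by blast
  have "norm z \<le> (\<Sum>j\<in>UNIV. \<Sum>i\<in>UNIV. norm (B $ Some j $ i) * b i)" if z: "\<forall>i. norm (W z $ i) \<le> b i" for z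
  proof -
    have hom: "homogenize z = B *v W z" using B by (simp add: W_def matrix_vector_mul_assoc)
    have "norm (z $ j) \<le> (\<Sum>i\<in>UNIV. norm (B $ Some j $ i) * b i)" for j
    proof -
      have "z $ j = homogenize z $ Some j" by (simp add: homogenize_def)
      also have "\<dots> = (\<Sum>i\<in>UNIV. B $ Some j $ i * W z $ i)" unfolding hom by (simp add: matrix_vector_mult_def)
      finally have "norm (z $ j) \<le> (\<Sum>i\<in>UNIV. norm (B $ Some j $ i * W z $ i))" by (simp add: norm_sum)
      also have "\<dots> \<le> (\<Sum>i\<in>UNIV. norm (B $ Some j $ i) * b i)"
        unfolding norm_mult using z by (intro sum_mono mult_left_mono) auto
      finally show ?thesis .
    qed
    moreover have "norm z \<le> (\<Sum>j\<in>UNIV. norm (z $ j))"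
      unfolding norm_vec_def by (rule L2_set_le_sum) simp
    ultimately show ?thesis by (meson order.trans sum_mono)
  qed
  then show ?thesis unfolding bounded_iff by blast
qed

text \<open>The center \<open>v\<close> is the chart coordinate of a real point \<open>x\<close> of
  \<open>C\<close>; there \<open>a f v\<close> is the positive real
  \<open>(f \<bullet> x) / (l \<bullet> x)\<close>.\<close>

lemma affine_tube_open:
  assumes o: "open D"
  obtains v where "affine_tube (dual_cone C \<inter> sphere 0 1) a ((1 / norm l) *\<^sub>R l) (1 / norm l) v"
proof -
  let ?S = "dual_cone C \<inter> sphere 0 1"
  have oX: "open (cone_over D)" using open_cone_over[OF o] .
  obtain x where x: "x \<in> C" using C_nonempty by blast
  have lx: "l \<bullet> x > 0" using x by (simp add: C_def)
  have cx: "complex_vec x \<noteq> 0" using x zero_notin_C by (auto simp: complex_vec_eq_0)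
  have "cev l (complex_vec x) \<noteq> 0" using lx by (simp add: cev_complex_vec)
  then have "proj (complex_vec x) \<in> range \<phi>"
    unfolding range_\<phi> using proj_mem_hyperplane_iff[OF cx] by blast
  then obtain v where v: "proj (W v) = proj (complex_vec x)" by (auto simp: \<phi> W_def)
  then obtain k where k: "complex_vec x = k *s W v" using proj_eq_iff[OF W_nonzero cx] by blast
  have fx: "of_real (f \<bullet> x) = k * cev f (W v)" for f
    using cev_complex_vec[of f x] unfolding k cev_smult by simp
  have k\<kappa>: "k * \<kappa> = of_real (l \<bullet> x)" using fx[of l] cev_l_W by simp
  have av: "a f v = of_real ((f \<bullet> x) / (l \<bullet> x))" for f
  proof -
    have "k \<noteq> 0" using k\<kappa> lx by auto
    then have "a f v = (k * cev f (W v)) / (k * \<kappa>)" by (simp add: a_def)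
    then show ?thesis unfolding fx[symmetric] k\<kappa> by simp
  qed
  have bnd: "bounded {z. \<forall>f\<in>?S. norm (a f z) \<le> M}" for M
  proof -
    \<comment> \<open>Bounds on the forms in \<open>?S\<close> extend to their span, which is the
      whole space and thus contains the coordinate forms \<open>axis i 1\<close>.\<close>
    have "\<exists>b. \<forall>z. (\<forall>f\<in>?S. norm (a f z) \<le> M) \<longrightarrow> norm (cev u (W z)) \<le> b" if "u \<in> span ?S" for u
      using that
    proof (induction rule: span_induct_alt)
      case base
      then show ?case by (intro exI[of _ 0]) (simp add: cev_def)
    next
      case (step c f u)
      then obtain b where b: "\<And>z. \<forall>f\<in>?S. norm (a f z) \<le> M \<Longrightarrow> norm (cev u (W z)) \<le> b" by blast
      have "norm (cev (c *\<^sub>R f + u) (W z)) \<le> \<bar>c\<bar> * (M * norm \<kappa>) + b"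
        if z: "\<forall>f\<in>?S. norm (a f z) \<le> M" for z
      proof -
        have "cev f (W z) = a f z * \<kappa>" using \<kappa>_nonzero by (simp add: a_def)
        then have "norm (cev f (W z)) \<le> M * norm \<kappa>"
          using z step(1) by (simp add: norm_mult mult_right_mono)
        then have "\<bar>c\<bar> * norm (cev f (W z)) \<le> \<bar>c\<bar> * (M * norm \<kappa>)" by (intro mult_left_mono) auto
        moreover have "norm (cev (c *\<^sub>R f + u) (W z)) \<le> \<bar>c\<bar> * norm (cev f (W z)) + norm (cev u (W z))"
          unfolding cev_add_left cev_scaleR_left by (rule order.trans[OF norm_triangle_ineq]) (simp add: norm_mult)
        ultimately show ?thesis using b[OF z] by linarith
      qed
      then show ?case by blast
    qed
    then have "\<exists>b. \<forall>z. (\<forall>f\<in>?S. norm (a f z) \<le> M) \<longrightarrow> norm (W z $ i) \<le> b" for i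
      using span_dual_cone[OF oX] by (metis UNIV_I cev_axis)
    then obtain b where "\<And>i z. \<forall>f\<in>?S. norm (a f z) \<le> M \<Longrightarrow> norm (W z $ i) \<le> b i" by metis
    then show ?thesis by (intro bounded_subset[OF bounded_if_bounded_coordinates[of b]]) auto
  qed
  have "affine_tube ?S a ((1 / norm l) *\<^sub>R l) (1 / norm l) v"
  proof
    show "compact ?S" by (rule compact_dual_cone)
    show "(1 / norm l) *\<^sub>R l \<in> ?S" using l_nonzero dual_cone_scale[OF l_in_dual] by simp
    show "affine_Cn (a f)" for f by (rule affine_a)
    have "continuous_on UNIV (\<lambda>z. \<chi> i. W z $ i)"
      by (intro continuous_on_vec_lambda affine_Cn_continuous_on affine_W)
    then have "continuous_on UNIV W" by simp
    then have "continuous_on UNIV (\<lambda>x. W (fst x))"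
      by (rule continuous_on_compose2) (auto intro: continuous_intros)
    then show "continuous_on UNIV (\<lambda>(z, f). a f z)"
      unfolding a_def cev_def split_beta using \<kappa>_nonzero by (intro continuous_intros) auto
    show "a ((1 / norm l) *\<^sub>R l) z = of_real (1 / norm l)" for z by (simp only: a_scaleR a_l mult_1_right)
    show "0 < 1 / norm l" using l_nonzero by simp
    show "bounded {z. \<forall>f\<in>?S. norm (a f z) \<le> M}" for M by (rule bnd)
    show "\<exists>r>0. a f v = of_real r" if "f \<in> ?S" for f
    proof -
      have "f \<bullet> x > 0" using dual_cone_pos[OF oX, of f] that x by force
      then show ?thesis using av lx by (intro exI[of _ "(f \<bullet> x) / (l \<bullet> x)"]) auto
    qed
  qed
  then show thesis by (rule that)
qed

lemma vimage_elliptic_tube_open: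
  assumes "open D"
  shows "\<phi> -` elliptic_tube D =
    {z. \<forall>f\<in>dual_cone C \<inter> sphere 0 1. \<forall>g\<in>dual_cone C \<inter> sphere 0 1. 0 < Re (a f z * cnj (a g z))}"
  using elliptic_tube_open_iff[OF open_cone_over[OF assms] W_nonzero] \<kappa>_nonzero
  by (auto simp: \<phi> W_def[symmetric] Re_a_mult zero_less_divide_iff simp del: times_complex.sel)

lemma vimage_elliptic_tube_compact:
  assumes "compact D"
  shows "\<phi> -` elliptic_tube D =
    {z. \<forall>f\<in>dual_cone C. \<forall>g\<in>dual_cone C. 0 \<le> Re (a f z * cnj (a g z))}"
  using elliptic_tube_closed_iff[OF closed_cone_over[OF assms] W_nonzero] \<kappa>_nonzero cev_l_W
  by (auto simp: \<phi> W_def[symmetric] Re_a_mult zero_le_divide_iff simp del: times_complex.sel)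

text \<open>For boundedness, \<open>l\<close> is interior to the dual cone, so \<open>l + u\<close>
  and \<open>l - u\<close> belong to it for small multiples \<open>u\<close> of coordinate forms.
  With \<open>x = a u z\<close>, the inequality for this pair is
  \<open>0 \<le> Re ((1 + x) * cnj (1 - x)) = 1 - (norm x)\<^sup>2\<close>.\<close>

lemma elliptic_tube_compact_polynomially_convex:
  assumes c: "compact D"
  shows "compact_polynomially_convex (\<phi> -` elliptic_tube D)"
  unfolding vimage_elliptic_tube_compact[OF c]
proof (rule compact_tube_polynomially_convex[where a = a and e = l, OF affine_a l_in_dual a_l])
  let ?Z = "{z. \<forall>f\<in>dual_cone C. \<forall>g\<in>dual_cone C. 0 \<le> Re (a f z * cnj (a g z))}"
  have "?Z = (\<Inter>f\<in>dual_cone C. \<Inter>g\<in>dual_cone C. {z. 0 \<le> Re (a f z * cnj (a g z))})" by auto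
  moreover have "closed {z. 0 \<le> Re (a f z * cnj (a g z))}" for f g
    by (intro closed_Collect_le continuous_intros affine_Cn_continuous_on affine_a)
  ultimately have "closed ?Z" by (simp only:) (intro closed_INT ballI)
  obtain m where m: "m > 0" "\<And>u. norm u \<le> m \<Longrightarrow> l + u \<in> dual_cone C"
    using l_interior_dual_cone[OF closed_cone_over[OF c]] by metis
  have "norm (W z $ i) \<le> norm \<kappa> / m" if z: "z \<in> ?Z" for z i
  proof -
    define u :: "real ^ 'n option" where "u = m *\<^sub>R axis i 1"
    have "norm u \<le> m" "norm (- u) \<le> m" using m(1) by (simp_all add: u_def)
    then have "l + u \<in> dual_cone C" "l - u \<in> dual_cone C" using m(2)[of u] m(2)[of "- u"] by auto
    then have "0 \<le> Re (a (l + u) z * cnj (a (l - u) z))" using z by blast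
    moreover have "a (l + u) z = 1 + a u z" "a (l - u) z = 1 - a u z"
      using a_l[of z] by (simp_all add: a_def cev_add_left cev_diff_left add_divide_distrib diff_divide_distrib)
    moreover have "Re ((1 + x) * cnj (1 - x)) = 1 - (norm x)\<^sup>2" for x
      unfolding cmod_power2 by (simp add: power2_eq_square algebra_simps)
    ultimately have "0 \<le> 1 - (norm (a u z))\<^sup>2" by (simp only:)
    then have "norm (a u z) \<le> 1" by (simp add: power2_le_imp_le abs_square_le_1)
    moreover have "a u z = of_real m * W z $ i / \<kappa>" by (simp add: u_def a_def cev_scaleR_left cev_axis)
    ultimately have "m * norm (W z $ i) / norm \<kappa> \<le> 1" using m(1) by (simp add: norm_divide norm_mult)
    then show ?thesis using m(1) \<kappa>_nonzero by (simp add: field_simps)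
  qed
  then have "bounded ?Z"
    by (intro bounded_subset[OF bounded_if_bounded_coordinates[of "\<lambda>_. norm \<kappa> / m"]]) blast
  with \<open>closed ?Z\<close> show "compact ?Z" by (simp only: compact_eq_bounded_closed)
qed

end

lemma disjoint_hyperplane_iff:
  fixes D :: "(real, 'n::finite) projective set"
  shows "D \<inter> proj_hyperplane l = {} \<longleftrightarrow> (\<forall>x\<in>cone_over D. l \<bullet> x \<noteq> 0)"
proof -
  have "(\<Sum>i\<in>UNIV. l $ i * v $ i) = l \<bullet> v" for v by (simp add: inner_vec_def)
  then show ?thesis unfolding proj_hyperplane_def cone_over_def by auto
qed

theorem corollary3p7:
  fixes D :: "(real, 'n::finite) projective set"
  assumes "properly_convex D"
  shows
    "(open D \<longrightarrow>
       (\<exists>l. l \<noteq> 0 \<and> D \<inter> proj_hyperplane l = {}) \<and>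
       (\<forall>l \<phi>. l \<noteq> 0 \<and> D \<inter> proj_hyperplane l = {} \<and> affine_chart (complex_vec l) \<phi> \<longrightarrow>
          elliptic_tube D \<subseteq> - proj_hyperplane (complex_vec l) \<and>
          open (\<phi> -` elliptic_tube D) \<and>
          pseudoconvex (\<phi> -` elliptic_tube D) \<and>
          holomorphically_convex (\<phi> -` elliptic_tube D) \<and>
          domain_of_holomorphy (\<phi> -` elliptic_tube D) \<and>
          open_polynomially_convex (\<phi> -` elliptic_tube D) \<and>
          Runge_domain (\<phi> -` elliptic_tube D) \<and>
          linear_fraction_convex (\<phi> -` elliptic_tube D))) \<and>
     (compact D \<longrightarrow>
       (\<exists>l. l \<noteq> 0 \<and> D \<inter> proj_hyperplane l = {}) \<and>
       (\<forall>l \<phi>. l \<noteq> 0 \<and> D \<inter> proj_hyperplane l = {} \<and> affine_chart (complex_vec l) \<phi> \<longrightarrow>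
          elliptic_tube D \<subseteq> - proj_hyperplane (complex_vec l) \<and>
          compact_polynomially_convex (\<phi> -` elliptic_tube D)))"
proof -
  interpret double_cone "cone_over D" by (rule double_cone_cone_over[OF assms])
  have ex: "\<exists>l. l \<noteq> 0 \<and> D \<inter> proj_hyperplane l = {}" if "open D \<or> compact D"
    using ex_functional that open_cone_over closed_cone_over unfolding disjoint_hyperplane_iff by blast
  have cone: "tube_cone D l" if "D \<inter> proj_hyperplane l = {}" for l
    using that unfolding disjoint_hyperplane_iff by unfold_locales blast
  have avoid: "elliptic_tube D \<subseteq> - proj_hyperplane (complex_vec l)" if "D \<inter> proj_hyperplane l = {}" for l
    using cone[OF that] by (rule tube_cone.elliptic_tube_avoids_hyperplane)
  have chart: "\<exists>A. tube_chart D l A \<phi>"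
    if "D \<inter> proj_hyperplane l = {}" "affine_chart (complex_vec l) \<phi>" for l \<phi>
    using cone[OF that(1)] that(2)
    by (auto simp: affine_chart_def tube_chart_def tube_chart_axioms_def)
  have comp: "compact_polynomially_convex (\<phi> -` elliptic_tube D)"
    if "compact D" "D \<inter> proj_hyperplane l = {}" "affine_chart (complex_vec l) \<phi>" for l \<phi>
    using chart[OF that(2,3)] tube_chart.elliptic_tube_compact_polynomially_convex[OF _ that(1)] by blast
  have opn: "open (\<phi> -` elliptic_tube D) \<and> pseudoconvex (\<phi> -` elliptic_tube D) \<and>
      holomorphically_convex (\<phi> -` elliptic_tube D) \<and> domain_of_holomorphy (\<phi> -` elliptic_tube D) \<and>
      open_polynomially_convex (\<phi> -` elliptic_tube D) \<and> Runge_domain (\<phi> -` elliptic_tube D) \<and>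
      linear_fraction_convex (\<phi> -` elliptic_tube D)"
    if o: "open D" and h: "D \<inter> proj_hyperplane l = {}" and ch: "affine_chart (complex_vec l) \<phi>" for l \<phi>
  proof -
    obtain A where "tube_chart D l A \<phi>" using chart[OF h ch] by blast
    then interpret tube_chart D l A \<phi> .
    obtain v where "affine_tube (dual_cone C \<inter> sphere 0 1) a ((1 / norm l) *\<^sub>R l) (1 / norm l) v"
      using affine_tube_open[OF o] .
    then interpret T: affine_tube "dual_cone C \<inter> sphere 0 1" a "(1 / norm l) *\<^sub>R l" "1 / norm l" v .
    have "\<phi> -` elliptic_tube D = T.E"
      unfolding vimage_elliptic_tube_open[OF o] T.E_def ..
    then show ?thesis
      using T.open_E T.pseudoconvex_E T.holomorphically_convex_E T.domain_of_holomorphy_E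
        T.open_polynomially_convex_E T.Runge_domain_E T.linear_fraction_convex_E by simp
  qed
  show ?thesis using ex avoid comp opn by blast
qed

end
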